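(* Let $p\ge5$ be a prime, let $q=p^f$, and let $\mathfrak O$ be a compact discrete valuation ring with residue field of cardinality $q$. Let $d$ be a non-negative integer. Then $$\mathsf Z^{\mathsf{cc}}_{\mathsf F_{3,d}\otimes\mathfrak O}(T)=\frac{\Bigl(1-q^{\frac{(d-1)(d^2+d-3)}3}T\Bigr)\Bigl(1-q^{\frac{(d-2)d(d+2)}3}T\Bigr)}{\Bigl(1-q^{\frac{(d-1)d(d+1)}3}T\Bigr)\Bigl(1-q^{\frac{d^3-d+3}3}T\Bigr)\Bigl(1-q^{\frac{(2d^2+3d-11)d}6}T\Bigr)}.$$
   Context: Let $\mathfrak f_{3,d}$ be the free nilpotent Lie $\mathbf Z[1/6]$-algebra of class at most $3$ on $d$ generators (its underlying $\mathbf Z[1/6]$-module is free of finite rank). The associated unipotent group scheme $\mathsf F_{3,d}$ over $\mathbf Z[1/6]$ is given as follows: for each commutative $\mathbf Z[1/6]$-algebra $S$, the group $\mathsf F_{3,d}(S)$ has underlying set $\mathfrak f_{3,d}\otimes S$ and multiplication given by the Baker–Campbell–Hausdorff series, i.e. (in class at most $3$) $x*y=x+y+\frac12[x,y]+\frac1{12}\bigl([x,[x,y]]+[y,[y,x]]\bigr)$. Since $p\ge5$, $\mathfrak O$ is a $\mathbf Z[1/6]$-algebra; $\mathsf F_{3,d}\otimes\mathfrak O$ denotes base change to $\mathfrak O$. For a finite group $H$, $\mathrm k(H)$ denotes its number of conjugacy classes. Let $\mathfrak P$ be the maximal ideal of $\mathfrak O$. For a group scheme $\mathsf G$ of finite type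 over $\mathfrak O$, its class counting zeta function is $\mathsf Z^{\mathsf{cc}}_{\mathsf G}(T)=\sum_{n=0}^\infty \mathrm k(\mathsf G(\mathfrak O/\mathfrak P^n))T^n$. *)

theory Defs
  imports
    "HOL-Computational_Algebra.Primes"
    "HOL-Computational_Algebra.Formal_Power_Series"
    "HOL-Analysis.Abstract_Topology"
    "HOL-Algebra.Group_Action"
    "HOL-Algebra.Ideal_Product"
    "HOL-Algebra.Module"
    "HOL-Algebra.QuotRing"
    "HOL-Algebra.Ring_Divisibility"
begin

section \<open>Compact discrete valuation rings\<close>

locale discrete_valuation_ring = principal_domain +
  assumes not_field: "\<not> field R"
    and local: "\<exists>!I. maximalideal I R"

definition max_ideal :: "('a, 'b) ring_scheme \<Rightarrow> 'a set"
  where "max_ideal R = (THE I. maximalideal I R)"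

definition ideal_power :: "('a, 'b) ring_scheme \<Rightarrow> 'a set \<Rightarrow> nat \<Rightarrow> 'a set"
  where "ideal_power R I n = I [^]\<^bsub>ideals_set R\<^esub> n"

text \<open>The \<open>I\<close>-adic topology; the cosets of the powers of \<open>I\<close> form a basis of it.\<close>

definition adic_topology :: "('a, 'b) ring_scheme \<Rightarrow> 'a set \<Rightarrow> 'a topology"
  where "adic_topology R I =
    topology_generated_by {ideal_power R I n +>\<^bsub>R\<^esub> x | n x. x \<in> carrier R}"

locale compact_discrete_valuation_ring = discrete_valuation_ring +
  assumes compact: "compact_space (adic_topology R (max_ideal R))"


section \<open>The ring \<open>\<int>[1/6]\<close> and its algebras\<close>

definition Z_sixth :: "rat ring"
  where "Z_sixth =
    \<lparr>carrier = {of_int a / 6 ^ k | (a::int) (k::nat). True}, mult = (*), one = 1, zero = 0, add = (+)\<rparr>"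

text \<open>
  A commutative ring \<open>S\<close> is a \<open>\<int>[1/6]\<close>-algebra in at most one way, namely when 6 is a unit of
  \<open>S\<close>, and then the structure map sends the reduced fraction \<open>a/b\<close> to \<open>a b\<^sup>-\<^sup>1\<close>.
\<close>

definition Z_sixth_map :: "('a, 'b) ring_scheme \<Rightarrow> rat \<Rightarrow> 'a"
  where "Z_sixth_map S r = (case quotient_of r of (a, b) \<Rightarrow>
    add_pow S a \<one>\<^bsub>S\<^esub> \<otimes>\<^bsub>S\<^esub> inv\<^bsub>S\<^esub> (add_pow S b \<one>\<^bsub>S\<^esub>))"


section \<open>Free nilpotent Lie algebras\<close>

text \<open>
  A Lie algebra over \<open>A\<close> is represented by a module record over \<open>A\<close> whose (otherwise unused)
  multiplication field holds the Lie bracket; the field \<open>one\<close> has no meaning.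

  The free nilpotent Lie \<open>A\<close>-algebra of class at most \<open>c\<close> on \<open>d\<close> generators is the quotient of the
  algebra of formal Lie terms in \<open>d\<close> generators by the least congruence that enforces the axioms of
  a Lie \<open>A\<close>-algebra and the vanishing of all left-normed brackets of length \<open>c + 1\<close>.
\<close>

datatype 'r lie_term =
    Gen nat
  | LZero
  | LAdd "'r lie_term" "'r lie_term"
  | LSmult 'r "'r lie_term"
  | LBracket "'r lie_term" "'r lie_term"

inductive_set lie_terms :: "('r, 'm) ring_scheme \<Rightarrow> nat \<Rightarrow> 'r lie_term set"
  for A :: "('r, 'm) ring_scheme" and d :: nat where
  gen: "i < d \<Longrightarrow> Gen i \<in> lie_terms A d"
| zero: "LZero \<in> lie_terms A d"
| add: "s \<in> lie_terms A d \<Longrightarrow> t \<in> lie_terms A d \<Longrightarrow> LAdd s t \<in> lie_terms A d"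
| smult: "a \<in> carrier A \<Longrightarrow> t \<in> lie_terms A d \<Longrightarrow> LSmult a t \<in> lie_terms A d"
| bracket: "s \<in> lie_terms A d \<Longrightarrow> t \<in> lie_terms A d \<Longrightarrow> LBracket s t \<in> lie_terms A d"

inductive_set nil_lie_cong ::
    "('r, 'm) ring_scheme \<Rightarrow> nat \<Rightarrow> nat \<Rightarrow> ('r lie_term \<times> 'r lie_term) set"
  for A :: "('r, 'm) ring_scheme" and c :: nat and d :: nat where
  refl: "t \<in> lie_terms A d \<Longrightarrow> (t, t) \<in> nil_lie_cong A c d"
| sym: "(s, t) \<in> nil_lie_cong A c d \<Longrightarrow> (t, s) \<in> nil_lie_cong A c d"
| trans: "(s, t) \<in> nil_lie_cong A c d \<Longrightarrow> (t, u) \<in> nil_lie_cong A c d \<Longrightarrow>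
    (s, u) \<in> nil_lie_cong A c d"
| cong_add: "(s, s') \<in> nil_lie_cong A c d \<Longrightarrow> (t, t') \<in> nil_lie_cong A c d \<Longrightarrow>
    (LAdd s t, LAdd s' t') \<in> nil_lie_cong A c d"
| cong_smult: "a \<in> carrier A \<Longrightarrow> (t, t') \<in> nil_lie_cong A c d \<Longrightarrow>
    (LSmult a t, LSmult a t') \<in> nil_lie_cong A c d"
| cong_bracket: "(s, s') \<in> nil_lie_cong A c d \<Longrightarrow> (t, t') \<in> nil_lie_cong A c d \<Longrightarrow>
    (LBracket s t, LBracket s' t') \<in> nil_lie_cong A c d"
| add_assoc: "s \<in> lie_terms A d \<Longrightarrow> t \<in> lie_terms A d \<Longrightarrow> u \<in> lie_terms A d \<Longrightarrow>
    (LAdd (LAdd s t) u, LAdd s (LAdd t u)) \<in> nil_lie_cong A c d"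
| add_comm: "s \<in> lie_terms A d \<Longrightarrow> t \<in> lie_terms A d \<Longrightarrow>
    (LAdd s t, LAdd t s) \<in> nil_lie_cong A c d"
| add_zero: "t \<in> lie_terms A d \<Longrightarrow> (LAdd LZero t, t) \<in> nil_lie_cong A c d"
| add_neg: "t \<in> lie_terms A d \<Longrightarrow>
    (LAdd (LSmult (\<ominus>\<^bsub>A\<^esub> \<one>\<^bsub>A\<^esub>) t) t, LZero) \<in> nil_lie_cong A c d"
| smult_add_left: "a \<in> carrier A \<Longrightarrow> b \<in> carrier A \<Longrightarrow> t \<in> lie_terms A d \<Longrightarrow>
    (LSmult (a \<oplus>\<^bsub>A\<^esub> b) t, LAdd (LSmult a t) (LSmult b t)) \<in> nil_lie_cong A c d"
| smult_add_right: "a \<in> carrier A \<Longrightarrow> s \<in> lie_terms A d \<Longrightarrow> t \<in> lie_terms A d \<Longrightarrow>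
    (LSmult a (LAdd s t), LAdd (LSmult a s) (LSmult a t)) \<in> nil_lie_cong A c d"
| smult_assoc: "a \<in> carrier A \<Longrightarrow> b \<in> carrier A \<Longrightarrow> t \<in> lie_terms A d \<Longrightarrow>
    (LSmult (a \<otimes>\<^bsub>A\<^esub> b) t, LSmult a (LSmult b t)) \<in> nil_lie_cong A c d"
| smult_one: "t \<in> lie_terms A d \<Longrightarrow> (LSmult \<one>\<^bsub>A\<^esub> t, t) \<in> nil_lie_cong A c d"
| bracket_add_left: "s \<in> lie_terms A d \<Longrightarrow> t \<in> lie_terms A d \<Longrightarrow> u \<in> lie_terms A d \<Longrightarrow>
    (LBracket (LAdd s t) u, LAdd (LBracket s u) (LBracket t u)) \<in> nil_lie_cong A c d"
| bracket_add_right: "s \<in> lie_terms A d \<Longrightarrow> t \<in> lie_terms A d \<Longrightarrow> u \<in> lie_terms A d \<Longrightarrow>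
    (LBracket s (LAdd t u), LAdd (LBracket s t) (LBracket s u)) \<in> nil_lie_cong A c d"
| bracket_smult_left: "a \<in> carrier A \<Longrightarrow> s \<in> lie_terms A d \<Longrightarrow> t \<in> lie_terms A d \<Longrightarrow>
    (LBracket (LSmult a s) t, LSmult a (LBracket s t)) \<in> nil_lie_cong A c d"
| bracket_smult_right: "a \<in> carrier A \<Longrightarrow> s \<in> lie_terms A d \<Longrightarrow> t \<in> lie_terms A d \<Longrightarrow>
    (LBracket s (LSmult a t), LSmult a (LBracket s t)) \<in> nil_lie_cong A c d"
| alternating: "t \<in> lie_terms A d \<Longrightarrow> (LBracket t t, LZero) \<in> nil_lie_cong A c d"
| jacobi: "s \<in> lie_terms A d \<Longrightarrow> t \<in> lie_terms A d \<Longrightarrow> u \<in> lie_terms A d \<Longrightarrow>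
    (LAdd (LBracket s (LBracket t u))
       (LAdd (LBracket t (LBracket u s)) (LBracket u (LBracket s t))), LZero) \<in> nil_lie_cong A c d"
| nilpotent: "t \<in> lie_terms A d \<Longrightarrow> ts \<in> lists (lie_terms A d) \<Longrightarrow> length ts = c \<Longrightarrow>
    (foldl LBracket t ts, LZero) \<in> nil_lie_cong A c d"

definition free_nilpotent_lie ::
    "('r, 'm) ring_scheme \<Rightarrow> nat \<Rightarrow> nat \<Rightarrow> ('r, 'r lie_term set) module"
  where "free_nilpotent_lie A c d = (let E = nil_lie_cong A c d in
    \<lparr>carrier = lie_terms A d // E,
     mult = (\<lambda>X Y. \<Union>s\<in>X. \<Union>t\<in>Y. E `` {LBracket s t}),
     one = undefined,
     zero = E `` {LZero},
     add = (\<lambda>X Y. \<Union>s\<in>X. \<Union>t\<in>Y. E `` {LAdd s t}),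
     smult = (\<lambda>a X. \<Union>t\<in>X. E `` {LSmult a t})\<rparr>)"


section \<open>Base change of Lie algebras\<close>

text \<open>
  The tensor product \<open>L \<otimes>\<^sub>A S\<close> along a ring homomorphism \<open>\<phi>\<close> from \<open>A\<close> to \<open>S\<close>: its elements are the
  formal sums of pure tensors, given as lists of pairs, modulo the tensor relations.
\<close>

abbreviation tensor_sums :: "('s, 'n) ring_scheme \<Rightarrow> ('r, 'l, 'k) module_scheme \<Rightarrow> ('l \<times> 's) list set"
  where "tensor_sums S L \<equiv> lists (carrier L \<times> carrier S)"

inductive_set tensor_cong :: "('r, 'm) ring_scheme \<Rightarrow> ('r \<Rightarrow> 's) \<Rightarrow> ('s, 'n) ring_scheme \<Rightarrow>
    ('r, 'l, 'k) module_scheme \<Rightarrow> (('l \<times> 's) list \<times> ('l \<times> 's) list) set"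
  for A :: "('r, 'm) ring_scheme" and \<phi> :: "'r \<Rightarrow> 's" and S :: "('s, 'n) ring_scheme"
    and L :: "('r, 'l, 'k) module_scheme" where
  refl: "v \<in> tensor_sums S L \<Longrightarrow> (v, v) \<in> tensor_cong A \<phi> S L"
| sym: "(v, w) \<in> tensor_cong A \<phi> S L \<Longrightarrow> (w, v) \<in> tensor_cong A \<phi> S L"
| trans: "(u, v) \<in> tensor_cong A \<phi> S L \<Longrightarrow> (v, w) \<in> tensor_cong A \<phi> S L \<Longrightarrow>
    (u, w) \<in> tensor_cong A \<phi> S L"
| cong_append: "(v, v') \<in> tensor_cong A \<phi> S L \<Longrightarrow> (w, w') \<in> tensor_cong A \<phi> S L \<Longrightarrow>
    (v @ w, v' @ w') \<in> tensor_cong A \<phi> S L"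
| comm: "v \<in> tensor_sums S L \<Longrightarrow> w \<in> tensor_sums S L \<Longrightarrow>
    (v @ w, w @ v) \<in> tensor_cong A \<phi> S L"
| zero: "s \<in> carrier S \<Longrightarrow> ([(\<zero>\<^bsub>L\<^esub>, s)], []) \<in> tensor_cong A \<phi> S L"
| add_left: "x \<in> carrier L \<Longrightarrow> y \<in> carrier L \<Longrightarrow> s \<in> carrier S \<Longrightarrow>
    ([(x \<oplus>\<^bsub>L\<^esub> y, s)], [(x, s), (y, s)]) \<in> tensor_cong A \<phi> S L"
| add_right: "x \<in> carrier L \<Longrightarrow> s \<in> carrier S \<Longrightarrow> t \<in> carrier S \<Longrightarrow>
    ([(x, s \<oplus>\<^bsub>S\<^esub> t)], [(x, s), (x, t)]) \<in> tensor_cong A \<phi> S L"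
| balanced: "a \<in> carrier A \<Longrightarrow> x \<in> carrier L \<Longrightarrow> s \<in> carrier S \<Longrightarrow>
    ([(a \<odot>\<^bsub>L\<^esub> x, s)], [(x, \<phi> a \<otimes>\<^bsub>S\<^esub> s)]) \<in> tensor_cong A \<phi> S L"

definition base_change :: "('r, 'm) ring_scheme \<Rightarrow> ('r \<Rightarrow> 's) \<Rightarrow> ('s, 'n) ring_scheme \<Rightarrow>
    ('r, 'l, 'k) module_scheme \<Rightarrow> ('s, ('l \<times> 's) list set) module"
  where "base_change A \<phi> S L = (let E = tensor_cong A \<phi> S L in
    \<lparr>carrier = tensor_sums S L // E,
     mult = (\<lambda>X Y. \<Union>v\<in>X. \<Union>w\<in>Y. E `` {[(x \<otimes>\<^bsub>L\<^esub> y, s \<otimes>\<^bsub>S\<^esub> t). (x, s) \<leftarrow> v, (y, t) \<leftarrow> w]}),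
     one = undefined,
     zero = E `` {[]},
     add = (\<lambda>X Y. \<Union>v\<in>X. \<Union>w\<in>Y. E `` {v @ w}),
     smult = (\<lambda>a X. \<Union>v\<in>X. E `` {[(x, a \<otimes>\<^bsub>S\<^esub> s). (x, s) \<leftarrow> v]})\<rparr>)"


section \<open>The unipotent group scheme \<open>F\<^sub>3\<^sub>,\<^sub>d\<close>\<close>

text \<open>
  The Baker--Campbell--Hausdorff series as it reads in class at most 3; \<open>S\<close> is a
  \<open>\<int>[1/6]\<close>-algebra and \<open>L\<close> a Lie \<open>S\<close>-algebra, so \<open>\<otimes>\<^bsub>L\<^esub>\<close> is the bracket.
\<close>

definition BCH_group :: "('s, 'n) ring_scheme \<Rightarrow> ('s, 'l, 'k) module_scheme \<Rightarrow> 'l monoid"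
  where "BCH_group S L =
    \<lparr>carrier = carrier L,
     mult = (\<lambda>x y. x \<oplus>\<^bsub>L\<^esub> y
       \<oplus>\<^bsub>L\<^esub> (Z_sixth_map S (1/2) \<odot>\<^bsub>L\<^esub> (x \<otimes>\<^bsub>L\<^esub> y))
       \<oplus>\<^bsub>L\<^esub> (Z_sixth_map S (1/12) \<odot>\<^bsub>L\<^esub>
             ((x \<otimes>\<^bsub>L\<^esub> (x \<otimes>\<^bsub>L\<^esub> y)) \<oplus>\<^bsub>L\<^esub> (y \<otimes>\<^bsub>L\<^esub> (y \<otimes>\<^bsub>L\<^esub> x))))),
     one = \<zero>\<^bsub>L\<^esub>\<rparr>"

text \<open>
  Group schemes are given by their functors of points. Since a ring is a \<open>\<int>[1/6]\<close>-algebra in at most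
  one way, the base change of \<open>F\<^sub>3\<^sub>,\<^sub>d\<close> to a \<open>\<int>[1/6]\<close>-algebra \<open>R\<close> is given by the same functor,
  evaluated only at \<open>R\<close>-algebras.
\<close>

definition F3 :: "nat \<Rightarrow> ('s, 'n) ring_scheme \<Rightarrow> ((rat lie_term set \<times> 's) list set) monoid"
  where "F3 d S = BCH_group S (base_change Z_sixth (Z_sixth_map S) S (free_nilpotent_lie Z_sixth 3 d))"


section \<open>Class counting zeta functions\<close>

definition class_number :: "('g, 'm) monoid_scheme \<Rightarrow> nat"
  where "class_number H =
    card (orbits H (carrier H) (\<lambda>g. \<lambda>h\<in>carrier H. g \<otimes>\<^bsub>H\<^esub> h \<otimes>\<^bsub>H\<^esub> inv\<^bsub>H\<^esub> g))"

text \<open>Here \<open>G\<close> is the functor of points of a group scheme over the discrete valuation ring \<open>R\<close>.\<close>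

definition class_counting_zeta ::
    "('a, 'b) ring_scheme \<Rightarrow> ('a set ring \<Rightarrow> 'g monoid) \<Rightarrow> real fps"
  where "class_counting_zeta R G =
    Abs_fps (\<lambda>n. of_nat (class_number (G (R Quot (ideal_power R (max_ideal R) n)))))"

end

(* In class at most three x * y - y * x is the Lie bracket [x, y], so by Burnside's lemma the class
   number is determined by the number of pairs with [x, y] = 0. In coordinates with respect to a Hall
   basis, let x and y have components x_i, y_i in degree one and v_jk, w_jk in degree two. Then
   [x, y] = 0 means that the vectors (x_i) and (y_i) are proportional and that the tensor
   x_i w_jk - y_i v_jk is alternating. A tensor of rank at most two in one index is alternating only if
   it is zero; hence, independently for all j < k, the pair (w_jk, v_jk) runs through the syzygies of the
   degree-one parts.

   Over O/P^n let i be the valuation of (x_i). A shear turns the vectors (y_i) proportional to it into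
   arbitrary vectors modulo P^i (with multiplicity q^(n-i)), and if such a vector has valuation j, there
   are q^(n+j) syzygies. The resulting sum is an iterated convolution, so the zeta function is a product
   of three series: a geometric series and two generating functions of the numbers of primitive vectors
   modulo P^m, each of the form (1 - cT)/(1 - q^d cT). *)

theory Submission
  imports Defs "HOL-Decision_Procs.Commutative_Ring"
begin

section \<open>Free nilpotent Lie algebras of class three\<close>

text \<open>The Lie algebra and its base change are given only as quotients of formal terms and of
  formal sums, so nothing is known in advance about their size. That the Hall elements form a basis
  rests on two facts: they span, by induction on terms; and an explicit bracket on families of
  coordinates satisfies every defining relation, which gives coordinates that are well defined on
  classes and dual to the Hall elements. Both facts survive the tensor product, and from then on
  everything is computed in coordinates. In particular the truncated series is shown to be
  associative there, as a polynomial identity modulo 12 u = 1. Alternating tensors enter because the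
  degree-three part is V (x) Lambda^2 V modulo Lambda^3 V, with V spanned by the generators: for
  t_ijk = x_i w_jk - y_i v_jk and i different from j, the bracket has coordinate t_ijk + t_jik at
  [i, j, k]. Over O/P^n zero divisors rule out arguments by linear rank. Their substitute is a
  pivot: an entry of least valuation divides all other entries of its vector.\<close>

lemma nil_lie_cong_terms:
  assumes "ring A" "(s, t) \<in> nil_lie_cong A c d"
  shows "s \<in> lie_terms A d \<and> t \<in> lie_terms A d"
proof -
  interpret ring A by fact
  have foldl_terms: "foldl LBracket t ts \<in> lie_terms A d"
    if "t \<in> lie_terms A d" "ts \<in> lists (lie_terms A d)" for t ts
    using that by (induction ts arbitrary: t) (auto intro: lie_terms.intros)
  show ?thesis
    using assms(2)
    by (induction rule: nil_lie_cong.induct) (auto intro: lie_terms.intros foldl_terms)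
qed

lemma equiv_nil_lie_cong:
  assumes "ring A"
  shows "equiv (lie_terms A d) (nil_lie_cong A c d)"
proof (rule equivI)
  show "nil_lie_cong A c d \<subseteq> lie_terms A d \<times> lie_terms A d"
    using nil_lie_cong_terms[OF assms] by auto
  show "refl_on (lie_terms A d) (nil_lie_cong A c d)"
    by (intro refl_onI nil_lie_cong.refl)
  show "sym (nil_lie_cong A c d)"
    by (rule symI) (rule nil_lie_cong.sym)
  show "trans (nil_lie_cong A c d)"
    by (rule transI) (rule nil_lie_cong.trans)
qed

text \<open>
  A Hall basis in degrees at most three, with \<open>[i]\<close>, \<open>[j, k]\<close> and \<open>[i, j, k]\<close> standing for the
  iterated brackets \<open>e\<^sub>i\<close>, \<open>[e\<^sub>j, e\<^sub>k]\<close> and \<open>[e\<^sub>i, [e\<^sub>j, e\<^sub>k]]\<close>.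
\<close>

definition hall :: "nat \<Rightarrow> nat list set"
  where "hall d = {[i] | i. i < d} \<union> {[j, k] | j k. j < k \<and> k < d}
    \<union> {[i, j, k] | i j k. j < k \<and> j \<le> i \<and> i < d \<and> k < d}"

fun hall_term :: "nat list \<Rightarrow> 'r lie_term" where
  "hall_term [] = LZero"
| "hall_term [i] = Gen i"
| "hall_term (i # j # l) = LBracket (Gen i) (hall_term (j # l))"

lemma hall_cases [consumes 1, case_names one two three]:
  assumes "b \<in> hall d"
  obtains i where "b = [i]" "i < d"
  | j k where "b = [j, k]" "j < k" "k < d"
  | i j k where "b = [i, j, k]" "j < k" "j \<le> i" "i < d" "k < d"
  using assms unfolding hall_def by blast

lemma hall_term_in_lie_terms: "b \<in> hall d \<Longrightarrow> hall_term b \<in> lie_terms A d"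
  by (erule hall_cases) (auto intro!: lie_terms.intros)

text \<open>The span is formed on terms and saturated under the congruence. Spanning can then be
  proved by induction on terms, without a module structure on the quotient.\<close>

inductive_set hall_span :: "('r, 'm) ring_scheme \<Rightarrow> nat \<Rightarrow> 'r lie_term set"
  for A :: "('r, 'm) ring_scheme" and d :: nat where
  base: "b \<in> hall d \<Longrightarrow> hall_term b \<in> hall_span A d"
| zero: "LZero \<in> hall_span A d"
| add: "s \<in> hall_span A d \<Longrightarrow> t \<in> hall_span A d \<Longrightarrow> LAdd s t \<in> hall_span A d"
| smult: "a \<in> carrier A \<Longrightarrow> t \<in> hall_span A d \<Longrightarrow> LSmult a t \<in> hall_span A d"
| cong: "t \<in> hall_span A d \<Longrightarrow> (s, t) \<in> nil_lie_cong A 3 d \<Longrightarrow> s \<in> hall_span A d"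

section \<open>Equational reasoning modulo the Lie relations\<close>

locale nil_lie = ring A for A :: "('r, 'm) ring_scheme" (structure) +
  fixes c d :: nat
begin

definition lie_eq (infix "\<approx>" 50) where "s \<approx> t \<longleftrightarrow> (s, t) \<in> nil_lie_cong A c d"
abbreviation "T \<equiv> lie_terms A d"
abbreviation "LNeg t \<equiv> LSmult (\<ominus> \<one>) t"

lemmas T_intros = lie_terms.intros
lemmas lie_eq_intros = nil_lie_cong.intros[where A = A and c = c and d = d, folded lie_eq_def]
lemmas eq_refl = lie_eq_intros(1)
lemmas eq_sym = lie_eq_intros(2)
lemmas eq_trans [trans] = lie_eq_intros(3)
lemmas eq_cong_add = lie_eq_intros(4)
lemmas eq_cong_smult = lie_eq_intros(5)
lemmas eq_cong_bracket = lie_eq_intros(6)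
lemmas eq_add_assoc = lie_eq_intros(7)
lemmas eq_add_comm = lie_eq_intros(8)
lemmas eq_add_zero = lie_eq_intros(9)
lemmas eq_add_neg = lie_eq_intros(10)
lemmas eq_smult_add_right = lie_eq_intros(12)
lemmas eq_bracket_add_left = lie_eq_intros(15)
lemmas eq_bracket_add_right = lie_eq_intros(16)
lemmas eq_bracket_smult_left = lie_eq_intros(17)
lemmas eq_bracket_smult_right = lie_eq_intros(18)
lemmas eq_alternating = lie_eq_intros(19)
lemmas eq_jacobi = lie_eq_intros(20)
lemmas eq_nilpotent = lie_eq_intros(21)

lemma minus_one_closed: "\<ominus> \<one> \<in> carrier A"
  by simp

lemma eq_neg_if_add_zero:
  assumes "s \<in> T" "t \<in> T" "LAdd s t \<approx> LZero"
  shows "s \<approx> LNeg t"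
proof -
  have n: "LNeg t \<in> T" using assms by (auto intro: T_intros)
  have "s \<approx> LAdd LZero s"
    by (intro eq_sym[OF eq_add_zero] assms)
  also have "\<dots> \<approx> LAdd s LZero"
    by (intro eq_add_comm T_intros assms)
  also have "\<dots> \<approx> LAdd s (LAdd (LNeg t) t)"
    by (intro eq_cong_add eq_refl eq_sym[OF eq_add_neg] assms)
  also have "\<dots> \<approx> LAdd s (LAdd t (LNeg t))"
    by (intro eq_cong_add eq_refl eq_add_comm assms n)
  also have "\<dots> \<approx> LAdd (LAdd s t) (LNeg t)"
    by (intro eq_sym[OF eq_add_assoc] assms n)
  also have "\<dots> \<approx> LAdd LZero (LNeg t)"
    by (intro eq_cong_add eq_refl assms n)
  also have "\<dots> \<approx> LNeg t"
    using n by (rule eq_add_zero)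
  finally show ?thesis .
qed

text \<open>No rule of the congruence says that multiples of zero and brackets with zero vanish.
  Additivity exhibits each of them as its own double, and this lemma finishes.\<close>

lemma eq_zero_if_double:
  assumes "s \<in> T" "s \<approx> LAdd s s"
  shows "s \<approx> LZero"
proof -
  have n: "LNeg s \<in> T" using assms by (auto intro: T_intros)
  have "s \<approx> LAdd LZero s"
    by (intro eq_sym[OF eq_add_zero] assms)
  also have "\<dots> \<approx> LAdd (LAdd (LNeg s) s) s"
    by (intro eq_cong_add eq_refl eq_sym[OF eq_add_neg] assms)
  also have "\<dots> \<approx> LAdd (LNeg s) (LAdd s s)"
    by (intro eq_add_assoc assms n)
  also have "\<dots> \<approx> LAdd (LNeg s) s"
    by (intro eq_cong_add eq_refl eq_sym[OF assms(2)] n)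
  also have "\<dots> \<approx> LZero"
    by (intro eq_add_neg assms)
  finally show ?thesis .
qed

lemma smult_zero:
  assumes "a \<in> carrier A"
  shows "LSmult a LZero \<approx> LZero"
proof (rule eq_zero_if_double)
  have "LSmult a LZero \<approx> LSmult a (LAdd LZero LZero)"
    by (intro eq_cong_smult eq_sym[OF eq_add_zero] T_intros assms)
  also have "\<dots> \<approx> LAdd (LSmult a LZero) (LSmult a LZero)"
    by (intro eq_smult_add_right T_intros assms)
  finally show "LSmult a LZero \<approx> LAdd (LSmult a LZero) (LSmult a LZero)" .
qed (use assms in \<open>auto intro: T_intros\<close>)

lemma bracket_zero_left:
  assumes "t \<in> T"
  shows "LBracket LZero t \<approx> LZero"
proof (rule eq_zero_if_double)
  have "LBracket LZero t \<approx> LBracket (LAdd LZero LZero) t"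
    by (intro eq_cong_bracket eq_refl eq_sym[OF eq_add_zero] T_intros assms)
  also have "\<dots> \<approx> LAdd (LBracket LZero t) (LBracket LZero t)"
    by (intro eq_bracket_add_left T_intros assms)
  finally show "LBracket LZero t \<approx> LAdd (LBracket LZero t) (LBracket LZero t)" .
qed (use assms in \<open>auto intro: T_intros\<close>)

lemma add_zero_zero:
  assumes "s \<approx> LZero" "t \<approx> LZero"
  shows "LAdd s t \<approx> LZero"
proof -
  have "LAdd s t \<approx> LAdd LZero LZero"
    using assms by (rule eq_cong_add)
  also have "\<dots> \<approx> LZero"
    by (intro eq_add_zero T_intros)
  finally show ?thesis .
qed

text \<open>Polarisation of [s + t, s + t] = 0: the two squares vanish and the mixed brackets
  remain.\<close>

lemma bracket_antisym:
  assumes "s \<in> T" "t \<in> T"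
  shows "LBracket s t \<approx> LNeg (LBracket t s)"
proof (rule eq_neg_if_add_zero)
  let ?b = LBracket
  have T: "?b s s \<in> T" "?b s t \<in> T" "?b t s \<in> T" "?b t t \<in> T" "LAdd s t \<in> T"
    using assms by (auto intro: T_intros)
  have "LAdd (?b s t) (?b t s) \<approx> LAdd LZero (LAdd (?b s t) (?b t s))"
    by (intro eq_sym[OF eq_add_zero] lie_terms.add T)
  also have "\<dots> \<approx> LAdd (LAdd LZero (?b s t)) (?b t s)"
    by (intro eq_sym[OF eq_add_assoc] lie_terms.zero T)
  also have "\<dots> \<approx> LAdd (LAdd (?b s s) (?b s t)) (LAdd (?b t s) (?b t t))"
  proof (rule eq_cong_add)
    show "LAdd LZero (?b s t) \<approx> LAdd (?b s s) (?b s t)"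
      by (intro eq_cong_add eq_sym[OF eq_alternating] eq_refl T assms)
    have "?b t s \<approx> LAdd LZero (?b t s)"
      by (intro eq_sym[OF eq_add_zero] T)
    also have "\<dots> \<approx> LAdd (?b t s) LZero"
      by (intro eq_add_comm lie_terms.zero T)
    also have "\<dots> \<approx> LAdd (?b t s) (?b t t)"
      by (intro eq_cong_add eq_sym[OF eq_alternating] eq_refl T assms)
    finally show "?b t s \<approx> LAdd (?b t s) (?b t t)" .
  qed
  also have "\<dots> \<approx> LAdd (?b s (LAdd s t)) (?b t (LAdd s t))"
    by (intro eq_cong_add eq_sym[OF eq_bracket_add_right] assms)
  also have "\<dots> \<approx> ?b (LAdd s t) (LAdd s t)"
    by (intro eq_sym[OF eq_bracket_add_left] assms T)
  also have "\<dots> \<approx> LZero"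
    by (intro eq_alternating T)
  finally show "LAdd (?b s t) (?b t s) \<approx> LZero" .
qed (use assms in \<open>auto intro: T_intros\<close>)

lemma neg_zero: "t \<approx> LZero \<Longrightarrow> LNeg t \<approx> LZero"
  by (rule eq_trans[OF eq_cong_smult[OF minus_one_closed] smult_zero[OF minus_one_closed]])

lemma bracket_zero_swap:
  assumes "s \<in> T" "t \<in> T" "LBracket s t \<approx> LZero"
  shows "LBracket t s \<approx> LZero"
  using bracket_antisym[OF assms(2,1)] neg_zero[OF assms(3)] by (rule eq_trans)

lemma bracket_zero_right: "t \<in> T \<Longrightarrow> LBracket t LZero \<approx> LZero"
  by (rule bracket_zero_swap[OF lie_terms.zero _ bracket_zero_left])

lemma bracket_swap_inner:
  assumes "s \<in> T" "t \<in> T" "u \<in> T" "LBracket s (LBracket t u) \<approx> LZero"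
  shows "LBracket s (LBracket u t) \<approx> LZero"
proof -
  have "LBracket s (LBracket u t) \<approx> LBracket s (LNeg (LBracket t u))"
    using assms by (intro eq_cong_bracket eq_refl bracket_antisym)
  also have "\<dots> \<approx> LNeg (LBracket s (LBracket t u))"
    using assms by (intro eq_bracket_smult_right minus_one_closed T_intros)
  also have "\<dots> \<approx> LZero"
    using assms by (intro neg_zero)
  finally show ?thesis .
qed

end

section \<open>Spanning by the Hall terms in class three\<close>

locale nil_lie3 = nil_lie A 3 d for A :: "('r, 'm) ring_scheme" (structure) and d
begin

notation lie_eq (infix "\<approx>" 50)

text \<open>The nilpotency relation speaks of left-normed brackets. Antisymmetry, used for the outer
  and then for the middle bracket, turns them into right-normed ones.\<close>

lemma bracket_length_four:
  assumes "s \<in> T" "t \<in> T" "u \<in> T" "v \<in> T"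
  shows "LBracket s (LBracket t (LBracket u v)) \<approx> LZero"
proof -
  let ?X = "LBracket u v"
  have X: "?X \<in> T" "LBracket ?X t \<in> T" by (intro lie_terms.bracket assms)+
  have "foldl LBracket u [v, t, s] \<approx> LZero"
    using assms by (intro eq_nilpotent) auto
  then have "LBracket s (LBracket ?X t) \<approx> LZero"
    by (intro bracket_zero_swap[OF X(2) assms(1)]) simp
  then show ?thesis
    by (rule bracket_swap_inner[OF assms(1) X(1) assms(2)])
qed

text \<open>The Jacobi identity for [s, t], u and v expresses this bracket through two brackets of
  length four.\<close>

lemma bracket_two_two:
  assumes "s \<in> T" "t \<in> T" "u \<in> T" "v \<in> T"
  shows "LBracket (LBracket s t) (LBracket u v) \<approx> LZero"
proof -
  let ?X = "LBracket s t"
  have T: "?X \<in> T" "LBracket u v \<in> T" using assms by (auto intro: T_intros)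
  have "LBracket u (LBracket v ?X) \<approx> LZero"
    using assms by (intro bracket_length_four)
  moreover have "LBracket v (LBracket ?X u) \<approx> LZero"
    by (rule bracket_swap_inner[OF _ _ _ bracket_length_four]) (intro assms T)+
  ultimately have z: "LAdd (LBracket u (LBracket v ?X)) (LBracket v (LBracket ?X u)) \<approx> LZero"
    by (rule add_zero_zero)
  have T': "LBracket ?X (LBracket u v) \<in> T" by (intro T_intros assms)
  have "LBracket ?X (LBracket u v) \<approx> LAdd LZero (LBracket ?X (LBracket u v))"
    by (intro eq_sym[OF eq_add_zero] T')
  also have "\<dots> \<approx> LAdd (LBracket ?X (LBracket u v)) LZero"
    by (intro eq_add_comm lie_terms.zero T')
  also have "\<dots> \<approx> LAdd (LBracket ?X (LBracket u v))
      (LAdd (LBracket u (LBracket v ?X)) (LBracket v (LBracket ?X u)))"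
    by (intro eq_cong_add eq_refl eq_sym[OF z] T')
  also have "\<dots> \<approx> LZero"
    by (intro eq_jacobi assms T)
  finally show ?thesis .
qed

lemma hall_span_lie_terms: "t \<in> hall_span A d \<Longrightarrow> t \<in> T"
  by (induction rule: hall_span.induct)
    (auto intro: T_intros hall_term_in_lie_terms dest: nil_lie_cong_terms[OF ring_axioms])

lemma hall_span_cong: "t \<in> hall_span A d \<Longrightarrow> s \<approx> t \<Longrightarrow> s \<in> hall_span A d"
  unfolding lie_eq_def by (rule hall_span.cong)

lemma hall_span_zero: "t \<approx> LZero \<Longrightarrow> t \<in> hall_span A d"
  by (rule hall_span_cong[OF hall_span.zero])

lemma hall_span_swap:
  assumes "s \<in> T" "t \<in> T" "LBracket t s \<in> hall_span A d"
  shows "LBracket s t \<in> hall_span A d"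
  by (rule hall_span_cong[OF hall_span.smult[OF minus_one_closed assms(3)]])
    (intro bracket_antisym assms)

lemma bracket_gens_in_hall_span:
  assumes "i < d" "j < d"
  shows "LBracket (Gen i) (Gen j) \<in> hall_span A d"
proof (cases i j rule: linorder_cases)
  case less
  then show ?thesis
    using assms hall_span.base[of "[i, j]" d A] by (simp add: hall_def)
next
  case equal
  then show ?thesis
    using assms by (auto intro!: hall_span_zero eq_alternating T_intros)
next
  case greater
  then have "LBracket (Gen j) (Gen i) \<in> hall_span A d"
    using assms hall_span.base[of "[j, i]" d A] by (simp add: hall_def)
  then show ?thesis
    using assms by (auto intro!: hall_span_swap T_intros)
qed

text \<open>Outside the Hall set only i < j occurs. There the Jacobi identity leads to [e_j,
  [e_i, e_k]] and [e_k, [e_i, e_j]], whose index lists are Hall lists because the least index i now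
  stands in the middle.\<close>

lemma bracket_gen_two_in_hall_span:
  assumes "i < d" "j < k" "k < d"
  shows "LBracket (Gen i) (LBracket (Gen j) (Gen k)) \<in> hall_span A d"
proof (cases "j \<le> i")
  case True
  then show ?thesis
    using assms hall_span.base[of "[i, j, k]" d A] by (simp add: hall_def)
next
  case False
  let ?g = "Gen :: nat \<Rightarrow> 'r lie_term"
  have g: "?g i \<in> T" "?g j \<in> T" "?g k \<in> T"
    using assms False by (auto intro: T_intros)
  have "LBracket (?g k) (LBracket (?g i) (?g j)) \<in> hall_span A d"
    using assms False hall_span.base[of "[k, i, j]" d A] by (simp add: hall_def)
  moreover have "LBracket (?g j) (LBracket (?g k) (?g i)) \<in> hall_span A d"
  proof (rule hall_span_cong)
    show "LBracket (?g j) (LBracket (?g k) (?g i)) \<approx> LNeg (LBracket (?g j) (LBracket (?g i) (?g k)))"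
      by (rule eq_trans[OF eq_cong_bracket eq_bracket_smult_right])
        (intro bracket_antisym eq_refl minus_one_closed lie_terms.bracket g)+
    show "LNeg (LBracket (?g j) (LBracket (?g i) (?g k))) \<in> hall_span A d"
      using assms False hall_span.base[of "[j, i, k]" d A]
      by (intro hall_span.smult minus_one_closed) (simp add: hall_def)
  qed
  ultimately have "LAdd (LBracket (?g j) (LBracket (?g k) (?g i)))
      (LBracket (?g k) (LBracket (?g i) (?g j))) \<in> hall_span A d"
    by (rule hall_span.add[rotated])
  then show ?thesis
    by (rule hall_span_cong[OF hall_span.smult[OF minus_one_closed]])
      (intro eq_neg_if_add_zero eq_jacobi lie_terms.add lie_terms.bracket g)
qed

text \<open>Only total degrees two and three need the Hall set; from degree four on the bracket
  vanishes.\<close>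

lemma bracket_hall_terms_in_hall_span:
  assumes "b \<in> hall d" "b' \<in> hall d"
  shows "LBracket (hall_term b) (hall_term b') \<in> hall_span A d"
  using assms(1)
proof (cases rule: hall_cases)
  case (one i)
  from assms(2) show ?thesis
  proof (cases rule: hall_cases)
    case one': (one i')
    then show ?thesis using one by (simp add: bracket_gens_in_hall_span)
  next
    case two
    then show ?thesis using one by (simp add: bracket_gen_two_in_hall_span)
  next
    case three
    then show ?thesis
      using one by (simp, intro hall_span_zero bracket_length_four lie_terms.gen) auto
  qed
next
  case (two j k)
  from assms(2) show ?thesis
  proof (cases rule: hall_cases)
    case one
    then show ?thesis
      using two
      by (auto intro: hall_span_swap[OF _ _ bracket_gen_two_in_hall_span]
          intro!: lie_terms.bracket lie_terms.gen)
  next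
    case two': two
    then show ?thesis
      using two by (simp, intro hall_span_zero bracket_two_two lie_terms.gen) auto
  next
    case three
    then show ?thesis
      using two
      by (simp, intro hall_span_zero bracket_two_two lie_terms.bracket lie_terms.gen) auto
  qed
next
  case (three i j k)
  from assms(2) show ?thesis
  proof (cases rule: hall_cases)
    case one
    then show ?thesis
      using three
      by (simp, intro hall_span_zero bracket_zero_swap[OF _ _ bracket_length_four]
          lie_terms.bracket lie_terms.gen) auto
  next
    case two
    then show ?thesis
      using three
      by (simp, intro hall_span_zero bracket_two_two lie_terms.bracket lie_terms.gen) auto
  next
    case three': three
    then show ?thesis
      using three
      by (simp, intro hall_span_zero bracket_two_two lie_terms.bracket lie_terms.gen) auto
  qed
qed

lemma bracket_in_hall_span:
  assumes "s \<in> hall_span A d" "t \<in> hall_span A d"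
  shows "LBracket s t \<in> hall_span A d"
  using assms
proof (induction s rule: hall_span.induct)
  case (base b)
  from base.prems show ?case
  proof (induction t rule: hall_span.induct)
    case (base b')
    then show ?case by (intro bracket_hall_terms_in_hall_span \<open>b \<in> hall d\<close>)
  next
    case zero
    show ?case
      by (intro hall_span_zero bracket_zero_right hall_term_in_lie_terms \<open>b \<in> hall d\<close>)
  next
    case (add s t)
    then show ?case
      by (intro hall_span_cong[OF hall_span.add[OF add.IH] eq_bracket_add_right]
          hall_span_lie_terms hall_span.base \<open>b \<in> hall d\<close>)
  next
    case (smult a t)
    then show ?case
      by (intro hall_span_cong[OF hall_span.smult[OF _ smult.IH] eq_bracket_smult_right]
          hall_span_lie_terms hall_span.base \<open>b \<in> hall d\<close>)
  next
    case (cong t s)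
    then show ?case
      by (intro hall_span_cong[OF cong.IH eq_cong_bracket] eq_refl cong.hyps[folded lie_eq_def]
          hall_span_lie_terms hall_span.base \<open>b \<in> hall d\<close>)
  qed
next
  case zero
  show ?case by (intro hall_span_zero bracket_zero_left hall_span_lie_terms zero.prems)
next
  case (add s s')
  then show ?case
    by (intro hall_span_cong[OF hall_span.add[OF add.IH] eq_bracket_add_left]
        hall_span_lie_terms)
next
  case (smult a s)
  then show ?case
    by (intro hall_span_cong[OF hall_span.smult[OF _ smult.IH] eq_bracket_smult_left]
        hall_span_lie_terms)
next
  case (cong s s')
  then show ?case
    by (intro hall_span_cong[OF cong.IH eq_cong_bracket] eq_refl cong.hyps[folded lie_eq_def]
        hall_span_lie_terms)
qed

text \<open>Bilinearity reduces brackets to those of Hall terms, so the span is closed under all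
  term constructors. This is the generating half of the basis property.\<close>

lemma lie_terms_in_hall_span: "t \<in> T \<Longrightarrow> t \<in> hall_span A d"
proof (induction rule: lie_terms.induct)
  case (gen i)
  then show ?case using hall_span.base[of "[i]" d A] by (simp add: hall_def)
qed (auto intro: hall_span.zero hall_span.add hall_span.smult bracket_in_hall_span)

end

section \<open>Coordinates over \<open>\<int>[1/6]\<close>\<close>

lemma Z_sixth_simps [simp]:
  "a \<oplus>\<^bsub>Z_sixth\<^esub> b = a + b" "a \<otimes>\<^bsub>Z_sixth\<^esub> b = a * b" "\<zero>\<^bsub>Z_sixth\<^esub> = 0" "\<one>\<^bsub>Z_sixth\<^esub> = 1"
  by (simp_all add: Z_sixth_def)

lemma Z_sixthI: "r = of_int a / 6 ^ k \<Longrightarrow> r \<in> carrier Z_sixth"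
  by (auto simp: Z_sixth_def)

lemma Z_sixthE:
  assumes "r \<in> carrier Z_sixth"
  obtains a k where "r = of_int a / 6 ^ k"
  using assms by (auto simp: Z_sixth_def)

lemma Z_sixth_of_int: "of_int a \<in> carrier Z_sixth"
  by (rule Z_sixthI[of _ a 0]) simp

lemma Z_sixth_0 [simp]: "0 \<in> carrier Z_sixth" and Z_sixth_1 [simp]: "1 \<in> carrier Z_sixth"
  using Z_sixth_of_int[of 0] Z_sixth_of_int[of 1] by simp_all

lemma Z_sixth_add [simp]:
  assumes "r \<in> carrier Z_sixth" "s \<in> carrier Z_sixth"
  shows "r + s \<in> carrier Z_sixth"
proof -
  obtain a k b l where *: "r = of_int a / 6 ^ k" "s = of_int b / 6 ^ l"
    using assms by (metis Z_sixthE)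
  show ?thesis
    unfolding *
    by (intro Z_sixthI[of _ "a * 6 ^ l + b * 6 ^ k" "k + l"]) (simp add: field_simps power_add)
qed

lemma Z_sixth_mult [simp]:
  assumes "r \<in> carrier Z_sixth" "s \<in> carrier Z_sixth"
  shows "r * s \<in> carrier Z_sixth"
proof -
  obtain a k b l where *: "r = of_int a / 6 ^ k" "s = of_int b / 6 ^ l"
    using assms by (metis Z_sixthE)
  show ?thesis
    unfolding *
    by (intro Z_sixthI[of _ "a * b" "k + l"]) (simp add: field_simps power_add)
qed

lemma Z_sixth_minus [simp]: "r \<in> carrier Z_sixth \<Longrightarrow> - r \<in> carrier Z_sixth"
  using Z_sixth_mult[OF Z_sixth_of_int[of "-1"], of r] by simp

lemma Z_sixth_diff [simp]:
  "r \<in> carrier Z_sixth \<Longrightarrow> s \<in> carrier Z_sixth \<Longrightarrow> r - s \<in> carrier Z_sixth"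
  using Z_sixth_add[of r "- s"] by simp

lemma cring_Z_sixth: "cring Z_sixth"
proof (rule cringI)
  show "abelian_group Z_sixth"
    by (rule abelian_groupI) (auto simp: algebra_simps intro: bexI[of _ "- x" for x])
  show "comm_monoid Z_sixth"
    by (rule comm_monoidI) (auto simp: algebra_simps)
qed (simp add: algebra_simps)

interpretation Z_sixth: cring Z_sixth
  by (rule cring_Z_sixth)

lemma Z_sixth_uminus_one: "\<ominus>\<^bsub>Z_sixth\<^esub> 1 = - 1"
  by (rule Z_sixth.minus_equality) simp_all

text \<open>
  The coordinates of a bracket with respect to the Hall basis: for \<open>i < j < k\<close> the Jacobi identity
  \<open>[e\<^sub>i, [e\<^sub>j, e\<^sub>k]] = [e\<^sub>j, [e\<^sub>i, e\<^sub>k]] - [e\<^sub>k, [e\<^sub>i, e\<^sub>j]]\<close> accounts for the second pair of terms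
  in degree three.
\<close>

fun bracket_coord :: "(nat list \<Rightarrow> 'a::comm_ring_1) \<Rightarrow> (nat list \<Rightarrow> 'a) \<Rightarrow> nat list \<Rightarrow> 'a" where
  "bracket_coord x y [j, k] = x [j] * y [k] - y [j] * x [k]"
| "bracket_coord x y [i, j, k] =
    (if i = j then x [j] * y [j, k] - y [j] * x [j, k]
     else x [i] * y [j, k] - y [i] * x [j, k] + (x [j] * y [i, k] - y [j] * x [i, k]))"
| "bracket_coord x y l = 0"

text \<open>Coordinates are kept at all lists, not only at Hall lists: the entries at
  \<open>[j, k]\<close> form an alternating matrix, and the Lie identities then hold at every list,
  whatever the order of its indices.\<close>

primrec term_coord :: "rat lie_term \<Rightarrow> nat list \<Rightarrow> rat" where
  "term_coord (Gen n) l = of_bool (l = [n])"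
| "term_coord LZero l = 0"
| "term_coord (LAdd s t) l = term_coord s l + term_coord t l"
| "term_coord (LSmult a t) l = a * term_coord t l"
| "term_coord (LBracket s t) l = bracket_coord (term_coord s) (term_coord t) l"

lemma length_three_cases:
  "(\<And>i. l = [i] \<Longrightarrow> P) \<Longrightarrow> (\<And>j k. l = [j, k] \<Longrightarrow> P) \<Longrightarrow> (\<And>i j k. l = [i, j, k] \<Longrightarrow> P) \<Longrightarrow>
    (length l \<notin> {1, 2, 3} \<Longrightarrow> P) \<Longrightarrow> P"
  by (cases "length l \<in> {1, 2, 3}") (auto simp: length_Suc_conv numeral_2_eq_2 numeral_3_eq_3)

lemma bracket_coord_other: "length l \<notin> {2, 3} \<Longrightarrow> bracket_coord x y l = 0"
  by (induction x y l rule: bracket_coord.induct) auto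

text \<open>Independence rests on the fact that \<open>bracket_coord\<close> obeys every defining
  relation. Bilinearity, alternation and Jacobi are polynomial identities in degrees two and three;
  the nilpotency relation holds since each bracket raises the lowest degree that can occur.\<close>

lemma term_coord_cong: "(s, t) \<in> nil_lie_cong Z_sixth 3 d \<Longrightarrow> term_coord s = term_coord t"
proof (induction rule: nil_lie_cong.induct)
  case (bracket_add_left s t u)
  show ?case
  proof
    fix l show "term_coord (LBracket (LAdd s t) u) l = term_coord (LAdd (LBracket s u) (LBracket t u)) l"
      by (rule length_three_cases[of l]) (simp_all add: bracket_coord_other algebra_simps)
  qed
next
  case (bracket_add_right s t u)
  show ?case
  proof
    fix l show "term_coord (LBracket s (LAdd t u)) l = term_coord (LAdd (LBracket s t) (LBracket s u)) l"
      by (rule length_three_cases[of l]) (simp_all add: bracket_coord_other algebra_simps)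
  qed
next
  case (bracket_smult_left a s t)
  show ?case
  proof
    fix l show "term_coord (LBracket (LSmult a s) t) l = term_coord (LSmult a (LBracket s t)) l"
      by (rule length_three_cases[of l]) (simp_all add: bracket_coord_other algebra_simps)
  qed
next
  case (bracket_smult_right a s t)
  show ?case
  proof
    fix l show "term_coord (LBracket s (LSmult a t)) l = term_coord (LSmult a (LBracket s t)) l"
      by (rule length_three_cases[of l]) (simp_all add: bracket_coord_other algebra_simps)
  qed
next
  case (cong_bracket s s' t t')
  then show ?case by (intro ext) simp
next
  case (alternating t)
  show ?case
  proof
    fix l show "term_coord (LBracket t t) l = term_coord LZero l"
      by (rule length_three_cases[of l]) (simp_all add: bracket_coord_other algebra_simps)
  qed
next
  case (jacobi s t u)
  show ?case
  proof
    fix l show "term_coord (LAdd (LBracket s (LBracket t u))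
      (LAdd (LBracket t (LBracket u s)) (LBracket u (LBracket s t)))) l = term_coord LZero l"
      by (rule length_three_cases[of l]) (simp_all add: bracket_coord_other algebra_simps)
  qed
next
  case (nilpotent t ts)
  then obtain t1 t2 t3 where ts: "ts = [t1, t2, t3]"
    by (auto simp: numeral_3_eq_3 length_Suc_conv)
  show ?case
  proof
    fix l show "term_coord (foldl LBracket t ts) l = term_coord LZero l"
      unfolding ts by (rule length_three_cases[of l]) (simp_all add: bracket_coord_other)
  qed
qed (auto simp: algebra_simps fun_eq_iff Z_sixth_uminus_one)

lemma bracket_coord_Z_sixth:
  assumes "\<And>l. x l \<in> carrier Z_sixth" "\<And>l. y l \<in> carrier Z_sixth"
  shows "bracket_coord x y l \<in> carrier Z_sixth"
  by (rule length_three_cases[of l]) (simp_all add: bracket_coord_other assms)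

lemma term_coord_Z_sixth: "t \<in> lie_terms Z_sixth d \<Longrightarrow> term_coord t l \<in> carrier Z_sixth"
  by (induction arbitrary: l rule: lie_terms.induct) (auto intro: bracket_coord_Z_sixth)

text \<open>Together with \<open>term_coord_cong\<close> this duality yields the linear independence
  of the Hall elements.\<close>

lemma term_coord_hall_term:
  assumes "b \<in> hall d" "b' \<in> hall d"
  shows "term_coord (hall_term b) b' = of_bool (b = b')"
  using assms(1)
proof (cases rule: hall_cases)
  case (one i)
  from assms(2) show ?thesis by (cases rule: hall_cases) (use one in auto)
next
  case (two j k)
  from assms(2) show ?thesis by (cases rule: hall_cases) (use two in auto)
next
  case (three i j k)
  from assms(2) show ?thesis by (cases rule: hall_cases) (use three in auto)
qed

interpretation Z_sixth: nil_lie3 Z_sixth d for d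
  by unfold_locales

section \<open>The quotient Lie algebra through representatives and coordinates\<close>

definition lie_class :: "nat \<Rightarrow> rat lie_term \<Rightarrow> rat lie_term set"
  where "lie_class d t = nil_lie_cong Z_sixth 3 d `` {t}"

abbreviation "f3 d \<equiv> free_nilpotent_lie Z_sixth 3 d"

definition lie_coord :: "rat lie_term set \<Rightarrow> nat list \<Rightarrow> rat"
  where "lie_coord X = term_coord (SOME t. t \<in> X)"

text \<open>The operations of the quotients are unions over all representatives; constancy on
  classes lets such a union collapse.\<close>

lemma UN_class:
  assumes "equiv A E" "t \<in> A" "\<And>t'. (t, t') \<in> E \<Longrightarrow> f t' = f t"
  shows "(\<Union>t'\<in>E `` {t}. f t') = f t"
proof (rule SUP_eq_const)
  show "E `` {t} \<noteq> {}"
    using equiv_class_self[OF assms(1,2)] by blast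
qed (use assms(3) in blast)

lemmas equiv_lie = equiv_nil_lie_cong[OF Z_sixth.ring_axioms]

lemma lie_class_eqI: "(s, t) \<in> nil_lie_cong Z_sixth 3 d \<Longrightarrow> lie_class d s = lie_class d t"
  unfolding lie_class_def by (rule equiv_class_eq[OF equiv_lie])

lemma carrier_f3: "carrier (f3 d) = lie_class d ` lie_terms Z_sixth d"
  by (auto simp: free_nilpotent_lie_def Let_def lie_class_def quotient_def)

lemma lie_class_closed [simp]: "t \<in> lie_terms Z_sixth d \<Longrightarrow> lie_class d t \<in> carrier (f3 d)"
  by (simp add: carrier_f3)

lemma f3_zero: "\<zero>\<^bsub>f3 d\<^esub> = lie_class d LZero"
  by (simp add: free_nilpotent_lie_def Let_def lie_class_def)

lemma f3_binop:
  assumes "s \<in> lie_terms Z_sixth d" "t \<in> lie_terms Z_sixth d"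
    and "\<And>s s' t t'. (s, s') \<in> nil_lie_cong Z_sixth 3 d \<Longrightarrow> (t, t') \<in> nil_lie_cong Z_sixth 3 d \<Longrightarrow>
      (F s t, F s' t') \<in> nil_lie_cong Z_sixth 3 d"
  shows "(\<Union>s'\<in>lie_class d s. \<Union>t'\<in>lie_class d t. nil_lie_cong Z_sixth 3 d `` {F s' t'}) = lie_class d (F s t)"
proof -
  let ?E = "nil_lie_cong Z_sixth 3 d"
  have inner: "(\<Union>t'\<in>?E `` {t}. ?E `` {F s' t'}) = ?E `` {F s t}" if s': "(s, s') \<in> ?E" for s'
  proof -
    have "(\<Union>t'\<in>?E `` {t}. ?E `` {F s' t'}) = ?E `` {F s' t}"
      using nil_lie_cong_terms[OF Z_sixth.ring_axioms s']
      by (intro UN_class[OF equiv_lie assms(2)] equiv_class_eq[OF equiv_lie] assms(3))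
        (auto intro: nil_lie_cong.refl nil_lie_cong.sym)
    also have "\<dots> = ?E `` {F s t}"
      using s' assms(2)
      by (intro equiv_class_eq[OF equiv_lie] assms(3)) (auto intro: nil_lie_cong.refl nil_lie_cong.sym)
    finally show ?thesis .
  qed
  show ?thesis
    unfolding lie_class_def
    using assms(1) inner by (subst UN_class[OF equiv_lie assms(1)]) (auto intro: nil_lie_cong.refl)
qed

lemma f3_add:
  "s \<in> lie_terms Z_sixth d \<Longrightarrow> t \<in> lie_terms Z_sixth d \<Longrightarrow>
    lie_class d s \<oplus>\<^bsub>f3 d\<^esub> lie_class d t = lie_class d (LAdd s t)"
  using f3_binop[of s d t LAdd]
  by (auto simp: free_nilpotent_lie_def Let_def intro: nil_lie_cong.cong_add)

lemma f3_bracket: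
  "s \<in> lie_terms Z_sixth d \<Longrightarrow> t \<in> lie_terms Z_sixth d \<Longrightarrow>
    lie_class d s \<otimes>\<^bsub>f3 d\<^esub> lie_class d t = lie_class d (LBracket s t)"
  using f3_binop[of s d t LBracket]
  by (auto simp: free_nilpotent_lie_def Let_def intro: nil_lie_cong.cong_bracket)

lemma f3_smult:
  assumes "a \<in> carrier Z_sixth" "t \<in> lie_terms Z_sixth d"
  shows "a \<odot>\<^bsub>f3 d\<^esub> lie_class d t = lie_class d (LSmult a t)"
  unfolding free_nilpotent_lie_def Let_def lie_class_def
  using assms
  by (auto intro!: UN_class[OF equiv_lie] equiv_class_eq[OF equiv_lie] nil_lie_cong.cong_smult
      intro: nil_lie_cong.sym)

lemma lie_coord_class:
  assumes "t \<in> lie_terms Z_sixth d"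
  shows "lie_coord (lie_class d t) = term_coord t"
proof -
  have "t \<in> lie_class d t"
    using assms by (simp add: lie_class_def nil_lie_cong.refl)
  then have "(SOME s. s \<in> lie_class d t) \<in> lie_class d t"
    by (rule someI)
  then show ?thesis
    unfolding lie_coord_def by (auto simp: lie_class_def dest: term_coord_cong)
qed

lemma f3_cases:
  assumes "X \<in> carrier (f3 d)"
  obtains t where "t \<in> lie_terms Z_sixth d" "X = lie_class d t"
  using assms by (auto simp: carrier_f3)

lemma lie_coord_Z_sixth: "X \<in> carrier (f3 d) \<Longrightarrow> lie_coord X l \<in> carrier Z_sixth"
  by (elim f3_cases) (simp add: lie_coord_class term_coord_Z_sixth)

lemma lie_coord_zero: "lie_coord \<zero>\<^bsub>f3 d\<^esub> l = 0"
  by (simp add: f3_zero lie_coord_class lie_terms.zero)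

lemma lie_coord_add:
  "X \<in> carrier (f3 d) \<Longrightarrow> Y \<in> carrier (f3 d) \<Longrightarrow>
    lie_coord (X \<oplus>\<^bsub>f3 d\<^esub> Y) l = lie_coord X l + lie_coord Y l"
  by (elim f3_cases) (simp add: f3_add lie_coord_class lie_terms.add)

lemma lie_coord_smult:
  "a \<in> carrier Z_sixth \<Longrightarrow> X \<in> carrier (f3 d) \<Longrightarrow> lie_coord (a \<odot>\<^bsub>f3 d\<^esub> X) l = a * lie_coord X l"
  by (elim f3_cases) (simp add: f3_smult lie_coord_class lie_terms.smult)

lemma lie_coord_bracket:
  "X \<in> carrier (f3 d) \<Longrightarrow> Y \<in> carrier (f3 d) \<Longrightarrow>
    lie_coord (X \<otimes>\<^bsub>f3 d\<^esub> Y) l = bracket_coord (lie_coord X) (lie_coord Y) l"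
  by (elim f3_cases) (simp add: f3_bracket lie_coord_class lie_terms.bracket)

lemma f3_closed:
  assumes "X \<in> carrier (f3 d)" "Y \<in> carrier (f3 d)" "a \<in> carrier Z_sixth"
  shows "X \<oplus>\<^bsub>f3 d\<^esub> Y \<in> carrier (f3 d)" "X \<otimes>\<^bsub>f3 d\<^esub> Y \<in> carrier (f3 d)"
    "a \<odot>\<^bsub>f3 d\<^esub> X \<in> carrier (f3 d)" "\<zero>\<^bsub>f3 d\<^esub> \<in> carrier (f3 d)"
  using assms
  by (auto elim!: f3_cases simp: f3_add f3_bracket f3_smult f3_zero intro!: lie_class_closed lie_terms.intros)

lemma f3_smult_zero:
  assumes "X \<in> carrier (f3 d)"
  shows "0 \<odot>\<^bsub>f3 d\<^esub> X = \<zero>\<^bsub>f3 d\<^esub>"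
proof -
  obtain t where t: "t \<in> lie_terms Z_sixth d" "X = lie_class d t"
    using assms by (rule f3_cases)
  have T: "LSmult 0 t \<in> lie_terms Z_sixth d"
    using t by (intro lie_terms.smult) auto
  have "Z_sixth.lie_eq d (LSmult 0 t) (LAdd (LSmult 0 t) (LSmult 0 t))"
    using nil_lie_cong.smult_add_left[of 0 Z_sixth 0 t d 3] t by (simp add: Z_sixth.lie_eq_def)
  then have "(LSmult 0 t, LZero) \<in> nil_lie_cong Z_sixth 3 d"
    using Z_sixth.eq_zero_if_double[OF T] by (simp add: Z_sixth.lie_eq_def)
  then show ?thesis
    using t by (simp add: f3_smult f3_zero lie_class_eqI)
qed

section \<open>Base change along \<open>\<int>[1/6] \<rightarrow> S\<close>\<close>

locale sixth_algebra = cring S for S :: "('s, 'n) ring_scheme" (structure) +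
  assumes six_unit: "add_pow S (6::int) \<one> \<in> Units S"
begin

abbreviation \<iota> :: "int \<Rightarrow> 's" where "\<iota> a \<equiv> add_pow S a \<one>"
abbreviation \<phi> :: "rat \<Rightarrow> 's" where "\<phi> \<equiv> Z_sixth_map S"

lemma iota_add: "\<iota> (a + b) = \<iota> a \<oplus> \<iota> b"
  by (simp add: add.int_pow_mult)

lemma iota_mult: "\<iota> (a * b) = \<iota> a \<otimes> \<iota> b"
  by (simp add: add_pow_ldistr_int add.int_pow_pow mult.commute)

lemma iota_six_power_unit: "\<iota> (6 ^ k) \<in> Units S"
  by (induction k) (simp_all add: iota_mult six_unit)

lemma unit_cancel: "u \<in> Units S \<Longrightarrow> x \<in> carrier S \<Longrightarrow> y \<in> carrier S \<Longrightarrow> x \<otimes> u = y \<otimes> u \<Longrightarrow> x = y"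
  by (metis Units_closed Units_l_cancel m_comm)

text \<open>\<open>Z_sixth_map\<close> uses the reduced fraction, whose denominator divides a power
  of six and so becomes a unit. Having the defining equation for unreduced fractions as well lets
  sums and products be compared over a common power of six.\<close>

lemma Z_sixth_map_closed_and_eq:
  assumes "r \<in> carrier Z_sixth" "r = of_int m / of_int n" "n \<noteq> 0"
  shows "\<phi> r \<in> carrier S \<and> \<phi> r \<otimes> \<iota> n = \<iota> m"
proof -
  obtain a b where ab: "quotient_of r = (a, b)"
    by force
  then have b: "b > 0" "coprime a b" "r = of_int a / of_int b"
    by (auto simp: quotient_of_denom_pos quotient_of_coprime quotient_of_div)
  obtain c k where "r = of_int c / 6 ^ k"
    using assms(1) by (rule Z_sixthE)
  then have "rat_of_int (a * 6 ^ k) = of_int (c * b)"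
    using b by (simp add: field_simps)
  then have "a * 6 ^ k = c * b"
    by (simp only: of_int_eq_iff)
  then have "b dvd a * 6 ^ k"
    by simp
  then have "b dvd 6 ^ k"
    using b(2) by (simp add: coprime_dvd_mult_right_iff coprime_commute)
  then obtain e where "6 ^ k = b * e" ..
  then have "\<iota> b \<otimes> \<iota> e \<in> Units S"
    using iota_six_power_unit[of k] by (simp add: iota_mult)
  then have ub: "\<iota> b \<in> Units S"
    using unit_factor by blast
  have phi: "\<phi> r = \<iota> a \<otimes> inv (\<iota> b)"
    by (simp add: Z_sixth_map_def ab)
  have "rat_of_int (a * n) = of_int (m * b)"
    using assms(2,3) b by (simp add: field_simps)
  then have an: "a * n = m * b"
    by (simp only: of_int_eq_iff)
  have "\<phi> r \<otimes> \<iota> n \<otimes> \<iota> b = (inv (\<iota> b) \<otimes> \<iota> b) \<otimes> (\<iota> a \<otimes> \<iota> n)"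
    unfolding phi using ub Units_inv_closed[OF ub] by (simp add: m_ac del: Units_l_inv Units_r_inv)
  also have "\<dots> = \<iota> m \<otimes> \<iota> b"
    using ub by (simp add: iota_mult[symmetric] an del: iota_mult)
  finally have "\<phi> r \<otimes> \<iota> n = \<iota> m"
    by (rule unit_cancel[OF ub, rotated 2]) (simp_all add: phi ub)
  moreover have "\<phi> r \<in> carrier S"
    by (simp add: phi ub)
  ultimately show ?thesis by blast
qed

lemma Z_sixth_map_closed [simp]:
  assumes "r \<in> carrier Z_sixth"
  shows "\<phi> r \<in> carrier S"
  using assms
proof (rule Z_sixthE)
  fix a k assume "r = of_int a / 6 ^ k"
  with assms show "\<phi> r \<in> carrier S"
    using Z_sixth_map_closed_and_eq[of r a "6 ^ k"] by simp
qed

lemma Z_sixth_map_eqI: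
  assumes "r \<in> carrier Z_sixth" "r = of_int m / 6 ^ k" "y \<in> carrier S" "y \<otimes> \<iota> (6 ^ k) = \<iota> m"
  shows "\<phi> r = y"
  using Z_sixth_map_closed_and_eq[of r m "6 ^ k"] assms
  by (intro unit_cancel[OF iota_six_power_unit[of k], of "\<phi> r" y]) auto

lemma Z_sixth_map_cases:
  assumes "r \<in> carrier Z_sixth"
  obtains m k where "r = of_int m / 6 ^ k" "\<phi> r \<otimes> \<iota> (6 ^ k) = \<iota> m"
proof -
  obtain m k where r: "r = of_int m / 6 ^ k"
    using assms by (rule Z_sixthE)
  with Z_sixth_map_closed_and_eq[of r m "6 ^ k"] assms show ?thesis
    by (intro that[of m k]) auto
qed

lemma Z_sixth_map_add [simp]:
  assumes "r \<in> carrier Z_sixth" "s \<in> carrier Z_sixth"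
  shows "\<phi> (r + s) = \<phi> r \<oplus> \<phi> s"
proof -
  obtain m k where r: "r = of_int m / 6 ^ k" "\<phi> r \<otimes> \<iota> (6 ^ k) = \<iota> m"
    using assms(1) by (rule Z_sixth_map_cases)
  obtain n l where s: "s = of_int n / 6 ^ l" "\<phi> s \<otimes> \<iota> (6 ^ l) = \<iota> n"
    using assms(2) by (rule Z_sixth_map_cases)
  show ?thesis
  proof (rule Z_sixth_map_eqI[of _ "m * 6 ^ l + n * 6 ^ k" "k + l"])
    show "r + s = of_int (m * 6 ^ l + n * 6 ^ k) / 6 ^ (k + l)"
      unfolding r s by (simp add: field_simps power_add)
    have "(\<phi> r \<oplus> \<phi> s) \<otimes> \<iota> (6 ^ (k + l))
        = (\<phi> r \<otimes> \<iota> (6 ^ k)) \<otimes> \<iota> (6 ^ l) \<oplus> (\<phi> s \<otimes> \<iota> (6 ^ l)) \<otimes> \<iota> (6 ^ k)"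
      using assms by (simp add: power_add iota_mult l_distr m_ac)
    then show "(\<phi> r \<oplus> \<phi> s) \<otimes> \<iota> (6 ^ (k + l)) = \<iota> (m * 6 ^ l + n * 6 ^ k)"
      by (simp add: r(2) s(2) iota_add iota_mult)
  qed (use assms in auto)
qed

lemma Z_sixth_map_mult [simp]:
  assumes "r \<in> carrier Z_sixth" "s \<in> carrier Z_sixth"
  shows "\<phi> (r * s) = \<phi> r \<otimes> \<phi> s"
proof -
  obtain m k where r: "r = of_int m / 6 ^ k" "\<phi> r \<otimes> \<iota> (6 ^ k) = \<iota> m"
    using assms(1) by (rule Z_sixth_map_cases)
  obtain n l where s: "s = of_int n / 6 ^ l" "\<phi> s \<otimes> \<iota> (6 ^ l) = \<iota> n"
    using assms(2) by (rule Z_sixth_map_cases)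
  show ?thesis
  proof (rule Z_sixth_map_eqI[of _ "m * n" "k + l"])
    show "r * s = of_int (m * n) / 6 ^ (k + l)"
      unfolding r s by (simp add: field_simps power_add)
    have "(\<phi> r \<otimes> \<phi> s) \<otimes> \<iota> (6 ^ (k + l)) = (\<phi> r \<otimes> \<iota> (6 ^ k)) \<otimes> (\<phi> s \<otimes> \<iota> (6 ^ l))"
      using assms by (simp add: power_add iota_mult m_ac)
    then show "(\<phi> r \<otimes> \<phi> s) \<otimes> \<iota> (6 ^ (k + l)) = \<iota> (m * n)"
      by (simp add: r(2) s(2) iota_mult)
  qed (use assms in auto)
qed

lemma Z_sixth_map_of_int: "\<phi> (of_int a) = \<iota> a"
  by (rule Z_sixth_map_eqI[of _ a 0]) (auto simp: Z_sixth_of_int)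

lemma Z_sixth_map_0 [simp]: "\<phi> 0 = \<zero>" and Z_sixth_map_1 [simp]: "\<phi> 1 = \<one>"
  using Z_sixth_map_of_int[of 0] Z_sixth_map_of_int[of 1] by (simp_all add: add_pow_def int_pow_def nat_pow_def)

lemma Z_sixth_map_uminus [simp]:
  assumes "r \<in> carrier Z_sixth"
  shows "\<phi> (- r) = \<ominus> \<phi> r"
  using assms Z_sixth_map_add[of "- r" r] by (intro minus_equality[symmetric]) auto

lemma Z_sixth_map_diff [simp]:
  "r \<in> carrier Z_sixth \<Longrightarrow> s \<in> carrier Z_sixth \<Longrightarrow> \<phi> (r - s) = \<phi> r \<ominus> \<phi> s"
  using Z_sixth_map_add[of r "- s"] by (simp add: minus_eq)

end

lemma finite_hall: "finite (hall d)"
proof (rule finite_subset)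
  show "hall d \<subseteq> {l. set l \<subseteq> {..<d} \<and> length l \<le> 3}"
    by (auto simp: hall_def)
qed (simp add: finite_lists_length_le)

section \<open>Formal sums, their coordinates, and the base change\<close>

locale f3_base_change = sixth_algebra S for S :: "('s, 'n) ring_scheme" (structure) +
  fixes d :: nat
begin

declare in_listsD [rule del] in_listsI [rule del]

abbreviation "L \<equiv> f3 d"
abbreviation "E \<equiv> tensor_cong Z_sixth \<phi> S L"
abbreviation "TS \<equiv> tensor_sums S L"
definition "M = base_change Z_sixth \<phi> S L"
definition "tclass v = E `` {v}"

text \<open>The S-linear extension of a rational-valued function to formal sums. The type of the
  left entries stays open because the bracket is evaluated on sums indexed by pairs of Lie
  elements.\<close>

primrec tval :: "('x \<Rightarrow> rat) \<Rightarrow> ('x \<times> 's) list \<Rightarrow> 's" where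
  "tval f [] = \<zero>"
| "tval f (p # v) = \<phi> (f (fst p)) \<otimes> snd p \<oplus> tval f v"

definition tval_ok :: "('x \<Rightarrow> rat) \<Rightarrow> ('x \<times> 's) list \<Rightarrow> bool"
  where "tval_ok f v \<longleftrightarrow> (\<forall>(x, s)\<in>set v. f x \<in> carrier Z_sixth \<and> s \<in> carrier S)"

lemma tval_ok_simps [simp]:
  "tval_ok f []" "tval_ok f (p # v) \<longleftrightarrow> f (fst p) \<in> carrier Z_sixth \<and> snd p \<in> carrier S \<and> tval_ok f v"
  "tval_ok f (v @ w) \<longleftrightarrow> tval_ok f v \<and> tval_ok f w"
  by (auto simp: tval_ok_def)

abbreviation "tcoord v l \<equiv> tval (\<lambda>X. lie_coord X l) v"

lemma tval_closed [simp]: "tval_ok f v \<Longrightarrow> tval f v \<in> carrier S"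
  by (induction v) auto

lemma tval_append: "tval_ok f v \<Longrightarrow> tval_ok f w \<Longrightarrow> tval f (v @ w) = tval f v \<oplus> tval f w"
  by (induction v) (simp_all add: a_assoc)

lemma TS_ok [simp]: "v \<in> TS \<Longrightarrow> tval_ok (\<lambda>X. lie_coord X l) v"
  by (auto simp: tval_ok_def in_lists_conv_set lie_coord_Z_sixth)

lemma TS_Nil [simp]: "[] \<in> TS"
  by simp

lemma tensor_cong_TS: "(v, w) \<in> E \<Longrightarrow> v \<in> TS \<and> w \<in> TS"
proof (induction rule: tensor_cong.induct)
  case (zero s)
  then show ?case using f3_closed(4) f3_zero by (auto simp: lie_terms.zero)
qed (auto intro: f3_closed)

lemma equiv_E: "equiv TS E"
proof (rule equivI)
  show "E \<subseteq> TS \<times> TS"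
    using tensor_cong_TS by auto
  show "refl_on TS E"
    by (intro refl_onI tensor_cong.refl)
  show "sym E"
    by (rule symI) (rule tensor_cong.sym)
  show "trans E"
    by (rule transI) (rule tensor_cong.trans)
qed

lemma tcoord_cong: "(v, w) \<in> E \<Longrightarrow> tcoord v l = tcoord w l"
proof (induction rule: tensor_cong.induct)
  case (cong_append v v' w w')
  then show ?case
    using tensor_cong_TS[of v v'] tensor_cong_TS[of w w'] by (simp add: tval_append lie_coord_Z_sixth)
next
  case (comm v w)
  then show ?case by (simp add: tval_append lie_coord_Z_sixth a_comm)
next
  case (add_left x y s)
  then show ?case by (simp add: lie_coord_add lie_coord_Z_sixth l_distr)
next
  case (add_right x s t)
  then show ?case by (simp add: lie_coord_Z_sixth r_distr)
next
  case (balanced a x s)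
  then show ?case by (simp add: lie_coord_smult lie_coord_Z_sixth m_ac)
qed (auto simp: lie_coord_zero)

lemma tclass_eq_iff: "v \<in> TS \<Longrightarrow> w \<in> TS \<Longrightarrow> tclass v = tclass w \<longleftrightarrow> (v, w) \<in> E"
  unfolding tclass_def by (rule eq_equiv_class_iff[OF equiv_E])

lemma carrier_M: "carrier M = tclass ` TS"
  by (auto simp: M_def base_change_def Let_def tclass_def quotient_def)

lemma tclass_closed [simp]: "v \<in> TS \<Longrightarrow> tclass v \<in> carrier M"
  by (simp add: carrier_M)

lemma M_cases:
  assumes "V \<in> carrier M"
  obtains v where "v \<in> TS" "V = tclass v"
  using assms by (auto simp: carrier_M)

definition coord :: "(rat lie_term set \<times> 's) list set \<Rightarrow> nat list \<Rightarrow> 's"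
  where "coord V l = tcoord (SOME v. v \<in> V) l"

lemma coord_tclass:
  assumes "v \<in> TS"
  shows "coord (tclass v) l = tcoord v l"
proof -
  have "v \<in> tclass v"
    using assms by (simp add: tclass_def tensor_cong.refl)
  then have "(SOME w. w \<in> tclass v) \<in> tclass v"
    by (rule someI)
  then have "(v, SOME w. w \<in> tclass v) \<in> E"
    by (simp add: tclass_def)
  from tcoord_cong[OF this] show ?thesis
    by (simp add: coord_def)
qed

lemma coord_closed [simp]: "V \<in> carrier M \<Longrightarrow> coord V l \<in> carrier S"
  by (elim M_cases) (simp add: coord_tclass lie_coord_Z_sixth)

lemma M_zero: "\<zero>\<^bsub>M\<^esub> = tclass []"
  by (simp add: M_def base_change_def Let_def tclass_def)

lemma M_add:
  assumes "v \<in> TS" "w \<in> TS"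
  shows "tclass v \<oplus>\<^bsub>M\<^esub> tclass w = tclass (v @ w)"
proof -
  have "tclass v \<oplus>\<^bsub>M\<^esub> tclass w = (\<Union>v'\<in>tclass v. \<Union>w'\<in>tclass w. tclass (v' @ w'))"
    by (simp add: M_def base_change_def Let_def tclass_def)
  also have "\<dots> = (\<Union>v'\<in>tclass v. tclass (v' @ w))"
    unfolding tclass_def
    by (intro SUP_cong refl UN_class[OF equiv_E assms(2)] equiv_class_eq[OF equiv_E]
        tensor_cong.cong_append)
      (use assms(1) in \<open>auto dest: tensor_cong_TS intro: tensor_cong.refl tensor_cong.sym\<close>)
  also have "\<dots> = tclass (v @ w)"
    unfolding tclass_def using assms(2)
    by (intro UN_class[OF equiv_E assms(1)] equiv_class_eq[OF equiv_E]
        tensor_cong.cong_append) (auto intro: tensor_cong.refl tensor_cong.sym)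
  finally show ?thesis .
qed

lemma M_zero_closed: "\<zero>\<^bsub>M\<^esub> \<in> carrier M"
  by (simp add: M_zero)

lemma M_add_closed: "V \<in> carrier M \<Longrightarrow> W \<in> carrier M \<Longrightarrow> V \<oplus>\<^bsub>M\<^esub> W \<in> carrier M"
  by (elim M_cases) (simp add: M_add)

lemma coord_zero: "coord \<zero>\<^bsub>M\<^esub> l = \<zero>"
  by (simp add: M_zero coord_tclass)

lemma coord_add: "V \<in> carrier M \<Longrightarrow> W \<in> carrier M \<Longrightarrow> coord (V \<oplus>\<^bsub>M\<^esub> W) l = coord V l \<oplus> coord W l"
  by (elim M_cases) (simp add: M_add coord_tclass tval_append lie_coord_Z_sixth)

section \<open>Normal forms: the base change is free on the Hall elements\<close>

definition hall_list :: "nat list list"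
  where "hall_list = (SOME l. set l = hall d \<and> distinct l)"

lemma hall_list: "set hall_list = hall d" "distinct hall_list"
  using someI_ex[OF finite_distinct_list[OF finite_hall[of d]]] by (simp_all add: hall_list_def)

definition hall_class :: "nat list \<Rightarrow> rat lie_term set"
  where "hall_class b = lie_class d (hall_term b)"

text \<open>The formal sum of the pure tensors b (x) c(b) over the Hall elements. Formal sums are
  lists, hence the fixed enumeration.\<close>

definition nf :: "(nat list \<Rightarrow> 's) \<Rightarrow> (rat lie_term set \<times> 's) list"
  where "nf c = map (\<lambda>b. (hall_class b, c b)) hall_list"

lemma hall_class_closed [simp]: "b \<in> hall d \<Longrightarrow> hall_class b \<in> carrier L"
  by (simp add: hall_class_def hall_term_in_lie_terms)

lemma lie_coord_hall_class:
  "b \<in> hall d \<Longrightarrow> b' \<in> hall d \<Longrightarrow> lie_coord (hall_class b) b' = of_bool (b = b')"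
  by (simp add: hall_class_def lie_coord_class hall_term_in_lie_terms term_coord_hall_term)

lemma nf_TS: "c \<in> hall d \<rightarrow> carrier S \<Longrightarrow> nf c \<in> TS"
  by (auto simp: nf_def in_lists_conv_set hall_list)

lemma tcoord_nf:
  assumes "c \<in> hall d \<rightarrow> carrier S" "b \<in> hall d"
  shows "tcoord (nf c) b = c b"
proof -
  have "tcoord (map (\<lambda>b. (hall_class b, c b)) l) b = (if b \<in> set l then c b else \<zero>)"
    if "set l \<subseteq> hall d" "distinct l" for l
    using that
  proof (induction l)
    case (Cons a l)
    moreover have "c a \<in> carrier S" "c b \<in> carrier S" using Cons.prems assms by auto
    ultimately show ?case
      using assms(2) by (auto simp: lie_coord_hall_class)
  qed simp
  from this[of hall_list] show ?thesis
    using assms(2) hall_list by (simp add: nf_def)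
qed

lemmas E_zero = tensor_cong.zero[where A = Z_sixth and \<phi> = \<phi> and S = S and L = L]
lemmas E_add_left = tensor_cong.add_left[where A = Z_sixth and \<phi> = \<phi> and S = S and L = L]
lemmas E_balanced = tensor_cong.balanced[where A = Z_sixth and \<phi> = \<phi> and S = S and L = L]

text \<open>The relations impose 0 (x) s = 0 only. Moving the scalar 0 across the tensor sign gives
  the other side.\<close>

lemma zero_pure: "X \<in> carrier L \<Longrightarrow> ([(X, \<zero>)], []) \<in> E"
  by (rule tensor_cong.trans[OF tensor_cong.sym E_zero[of \<zero>]])
    (use E_balanced[of 0 X \<zero>] in \<open>simp_all add: f3_smult_zero\<close>)

lemma nf_add_aux:
  assumes "set l \<subseteq> hall d" "c \<in> hall d \<rightarrow> carrier S" "c' \<in> hall d \<rightarrow> carrier S"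
  shows "(map (\<lambda>b. (hall_class b, c b)) l @ map (\<lambda>b. (hall_class b, c' b)) l,
    map (\<lambda>b. (hall_class b, c b \<oplus> c' b)) l) \<in> E"
  using assms(1)
proof (induction l)
  case Nil
  show ?case by (simp add: tensor_cong.refl)
next
  case (Cons a l)
  let ?f = "\<lambda>c l. map (\<lambda>b. (hall_class b, c b)) l"
  have a: "a \<in> hall d" "c a \<in> carrier S" "c' a \<in> carrier S" using Cons.prems assms by auto
  have TS: "?f c l \<in> TS" "?f c' l \<in> TS" "[(hall_class a, c a)] \<in> TS" "[(hall_class a, c' a)] \<in> TS"
    using Cons.prems assms by (auto simp: in_lists_conv_set)
  \<comment> \<open>The head of the second sum is moved past the tail of the first, so that the two
    tensors with left entry \<open>hall_class a\<close> become adjacent and can be merged.\<close>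
  have "([(hall_class a, c a)] @ (?f c l @ [(hall_class a, c' a)]) @ ?f c' l,
      [(hall_class a, c a)] @ ([(hall_class a, c' a)] @ ?f c l) @ ?f c' l) \<in> E"
    by (intro tensor_cong.cong_append tensor_cong.comm tensor_cong.refl TS)
  moreover have "([(hall_class a, c a), (hall_class a, c' a)] @ (?f c l @ ?f c' l),
      [(hall_class a, c a \<oplus> c' a)] @ ?f (\<lambda>b. c b \<oplus> c' b) l) \<in> E"
    using Cons a by (intro tensor_cong.cong_append tensor_cong.sym[OF tensor_cong.add_right]) auto
  ultimately show ?case
    using tensor_cong.trans by fastforce
qed

lemma nf_add:
  "c \<in> hall d \<rightarrow> carrier S \<Longrightarrow> c' \<in> hall d \<rightarrow> carrier S \<Longrightarrow> (nf c @ nf c', nf (\<lambda>b. c b \<oplus> c' b)) \<in> E"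
  unfolding nf_def by (rule nf_add_aux) (simp_all add: hall_list)

lemma nf_single_aux:
  assumes "set l \<subseteq> hall d" "distinct l" "s \<in> carrier S"
  shows "(map (\<lambda>a. (hall_class a, if a = b then s else \<zero>)) l,
    if b \<in> set l then [(hall_class b, s)] else []) \<in> E"
  using assms(1,2)
proof (induction l)
  case Nil
  show ?case by (simp add: tensor_cong.refl)
next
  case (Cons a l)
  let ?f = "map (\<lambda>a. (hall_class a, if a = b then s else \<zero>)) l"
  have a: "a \<in> hall d" and IH: "(?f, if b \<in> set l then [(hall_class b, s)] else []) \<in> E"
    using Cons by auto
  show ?case
  proof (cases "a = b")
    case True
    then have "([(hall_class a, s)] @ ?f, [(hall_class a, s)] @ []) \<in> E"
      using Cons.prems IH a assms(3) by (intro tensor_cong.cong_append tensor_cong.refl) auto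
    then show ?thesis using True Cons.prems by simp
  next
    case False
    then have "([(hall_class a, \<zero>)] @ ?f, [] @ (if b \<in> set l then [(hall_class b, s)] else [])) \<in> E"
      using IH a by (intro tensor_cong.cong_append zero_pure) auto
    then show ?thesis using False by simp
  qed
qed

lemma nf_single: "b \<in> hall d \<Longrightarrow> s \<in> carrier S \<Longrightarrow> (nf (\<lambda>a. if a = b then s else \<zero>), [(hall_class b, s)]) \<in> E"
  using nf_single_aux[of hall_list s b] by (simp add: nf_def hall_list)

lemma nf_zero: "(nf (\<lambda>_. \<zero>), []) \<in> E"
proof -
  have "(map (\<lambda>b. (hall_class b, \<zero>)) l, []) \<in> E" if "set l \<subseteq> hall d" for l
    using that
  proof (induction l)
    case (Cons a l)
    then have "([(hall_class a, \<zero>)] @ map (\<lambda>b. (hall_class b, \<zero>)) l, [] @ []) \<in> E"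
      by (intro tensor_cong.cong_append zero_pure) auto
    then show ?case by simp
  qed (simp add: tensor_cong.refl)
  then show ?thesis by (simp add: nf_def hall_list)
qed

definition nfable :: "(rat lie_term set \<times> 's) list \<Rightarrow> bool"
  where "nfable v \<longleftrightarrow> (\<exists>c \<in> hall d \<rightarrow> carrier S. (v, nf c) \<in> E)"

lemma nfable_cong: "(v, w) \<in> E \<Longrightarrow> nfable w \<Longrightarrow> nfable v"
  unfolding nfable_def by (blast intro: tensor_cong.trans)

lemma nfable_Nil: "nfable []"
  unfolding nfable_def using tensor_cong.sym[OF nf_zero] by (intro bexI[of _ "\<lambda>_. \<zero>"]) auto

lemma nfable_append:
  assumes "nfable v" "nfable w"
  shows "nfable (v @ w)"
proof -
  obtain c c' where c: "c \<in> hall d \<rightarrow> carrier S" "(v, nf c) \<in> E"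
    and c': "c' \<in> hall d \<rightarrow> carrier S" "(w, nf c') \<in> E"
    using assms unfolding nfable_def by blast
  have "(v @ w, nf (\<lambda>b. c b \<oplus> c' b)) \<in> E"
    by (rule tensor_cong.trans[OF tensor_cong.cong_append[OF c(2) c'(2)] nf_add[OF c(1) c'(1)]])
  then show ?thesis
    unfolding nfable_def using c c' by (intro bexI[of _ "\<lambda>b. c b \<oplus> c' b"]) auto
qed

text \<open>The right entry s stays arbitrary in the induction, since a scalar on the left is
  absorbed into it by balancing.\<close>

lemma nfable_pure:
  assumes "t \<in> hall_span Z_sixth d" "s \<in> carrier S"
  shows "nfable [(lie_class d t, s)]"
  using assms
proof (induction arbitrary: s rule: hall_span.induct)
  case (base b)
  then show ?case
    unfolding nfable_def using tensor_cong.sym[OF nf_single[of b s]]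
    by (intro bexI[of _ "\<lambda>a. if a = b then s else \<zero>"]) (auto simp: hall_class_def)
next
  case zero
  then show ?case
    using nfable_cong[OF E_zero[of s] nfable_Nil] by (simp add: f3_zero)
next
  case (add t u)
  note T = Z_sixth.hall_span_lie_terms[OF add.hyps(1)] Z_sixth.hall_span_lie_terms[OF add.hyps(2)]
  have "([(lie_class d (LAdd t u), s)], [(lie_class d t, s)] @ [(lie_class d u, s)]) \<in> E"
    using E_add_left[of "lie_class d t" "lie_class d u" s] T add.prems
    by (simp add: f3_add)
  then show ?case
    by (rule nfable_cong) (intro nfable_append add.IH add.prems)
next
  case (smult a t)
  note T = Z_sixth.hall_span_lie_terms[OF smult.hyps(2)]
  have "([(lie_class d (LSmult a t), s)], [(lie_class d t, \<phi> a \<otimes> s)]) \<in> E"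
    using E_balanced[of a "lie_class d t" s] T smult
    by (simp add: f3_smult)
  then show ?case
    by (rule nfable_cong) (use smult in auto)
next
  case (cong t s)
  then show ?case by (simp add: lie_class_eqI)
qed

lemma nfable_all: "v \<in> TS \<Longrightarrow> nfable v"
proof (induction v)
  case Nil
  show ?case by (rule nfable_Nil)
next
  case (Cons p v)
  obtain X s where p: "p = (X, s)" "X \<in> carrier L" "s \<in> carrier S"
    using Cons.prems by (cases p) auto
  obtain t where t: "t \<in> lie_terms Z_sixth d" "X = lie_class d t"
    using p(2) by (rule f3_cases)
  have "nfable ([p] @ v)"
    using Cons p t by (intro nfable_append) (auto intro: nfable_pure Z_sixth.lie_terms_in_hall_span)
  then show ?case by simp
qed

lemma nf_cong: "(\<And>b. b \<in> hall d \<Longrightarrow> c b = c' b) \<Longrightarrow> nf c = nf c'"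
  unfolding nf_def by (simp add: hall_list)

text \<open>Every formal sum is congruent to a normal form, and the coordinates of a normal form are
  its coefficients. Later this criterion also settles that scalar multiplication and bracket are
  well defined.\<close>

lemma tensor_congI:
  assumes "v \<in> TS" "w \<in> TS" "\<And>b. b \<in> hall d \<Longrightarrow> tcoord v b = tcoord w b"
  shows "(v, w) \<in> E"
proof -
  obtain c where c: "c \<in> hall d \<rightarrow> carrier S" "(v, nf c) \<in> E"
    using nfable_all[OF assms(1)] unfolding nfable_def ..
  obtain c' where c': "c' \<in> hall d \<rightarrow> carrier S" "(w, nf c') \<in> E"
    using nfable_all[OF assms(2)] unfolding nfable_def ..
  have "nf c = nf c'"
  proof (rule nf_cong)
    fix b assume b: "b \<in> hall d"
    have "c b = tcoord v b"
      using tcoord_nf[OF c(1) b] tcoord_cong[OF c(2)] by simp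
    also have "\<dots> = c' b"
      using tcoord_nf[OF c'(1) b] tcoord_cong[OF c'(2)] assms(3)[OF b] by simp
    finally show "c b = c' b" .
  qed
  with c'(2) have "(nf c, w) \<in> E"
    by (simp add: tensor_cong.sym)
  with c(2) show ?thesis
    by (rule tensor_cong.trans)
qed

lemma M_eqI:
  assumes "V \<in> carrier M" "W \<in> carrier M" "\<And>b. b \<in> hall d \<Longrightarrow> coord V b = coord W b"
  shows "V = W"
proof -
  obtain v w where vw: "v \<in> TS" "V = tclass v" "w \<in> TS" "W = tclass w"
    using assms(1,2) by (metis M_cases)
  with assms(3) have "(v, w) \<in> E"
    by (intro tensor_congI) (auto simp: coord_tclass)
  with vw show ?thesis
    by (simp add: tclass_eq_iff)
qed

text \<open>Freeness, in the form in which it is used for counting.\<close>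

lemma bij_betw_coord:
  "bij_betw (\<lambda>V. restrict (coord V) (hall d)) (carrier M) (hall d \<rightarrow>\<^sub>E carrier S)"
proof (rule bij_betw_imageI)
  show "inj_on (\<lambda>V. restrict (coord V) (hall d)) (carrier M)"
    by (rule inj_onI) (metis M_eqI restrict_apply')
  show "(\<lambda>V. restrict (coord V) (hall d)) ` carrier M = hall d \<rightarrow>\<^sub>E carrier S"
  proof (intro equalityI subsetI)
    fix c assume c: "c \<in> hall d \<rightarrow>\<^sub>E carrier S"
    then have TS: "nf c \<in> TS" by (auto intro: nf_TS)
    have "c = restrict (coord (tclass (nf c))) (hall d)"
      using c TS by (intro PiE_ext[of c "hall d" "\<lambda>_. carrier S"])
        (auto simp: coord_tclass tcoord_nf PiE_def)
    then show "c \<in> (\<lambda>V. restrict (coord V) (hall d)) ` carrier M"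
      using TS by (intro image_eqI[of _ _ "tclass (nf c)"]) auto
  qed auto
qed

end

section \<open>The Baker--Campbell--Hausdorff group\<close>

context cring
begin

text \<open>The formula of \<open>bracket_coord\<close> over a ring with explicit carrier: the
  quotient rings in question are not type class instances.\<close>

fun sbracket :: "(nat list \<Rightarrow> 'a) \<Rightarrow> (nat list \<Rightarrow> 'a) \<Rightarrow> nat list \<Rightarrow> 'a" where
  "sbracket x y [j, k] = x [j] \<otimes> y [k] \<ominus> y [j] \<otimes> x [k]"
| "sbracket x y [i, j, k] =
    (if i = j then x [j] \<otimes> y [j, k] \<ominus> y [j] \<otimes> x [j, k]
     else x [i] \<otimes> y [j, k] \<ominus> y [i] \<otimes> x [j, k] \<oplus> (x [j] \<otimes> y [i, k] \<ominus> y [j] \<otimes> x [i, k]))"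
| "sbracket x y l = \<zero>"

text \<open>The group law in coordinates, with \<open>h\<close> and \<open>u\<close> in the roles of
  1/2 and 1/12.\<close>

definition bch :: "'a \<Rightarrow> 'a \<Rightarrow> (nat list \<Rightarrow> 'a) \<Rightarrow> (nat list \<Rightarrow> 'a) \<Rightarrow> nat list \<Rightarrow> 'a"
  where "bch h u x y l = x l \<oplus> y l \<oplus> h \<otimes> sbracket x y l
    \<oplus> u \<otimes> (sbracket x (sbracket x y) l \<oplus> sbracket y (sbracket y x) l)"

lemma sbracket_other: "length l \<notin> {2, 3} \<Longrightarrow> sbracket x y l = \<zero>"
  by (induction x y l rule: sbracket.induct) auto

lemma sbracket_closed [simp]:
  "(\<And>l. x l \<in> carrier R) \<Longrightarrow> (\<And>l. y l \<in> carrier R) \<Longrightarrow> sbracket x y l \<in> carrier R"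
  by (rule length_three_cases[of l]) (simp_all add: sbracket_other)

end

text \<open>
  The associativity of the group law is a polynomial identity in the coordinates of three elements,
  checked by reflection. The indices \<open>0, 1, 2\<close> stand for the generators that occur. In degree three
  the identity only holds modulo the relation \<open>12 u = 1\<close>; the second summand of \<open>passoc\<close> is the
  multiple of \<open>12 u - 1\<close> by which the two sides differ.
\<close>

definition pindex :: "nat list \<Rightarrow> nat"
  where "pindex l = (if l = [0] then 0 else if l = [1] then 1 else if l = [2] then 2
    else if l = [0, 1] then 3 else if l = [1, 2] then 4 else if l = [0, 2] then 5 else 6)"

definition pvar :: "nat \<Rightarrow> nat list \<Rightarrow> polex"
  where "pvar m l = Var (1 + 7 * m + pindex l)"

fun pbracket :: "(nat list \<Rightarrow> polex) \<Rightarrow> (nat list \<Rightarrow> polex) \<Rightarrow> nat list \<Rightarrow> polex" where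
  "pbracket x y [j, k] = Sub (Mul (x [j]) (y [k])) (Mul (y [j]) (x [k]))"
| "pbracket x y [i, j, k] =
    (if i = j then Sub (Mul (x [j]) (y [j, k])) (Mul (y [j]) (x [j, k]))
     else Add (Sub (Mul (x [i]) (y [j, k])) (Mul (y [i]) (x [j, k])))
       (Sub (Mul (x [j]) (y [i, k])) (Mul (y [j]) (x [i, k]))))"
| "pbracket x y l = Const 0"

definition pu :: polex where "pu = Var 0"
definition phalf :: polex where "phalf = Add pu (Add pu (Add pu (Add pu (Add pu pu))))"

definition pbch :: "(nat list \<Rightarrow> polex) \<Rightarrow> (nat list \<Rightarrow> polex) \<Rightarrow> nat list \<Rightarrow> polex"
  where "pbch x y l = Add (Add (Add (x l) (y l)) (Mul phalf (pbracket x y l)))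
    (Mul pu (Add (pbracket x (pbracket x y) l) (pbracket y (pbracket y x) l)))"

definition passoc :: "nat list \<Rightarrow> polex"
  where "passoc l = Add (pbch (pvar 0) (pbch (pvar 1) (pvar 2)) l)
    (Mul (Neg (Mul (Add pu (Add pu pu)) (pbracket (pvar 1) (pbracket (pvar 0) (pvar 2)) l)))
      (Sub (Add phalf phalf) (Const 1)))"

text \<open>In degree three (x y) z - x (y z) equals (3u - h^2) [y, [x, z]] by the Jacobi identity.
  With h = 6u this is -3u (12u - 1) [y, [x, z]], the correction in \<open>passoc\<close>. The three
  index patterns are degree two and the two clauses of the bracket in degree three.\<close>

lemma norm_assoc:
  "norm (pbch (pbch (pvar 0) (pvar 1)) (pvar 2) [0, 1]) = norm (passoc [0, 1])"
  "norm (pbch (pbch (pvar 0) (pvar 1)) (pvar 2) [0, 0, 1]) = norm (passoc [0, 0, 1])"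
  "norm (pbch (pbch (pvar 0) (pvar 1)) (pvar 2) [0, 1, 2]) = norm (passoc [0, 1, 2])"
  by code_simp+

context cring
begin

lemma bch_assoc:
  assumes x: "\<And>l. x l \<in> carrier R" and y: "\<And>l. y l \<in> carrier R" and z: "\<And>l. z l \<in> carrier R"
    and u: "u \<in> carrier R" and h: "h = u \<oplus> (u \<oplus> (u \<oplus> (u \<oplus> (u \<oplus> u))))" "h \<oplus> h = \<one>"
  shows "bch h u (bch h u x y) z l = bch h u x (bch h u y z) l"
proof (rule length_three_cases[of l])
  have h1: "h \<in> carrier R" using h u by simp
  note c = x y z u h1
  \<comment> \<open>Variable 0 is \<open>u\<close>, followed by seven slots for each of x, y, z in
    the order of \<open>pindex\<close>; slots without a counterpart in the pattern at hand hold
    \<open>[]\<close>. The correction in \<open>passoc\<close> is killed by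
    \<open>zero\<close>.\<close>
  let ?env = "\<lambda>e. u # map x e @ map y e @ map z e"
  have env: "in_carrier (?env e)" for e
    using x y z u by (auto simp: in_carrier_def)
  have zero: "h \<oplus> h \<ominus> \<one> = \<zero>" using h(2) by (simp add: r_neg minus_eq)
  show ?thesis if "l = [i]" for i
    using that c by (simp add: bch_def a_ac)
  show ?thesis if "length l \<notin> {1, 2, 3}"
    using that c by (simp add: bch_def sbracket_other a_ac)
  show ?thesis if l: "l = [j, k]" for j k
    using norm_eq[OF env[of "[[j], [k], [], [j, k], [], [], []]"] norm_assoc(1)]
    using c zero
    by (simp add: l bch_def passoc_def pbch_def pvar_def pindex_def pu_def phalf_def
        h(1)[symmetric])
  show ?thesis if l: "l = [i, j, k]" for i j k
  proof (cases "i = j")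
    case True
    then show ?thesis
      using norm_eq[OF env[of "[[i], [k], [], [i, k], [], [], [i, i, k]]"] norm_assoc(2)]
      using c zero
      by (simp add: l bch_def passoc_def pbch_def pvar_def pindex_def pu_def phalf_def
          h(1)[symmetric])
  next
    case False
    then show ?thesis
      using norm_eq[OF env[of "[[i], [j], [k], [i, j], [j, k], [i, k], [i, j, k]]"] norm_assoc(3)]
      using c zero
      by (simp add: l bch_def passoc_def pbch_def pvar_def pindex_def pu_def phalf_def
          h(1)[symmetric])
  qed
qed

end

context cring
begin

lemma sbracket_zero_left: "(\<And>l. y l \<in> carrier R) \<Longrightarrow> sbracket (\<lambda>_. \<zero>) y l = \<zero>"
  by (rule length_three_cases[of l]) (simp_all add: sbracket_other)

lemma sbracket_zero_right: "(\<And>l. y l \<in> carrier R) \<Longrightarrow> sbracket y (\<lambda>_. \<zero>) l = \<zero>"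
  by (rule length_three_cases[of l]) (simp_all add: sbracket_other)

lemma sbracket_neg_self: "(\<And>l. x l \<in> carrier R) \<Longrightarrow> sbracket (\<lambda>l. \<ominus> x l) x l = \<zero>"
  by (rule length_three_cases[of l]) (simp_all add: sbracket_other l_minus r_minus minus_eq l_neg m_comm)

lemma sbracket_self_neg: "(\<And>l. x l \<in> carrier R) \<Longrightarrow> sbracket x (\<lambda>l. \<ominus> x l) l = \<zero>"
  by (rule length_three_cases[of l]) (simp_all add: sbracket_other l_minus r_minus minus_eq r_neg l_neg m_comm)

lemma sbracket_antisym:
  assumes "\<And>l. x l \<in> carrier R" "\<And>l. y l \<in> carrier R"
  shows "sbracket y x l = \<ominus> sbracket x y l"
  by (rule length_three_cases[of l]) (simp_all add: assms sbracket_other minus_eq minus_add a_ac m_ac)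

lemma bch_zero_left:
  assumes "h \<in> carrier R" "u \<in> carrier R" "\<And>l. y l \<in> carrier R"
  shows "bch h u (\<lambda>_. \<zero>) y l = y l"
proof -
  have "sbracket (\<lambda>_. \<zero>) y = (\<lambda>_. \<zero>)" "sbracket y (\<lambda>_. \<zero>) = (\<lambda>_. \<zero>)"
    using assms(3) by (auto simp: sbracket_zero_left sbracket_zero_right)
  then show ?thesis
    using assms by (simp add: bch_def sbracket_zero_left)
qed

lemma bch_neg_self:
  assumes "h \<in> carrier R" "u \<in> carrier R" "\<And>l. x l \<in> carrier R"
  shows "bch h u (\<lambda>l. \<ominus> x l) x l = \<zero>"
proof -
  have "sbracket (\<lambda>l. \<ominus> x l) x = (\<lambda>_. \<zero>)" "sbracket x (\<lambda>l. \<ominus> x l) = (\<lambda>_. \<zero>)"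
    using assms(3) by (auto simp: sbracket_neg_self sbracket_self_neg)
  then show ?thesis
    using assms by (simp add: bch_def sbracket_zero_right l_neg)
qed

text \<open>The cubic term is symmetric in x and y, so exchanging the factors only changes the sign
  of the term with \<open>h\<close>; twice that term is the bracket.\<close>

lemma bch_commute_iff:
  assumes x: "\<And>l. x l \<in> carrier R" and y: "\<And>l. y l \<in> carrier R"
    and u: "u \<in> carrier R" and h: "h \<in> carrier R" "h \<oplus> h = \<one>"
  shows "bch h u x y l = bch h u y x l \<longleftrightarrow> sbracket x y l = \<zero>"
proof -
  let ?b = "sbracket x y l"
  let ?C = "u \<otimes> (sbracket x (sbracket x y) l \<oplus> sbracket y (sbracket y x) l)"
  have C: "?C \<in> carrier R" "h \<otimes> ?b \<in> carrier R" "?b \<in> carrier R" using x y u h by auto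
  have 1: "bch h u x y l = (x l \<oplus> y l \<oplus> ?C) \<oplus> h \<otimes> ?b"
    using C x y by (simp add: bch_def a_ac)
  have 2: "bch h u y x l = (x l \<oplus> y l \<oplus> ?C) \<oplus> \<ominus> (h \<otimes> ?b)"
    using C x y u h by (simp add: bch_def a_ac sbracket_antisym[OF x y] r_minus)
  have "bch h u x y l = bch h u y x l \<longleftrightarrow> h \<otimes> ?b = \<ominus> (h \<otimes> ?b)"
    unfolding 1 2 using C x y by (subst add.l_cancel) auto
  also have "\<dots> \<longleftrightarrow> h \<otimes> ?b \<oplus> h \<otimes> ?b = \<zero>"
    using C by (metis minus_equality minus_minus r_neg)
  also have "h \<otimes> ?b \<oplus> h \<otimes> ?b = ?b"
    using C h by (simp add: l_distr[symmetric])
  finally show ?thesis .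
qed

end

section \<open>Scalar multiplication, bracket and group law on the base change\<close>

context f3_base_change
begin

lemma tval_smult:
  "tval_ok f v \<Longrightarrow> a \<in> carrier S \<Longrightarrow> tval f (map (\<lambda>(x, s). (x, a \<otimes> s)) v) = a \<otimes> tval f v"
  by (induction v) (auto simp: r_distr m_ac)

lemma M_smult:
  assumes "v \<in> TS" "a \<in> carrier S"
  shows "a \<odot>\<^bsub>M\<^esub> tclass v = tclass (map (\<lambda>(x, s). (x, a \<otimes> s)) v)"
proof -
  have TS: "map (\<lambda>(x, s). (x, a \<otimes> s)) w \<in> TS" if "w \<in> TS" for w
    using that assms(2) by (auto simp: in_lists_conv_set)
  have "a \<odot>\<^bsub>M\<^esub> tclass v = (\<Union>v'\<in>tclass v. tclass (map (\<lambda>(x, s). (x, a \<otimes> s)) v'))"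
    by (simp add: M_def base_change_def Let_def tclass_def)
  also have "\<dots> = tclass (map (\<lambda>(x, s). (x, a \<otimes> s)) v)"
    unfolding tclass_def
  proof (intro UN_class[OF equiv_E assms(1)] equiv_class_eq[OF equiv_E])
    fix v' assume E: "(v, v') \<in> E"
    then have "v' \<in> TS" by (simp add: tensor_cong_TS)
    then show "(map (\<lambda>(x, s). (x, a \<otimes> s)) v', map (\<lambda>(x, s). (x, a \<otimes> s)) v) \<in> E"
      using assms tcoord_cong[OF E] by (intro tensor_congI TS) (simp_all add: tval_smult)
  qed
  finally show ?thesis .
qed

lemma M_smult_closed: "a \<in> carrier S \<Longrightarrow> V \<in> carrier M \<Longrightarrow> a \<odot>\<^bsub>M\<^esub> V \<in> carrier M"
  by (elim M_cases) (fastforce simp: M_smult in_lists_conv_set intro!: tclass_closed)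

lemma coord_smult:
  assumes "a \<in> carrier S" "V \<in> carrier M"
  shows "coord (a \<odot>\<^bsub>M\<^esub> V) l = a \<otimes> coord V l"
proof -
  obtain v where v: "v \<in> TS" "V = tclass v"
    using assms(2) by (rule M_cases)
  then have "map (\<lambda>(x, s). (x, a \<otimes> s)) v \<in> TS"
    using assms(1) by (auto simp: in_lists_conv_set)
  with v assms(1) show ?thesis
    by (simp add: M_smult coord_tclass tval_smult)
qed

text \<open>The double sum with its pairs left unevaluated: a bilinear expression in coordinates of
  the two factors is then the value of a single function on pairs.\<close>

definition tpairs :: "('x \<times> 's) list \<Rightarrow> ('y \<times> 's) list \<Rightarrow> (('x \<times> 'y) \<times> 's) list"
  where "tpairs v w = concat (map (\<lambda>(x, s). map (\<lambda>(y, t). ((x, y), s \<otimes> t)) w) v)"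

lemma tval_ok_tpairs:
  assumes "\<And>x s y t. (x, s) \<in> set v \<Longrightarrow> (y, t) \<in> set w \<Longrightarrow>
    f (x, y) \<in> carrier Z_sixth \<and> s \<in> carrier S \<and> t \<in> carrier S"
  shows "tval_ok f (tpairs v w)"
  using assms unfolding tval_ok_def tpairs_def by fastforce

lemma tval_tpairs_mult:
  assumes "tval_ok f v" "tval_ok g w"
  shows "tval (\<lambda>(x, y). f x * g y) (tpairs v w) = tval f v \<otimes> tval g w"
proof -
  have inner: "tval (\<lambda>(x, y). f x * g y) (map (\<lambda>(y, t). ((x, y), s \<otimes> t)) w) = (\<phi> (f x) \<otimes> s) \<otimes> tval g w"
    if "f x \<in> carrier Z_sixth" "s \<in> carrier S" for x s
    using assms(2) that by (induction w) (auto simp: r_distr m_ac)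
  have ok: "tval_ok (\<lambda>(x, y). f x * g y) (map (\<lambda>(y, t). ((x, y), s \<otimes> t)) w)"
    if "f x \<in> carrier Z_sixth" "s \<in> carrier S" for x s
    using assms(2) that by (auto simp: tval_ok_def)
  show ?thesis
    using assms(1)
  proof (induction v)
    case Nil
    then show ?case using assms(2) by (simp add: tpairs_def)
  next
    case (Cons p v)
    obtain x s where p: "p = (x, s)" by force
    have "tpairs (p # v) w = map (\<lambda>(y, t). ((x, y), s \<otimes> t)) w @ tpairs v w"
      by (simp add: tpairs_def p)
    moreover have "tval_ok (\<lambda>(x, y). f x * g y) (tpairs v w)"
      using Cons.prems assms(2) by (intro tval_ok_tpairs) (fastforce simp: tval_ok_def)
    ultimately show ?case
      using Cons assms(2) p by (simp add: tval_append ok inner l_distr)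
  qed
qed

lemma tval_cong: "(\<And>p. p \<in> set v \<Longrightarrow> f (fst p) = g (fst p)) \<Longrightarrow> tval f v = tval g v"
  by (induction v) auto

lemma tval_add: "tval_ok f v \<Longrightarrow> tval_ok g v \<Longrightarrow> tval (\<lambda>x. f x + g x) v = tval f v \<oplus> tval g v"
  by (induction v) (auto simp: l_distr a_ac)

lemma tval_diff: "tval_ok f v \<Longrightarrow> tval_ok g v \<Longrightarrow> tval (\<lambda>x. f x - g x) v = tval f v \<ominus> tval g v"
  by (induction v) (auto simp: l_distr minus_eq l_minus minus_add a_ac)

lemma tval_map: "tval f (map (\<lambda>(x, s). (k x, s)) v) = tval (\<lambda>x. f (k x)) v"
  by (induction v) auto

definition tmul :: "(rat lie_term set \<times> 's) list \<Rightarrow> (rat lie_term set \<times> 's) list \<Rightarrow> (rat lie_term set \<times> 's) list"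
  where "tmul v w = [(x \<otimes>\<^bsub>L\<^esub> y, s \<otimes> t). (x, s) \<leftarrow> v, (y, t) \<leftarrow> w]"

lemma tmul_tpairs: "tmul v w = map (\<lambda>(p, s). (fst p \<otimes>\<^bsub>L\<^esub> snd p, s)) (tpairs v w)"
  by (auto simp: tmul_def tpairs_def map_concat o_def split_beta intro!: arg_cong[of _ _ concat])

lemma tmul_TS: "v \<in> TS \<Longrightarrow> w \<in> TS \<Longrightarrow> tmul v w \<in> TS"
  unfolding tmul_def in_lists_conv_set by (auto intro!: f3_closed)

text \<open>\<open>bracket_coord\<close> is built by sums and differences from products of one
  coordinate of each factor, and on \<open>tpairs\<close> such a product evaluates to the product of
  the values. This carries the rational formula over to S.\<close>

lemma tcoord_tmul:
  assumes "v \<in> TS" "w \<in> TS"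
  shows "tcoord (tmul v w) l = sbracket (tcoord v) (tcoord w) l"
proof -
  let ?c = lie_coord
  have set: "x \<in> carrier L \<and> s \<in> carrier S" if "(x, s) \<in> set v \<or> (x, s) \<in> set w" for x s
    using that assms by (auto simp: in_lists_conv_set)
  have 1: "tcoord (tmul v w) l = tval (\<lambda>(x, y). bracket_coord (?c x) (?c y) l) (tpairs v w)"
    unfolding tmul_tpairs tval_map
  proof (rule tval_cong)
    fix p assume "p \<in> set (tpairs v w)"
    then show "?c (fst (fst p) \<otimes>\<^bsub>L\<^esub> snd (fst p)) l
        = (case fst p of (x, y) \<Rightarrow> bracket_coord (?c x) (?c y) l)"
      using set by (fastforce simp: tpairs_def intro: lie_coord_bracket)
  qed
  have mult: "tval (\<lambda>p. ?c (fst p) a * ?c (snd p) b) (tpairs v w) = tcoord v a \<otimes> tcoord w b" for a b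
    using tval_tpairs_mult[OF TS_ok[OF assms(1)] TS_ok[OF assms(2)], of a b] by (simp add: split_def)
  have mult': "tval (\<lambda>p. ?c (snd p) a * ?c (fst p) b) (tpairs v w) = tcoord w a \<otimes> tcoord v b" for a b
    using mult[of b a] assms by (simp add: mult.commute m_comm)
  have ok: "tval_ok f (tpairs v w)"
    if "\<And>x y. x \<in> carrier L \<Longrightarrow> y \<in> carrier L \<Longrightarrow> f (x, y) \<in> carrier Z_sixth" for f
    using that set by (intro tval_ok_tpairs) blast
  note ok' = ok[of "\<lambda>p. ?c (fst p) a * ?c (snd p) b" for a b] ok[of "\<lambda>p. ?c (snd p) a * ?c (fst p) b" for a b]
    ok[of "\<lambda>p. ?c (fst p) a * ?c (snd p) b - ?c (snd p) a' * ?c (fst p) b'" for a b a' b']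
  note s = lie_coord_Z_sixth split_def tval_add tval_diff ok' mult mult'
  show ?thesis
    unfolding 1
  proof (rule length_three_cases[of l])
    assume *: "length l \<notin> {1, 2, 3}"
    \<comment> \<open>The zero function is written as f - f, so that \<open>tval_diff\<close>
      applies.\<close>
    have "tval (\<lambda>_. 0) (tpairs v w) = \<zero>"
      using tval_diff[of "\<lambda>p. ?c (fst p) l * ?c (snd p) l" "tpairs v w" "\<lambda>p. ?c (fst p) l * ?c (snd p) l"] assms
      by (simp add: s r_neg minus_eq)
    with * show "tval (\<lambda>(x, y). bracket_coord (?c x) (?c y) l) (tpairs v w) = sbracket (tcoord v) (tcoord w) l"
      by (simp add: sbracket_other bracket_coord_other split_def)
  next
    fix i assume *: "l = [i]"
    have "tval (\<lambda>_. 0) (tpairs v w) = \<zero>"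
      using tval_diff[of "\<lambda>p. ?c (fst p) l * ?c (snd p) l" "tpairs v w" "\<lambda>p. ?c (fst p) l * ?c (snd p) l"] assms
      by (simp add: s r_neg minus_eq)
    with * show "tval (\<lambda>(x, y). bracket_coord (?c x) (?c y) l) (tpairs v w) = sbracket (tcoord v) (tcoord w) l"
      by (simp add: sbracket_other bracket_coord_other split_def)
  next
    fix j k assume "l = [j, k]"
    then show "tval (\<lambda>(x, y). bracket_coord (?c x) (?c y) l) (tpairs v w) = sbracket (tcoord v) (tcoord w) l"
      by (simp add: s)
  next
    fix i j k assume "l = [i, j, k]"
    then show "tval (\<lambda>(x, y). bracket_coord (?c x) (?c y) l) (tpairs v w) = sbracket (tcoord v) (tcoord w) l"
      by (cases "i = j") (simp_all add: s)
  qed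
qed

lemma M_bracket:
  assumes "v \<in> TS" "w \<in> TS"
  shows "tclass v \<otimes>\<^bsub>M\<^esub> tclass w = tclass (tmul v w)"
proof -
  have E: "(tmul v' w', tmul v w) \<in> E" if "(v, v') \<in> E" "(w, w') \<in> E" for v' w'
  proof -
    have "v' \<in> TS" "w' \<in> TS" using that by (auto dest: tensor_cong_TS)
    then show ?thesis
      using assms tcoord_cong[OF that(1)] tcoord_cong[OF that(2)]
      by (intro tensor_congI tmul_TS) (simp_all add: tcoord_tmul)
  qed
  have "tclass v \<otimes>\<^bsub>M\<^esub> tclass w = (\<Union>v'\<in>tclass v. \<Union>w'\<in>tclass w. tclass (tmul v' w'))"
    by (simp add: M_def base_change_def Let_def tclass_def tmul_def)
  also have "\<dots> = (\<Union>v'\<in>tclass v. \<Union>w'\<in>tclass w. tclass (tmul v w))"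
  proof (intro SUP_cong HOL.refl)
    fix v' w' assume "v' \<in> tclass v" "w' \<in> tclass w"
    then show "tclass (tmul v' w') = tclass (tmul v w)"
      unfolding tclass_def by (intro equiv_class_eq[OF equiv_E] E) auto
  qed
  also have "\<dots> = tclass (tmul v w)"
    using assms equiv_class_self[OF equiv_E] unfolding tclass_def by blast
  finally show ?thesis .
qed

lemma M_bracket_closed: "V \<in> carrier M \<Longrightarrow> W \<in> carrier M \<Longrightarrow> V \<otimes>\<^bsub>M\<^esub> W \<in> carrier M"
  by (elim M_cases) (simp add: M_bracket tmul_TS)

lemma coord_bracket:
  assumes "V \<in> carrier M" "W \<in> carrier M"
  shows "coord (V \<otimes>\<^bsub>M\<^esub> W) l = sbracket (coord V) (coord W) l"
proof -
  obtain v where v: "v \<in> TS" "V = tclass v"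
    using assms(1) by (rule M_cases)
  obtain w where w: "w \<in> TS" "W = tclass w"
    using assms(2) by (rule M_cases)
  have "coord V = tcoord v" "coord W = tcoord w"
    using v w by (auto simp: coord_tclass)
  with v w show ?thesis
    by (simp add: M_bracket coord_tclass tmul_TS tcoord_tmul)
qed

abbreviation "half \<equiv> \<phi> (1/2)"
abbreviation "twelfth \<equiv> \<phi> (1/12)"

lemma twelfth_in: "1/12 \<in> carrier Z_sixth"
  by (rule Z_sixthI[of _ 3 2]) simp

lemma half_in: "1/2 \<in> carrier Z_sixth"
  by (rule Z_sixthI[of _ 3 1]) simp

lemma twelfth_closed: "twelfth \<in> carrier S" and half_closed: "half \<in> carrier S"
  using twelfth_in half_in by simp_all

lemma half_eq: "half = twelfth \<oplus> (twelfth \<oplus> (twelfth \<oplus> (twelfth \<oplus> (twelfth \<oplus> twelfth))))"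
proof -
  have "\<phi> (1/12 + (1/12 + (1/12 + (1/12 + (1/12 + 1/12))))) =
      twelfth \<oplus> (twelfth \<oplus> (twelfth \<oplus> (twelfth \<oplus> (twelfth \<oplus> twelfth))))"
    by (simp only: Z_sixth_map_add twelfth_in Z_sixth_add)
  then show ?thesis by simp
qed

lemma half_add_half: "half \<oplus> half = \<one>"
  using Z_sixth_map_add[OF half_in half_in] by simp

definition "G = BCH_group S M"

lemma F3_eq: "F3 d S = G"
  by (simp add: F3_def G_def M_def)

lemma carrier_G: "carrier G = carrier M"
  by (simp add: G_def BCH_group_def)

lemma one_G: "\<one>\<^bsub>G\<^esub> = \<zero>\<^bsub>M\<^esub>"
  by (simp add: G_def BCH_group_def)

lemma G_mult_closed: "V \<in> carrier M \<Longrightarrow> W \<in> carrier M \<Longrightarrow> V \<otimes>\<^bsub>G\<^esub> W \<in> carrier M"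
  by (simp add: G_def BCH_group_def M_add_closed M_smult_closed M_bracket_closed
      half_closed twelfth_closed)

lemma coord_G_mult:
  assumes "V \<in> carrier M" "W \<in> carrier M"
  shows "coord (V \<otimes>\<^bsub>G\<^esub> W) = bch half twelfth (coord V) (coord W)"
proof -
  have eq: "sbracket (coord V) (coord W) = coord (V \<otimes>\<^bsub>M\<^esub> W)" "sbracket (coord W) (coord V) = coord (W \<otimes>\<^bsub>M\<^esub> V)"
    using assms by (auto simp: coord_bracket)
  show ?thesis
    using assms unfolding bch_def eq
    by (intro ext) (simp add: G_def BCH_group_def coord_add coord_smult coord_bracket M_add_closed
        M_smult_closed M_bracket_closed half_closed twelfth_closed)
qed

lemma group_G: "group G"
proof (rule groupI)
  fix V W U assume VWU: "V \<in> carrier G" "W \<in> carrier G" "U \<in> carrier G"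
  show "V \<otimes>\<^bsub>G\<^esub> W \<otimes>\<^bsub>G\<^esub> U = V \<otimes>\<^bsub>G\<^esub> (W \<otimes>\<^bsub>G\<^esub> U)"
    using VWU unfolding carrier_G
    by (intro M_eqI G_mult_closed)
      (simp_all add: coord_G_mult G_mult_closed bch_assoc[OF _ _ _ twelfth_closed half_eq half_add_half])
next
  fix V assume V: "V \<in> carrier G"
  show "\<one>\<^bsub>G\<^esub> \<otimes>\<^bsub>G\<^esub> V = V"
  proof (rule M_eqI)
    fix b
    have "coord \<zero>\<^bsub>M\<^esub> = (\<lambda>_. \<zero>)" by (auto simp: coord_zero)
    then show "coord (\<one>\<^bsub>G\<^esub> \<otimes>\<^bsub>G\<^esub> V) b = coord V b"
      using V by (simp add: one_G carrier_G coord_G_mult M_zero_closed bch_zero_left half_closed twelfth_closed)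
  qed (use V in \<open>auto simp: one_G carrier_G intro: G_mult_closed M_zero_closed\<close>)
  let ?N = "(\<ominus> \<one>) \<odot>\<^bsub>M\<^esub> V"
  have N: "?N \<in> carrier M" using V by (simp add: carrier_G M_smult_closed)
  have "coord ?N = (\<lambda>l. \<ominus> coord V l)"
    using V by (auto simp: carrier_G coord_smult l_minus)
  then have "?N \<otimes>\<^bsub>G\<^esub> V = \<one>\<^bsub>G\<^esub>"
    using V N by (intro M_eqI) (simp_all add: one_G carrier_G G_mult_closed M_zero_closed coord_zero
        coord_G_mult bch_neg_self half_closed twelfth_closed)
  then show "\<exists>N\<in>carrier G. N \<otimes>\<^bsub>G\<^esub> V = \<one>\<^bsub>G\<^esub>"
    using N by (auto simp: carrier_G)
qed (auto simp: carrier_G one_G G_mult_closed M_zero_closed)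

lemma commute_G_iff:
  assumes "V \<in> carrier M" "W \<in> carrier M"
  shows "V \<otimes>\<^bsub>G\<^esub> W = W \<otimes>\<^bsub>G\<^esub> V \<longleftrightarrow> (\<forall>b\<in>hall d. sbracket (coord V) (coord W) b = \<zero>)"
proof -
  have "V \<otimes>\<^bsub>G\<^esub> W = W \<otimes>\<^bsub>G\<^esub> V \<longleftrightarrow> (\<forall>b\<in>hall d. coord (V \<otimes>\<^bsub>G\<^esub> W) b = coord (W \<otimes>\<^bsub>G\<^esub> V) b)"
    using assms M_eqI[OF G_mult_closed G_mult_closed] by metis
  also have "\<dots> \<longleftrightarrow> (\<forall>b\<in>hall d. sbracket (coord V) (coord W) b = \<zero>)"
    using assms by (simp add: coord_G_mult bch_commute_iff twelfth_closed half_closed half_add_half)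
  finally show ?thesis .
qed

end

lemma (in group) class_number_commuting_pairs:
  assumes "finite (carrier G)"
  shows "class_number G * card (carrier G)
    = card {(x, y). x \<in> carrier G \<and> y \<in> carrier G \<and> x \<otimes> y = y \<otimes> x}"
proof -
  let ?c = "\<lambda>g. \<lambda>h\<in>carrier G. g \<otimes> h \<otimes> inv g"
  interpret group_action G "carrier G" ?c
    by (rule action_by_conjugation)
  have "class_number G * card (carrier G) = (\<Sum>g\<in>carrier G. card (invariants (carrier G) ?c g))"
    unfolding class_number_def using burnside[OF assms assms] by (simp add: order_def)
  also have "\<dots> = (\<Sum>g\<in>carrier G. card {h \<in> carrier G. g \<otimes> h = h \<otimes> g})"
  proof (rule sum.cong)
    fix g assume g: "g \<in> carrier G"
    have "g \<otimes> h \<otimes> inv g = h \<longleftrightarrow> g \<otimes> h = h \<otimes> g" if "h \<in> carrier G" for h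
      using g that by (metis inv_solve_right m_closed)
    then show "card (invariants (carrier G) ?c g) = card {h \<in> carrier G. g \<otimes> h = h \<otimes> g}"
      unfolding invariants_def by (intro arg_cong[of _ _ card]) auto
  qed simp
  also have "\<dots> = card (SIGMA g:carrier G. {h \<in> carrier G. g \<otimes> h = h \<otimes> g})"
    using assms by simp
  also have "(SIGMA g:carrier G. {h \<in> carrier G. g \<otimes> h = h \<otimes> g})
      = {(x, y). x \<in> carrier G \<and> y \<in> carrier G \<and> x \<otimes> y = y \<otimes> x}"
    by auto
  finally show ?thesis .
qed

section \<open>Commuting pairs\<close>

definition hall1 :: "nat \<Rightarrow> nat list set"
  where "hall1 d = {[i] | i. i < d}"

definition hall2 :: "nat \<Rightarrow> nat list set"
  where "hall2 d = {[j, k] | j k. j < k \<and> k < d}"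

definition hall3 :: "nat \<Rightarrow> nat list set"
  where "hall3 d = {[i, j, k] | i j k. j < k \<and> j \<le> i \<and> i < d \<and> k < d}"

lemma hall_Un: "hall d = hall1 d \<union> hall2 d \<union> hall3 d"
  by (simp add: hall_def hall1_def hall2_def hall3_def)

lemma finite_hall_parts: "finite (hall1 d)" "finite (hall2 d)" "finite (hall3 d)"
  using finite_hall[of d] by (auto simp: hall_Un)

lemma hall_parts_disjoint:
  "hall1 d \<inter> hall2 d = {}" "hall1 d \<inter> hall3 d = {}" "hall2 d \<inter> hall3 d = {}"
  by (auto simp: hall1_def hall2_def hall3_def)

lemma card_hall1: "card (hall1 d) = d"
proof -
  have "hall1 d = (\<lambda>i. [i]) ` {..<d}" by (auto simp: hall1_def)
  then show ?thesis by (simp add: card_image inj_on_def)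
qed

text \<open>Witt's number (d^2 - d)/2, in a form free of subtraction and division.\<close>

lemma card_hall2: "2 * card (hall2 d) + d = d ^ 2"
proof (induction d)
  case 0
  have "hall2 0 = {}" by (auto simp: hall2_def)
  then show ?case by simp
next
  case (Suc d)
  have eq: "hall2 (Suc d) = hall2 d \<union> (\<lambda>j. [j, d]) ` {..<d}"
    by (auto simp: hall2_def less_Suc_eq)
  have "card (hall2 (Suc d)) = card (hall2 d) + d"
    unfolding eq
    by (subst card_Un_disjoint) (use finite_hall_parts(2)[of d] in \<open>auto simp: card_image inj_on_def hall2_def\<close>)
  then show ?case using Suc by (simp add: power2_eq_square)
qed

text \<open>Witt's number (d^3 - d)/3. In the new Hall lists the new letter d stands first, last, or
  in both places.\<close>

lemma card_hall3: "3 * card (hall3 d) + d = d ^ 3"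
proof (induction d)
  case 0
  have "hall3 0 = {}" by (auto simp: hall3_def)
  then show ?case by simp
next
  case (Suc d)
  let ?A = "(\<lambda>(j, k). [d, j, k]) ` {(j, k). j < k \<and> k < d}"
  let ?B = "(\<lambda>(i, j). [i, j, d]) ` {(i, j). j \<le> i \<and> i < d}"
  let ?C = "(\<lambda>j. [d, j, d]) ` {..<d}"
  have eq: "hall3 (Suc d) = hall3 d \<union> (?A \<union> (?B \<union> ?C))"
    by (auto simp: hall3_def less_Suc_eq)
  have fin: "finite {(j, k). j < k \<and> k < d}" "finite {(i, j). j \<le> i \<and> i < d}"
    by (rule finite_subset[of _ "{..<d} \<times> {..<d}"]; auto)+
  have A: "card ?A = card {(j, k). j < k \<and> k < d}" and B: "card ?B = card {(i, j). j \<le> i \<and> i < d}"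
    and C: "card ?C = d"
    by (auto simp: card_image inj_on_def)
  \<comment> \<open>The strict pairs and the reversed weak pairs split the square, so the first two
    families together have d^2 members.\<close>
  have "{(j, k). j < k \<and> k < d} \<union> {(i, j). j \<le> i \<and> i < d} = {..<d} \<times> {..<d}"
    by auto
  moreover have "{(j, k). j < k \<and> k < d} \<inter> {(i, j). j \<le> i \<and> i < d} = {}"
    by auto
  ultimately have "card {(j, k). j < k \<and> k < d} + card ({(i, j). j \<le> i \<and> i < d}) = d * d"
    using card_Un_disjoint[OF fin] by simp
  then have AB: "card ?A + card ?B = d * d"
    unfolding A B .
  have "card (hall3 (Suc d)) = card (hall3 d) + (card ?A + (card ?B + card ?C))"
    unfolding eq
    by (subst card_Un_disjoint; (subst card_Un_disjoint)?; (subst card_Un_disjoint)?)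
      (use finite_hall_parts(3)[of d] fin in \<open>auto simp: hall3_def\<close>)
  then have "card (hall3 (Suc d)) = card (hall3 d) + d * d + d"
    using AB C by simp
  then show ?case using Suc by (simp add: power3_eq_cube algebra_simps)
qed

lemma card_hall: "card (hall d) = d + card (hall2 d) + card (hall3 d)"
  unfolding hall_Un using hall_parts_disjoint[of d]
  by (subst card_Un_disjoint; (subst card_Un_disjoint)?) (auto simp: finite_hall_parts card_hall1)

text \<open>The tensor \<open>x\<^sub>i w\<^sub>j\<^sub>k - y\<^sub>i v\<^sub>j\<^sub>k\<close> is a sum of two tensors that are decomposable in the first
  index, so it cannot be alternating unless it vanishes.\<close>

lemma (in cring) alternating_rank_two_zero:
  fixes x y :: "nat \<Rightarrow> 'a" and v w :: "nat \<Rightarrow> nat \<Rightarrow> 'a"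
  defines "t \<equiv> \<lambda>i j k. x i \<otimes> w j k \<ominus> y i \<otimes> v j k"
  assumes closed: "\<And>i. x i \<in> carrier R" "\<And>i. y i \<in> carrier R"
    "\<And>i j. v i j \<in> carrier R" "\<And>i j. w i j \<in> carrier R"
    and pivot: "\<And>z. (\<And>i. z i \<in> carrier R) \<Longrightarrow>
      \<exists>m<d. \<forall>i<d. \<exists>r\<in>carrier R. z i = z m \<otimes> r"
    and alt: "\<And>i j k. i < d \<Longrightarrow> j < d \<Longrightarrow> k < d \<Longrightarrow> t j i k = \<ominus> t i j k"
      "\<And>i j k. i < d \<Longrightarrow> j < d \<Longrightarrow> k < d \<Longrightarrow> t i k j = \<ominus> t i j k"
      "\<And>i k. i < d \<Longrightarrow> k < d \<Longrightarrow> t i i k = \<zero>"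
    and "i < d" "j < d" "k < d"
  shows "t i j k = \<zero>"
proof -
  have t_closed [simp]: "t i j k \<in> carrier R" for i j k
    by (simp add: t_def closed)
  have cyc: "t i j k = t j k i" if "i < d" "j < d" "k < d" for i j k
    using alt(1)[OF that] alt(2)[OF that(2,1,3)] by (metis minus_minus t_closed)
  have tiji: "t i j i = \<zero>" if "i < d" "j < d" for i j
    using alt(2)[OF that(1,1,2)] alt(3)[OF that] by simp
  obtain m where m: "m < d" "\<forall>i<d. \<exists>r\<in>carrier R. x i = x m \<otimes> r"
    using pivot[of x] closed by blast
  then obtain \<rho>0 where \<rho>0: "\<And>i. i < d \<Longrightarrow> \<rho>0 i \<in> carrier R \<and> x i = x m \<otimes> \<rho>0 i"
    by metis
  \<comment> \<open>The quotient at the pivot itself is normalised to 1, which is not automatic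
    because \<open>x m\<close> may be a zero divisor. The value zero outside the index range makes
    closedness unconditional.\<close>
  define \<rho> where "\<rho> i = (if i = m then \<one> else if i < d then \<rho>0 i else \<zero>)" for i
  have \<rho>_closed [simp]: "\<rho> i \<in> carrier R" for i
    using \<rho>0 by (simp add: \<rho>_def)
  have x: "x i = x m \<otimes> \<rho> i" if "i < d" for i
  proof (cases "i = m")
    case True
    then show ?thesis by (simp add: \<rho>_def closed)
  next
    case False
    then show ?thesis using \<rho>0[OF that] that by (simp add: \<rho>_def)
  qed
  \<comment> \<open>Eliminating the x-direction leaves z with \<open>z m = \<zero>\<close>. A second
    pivot c, for z, displays t as a sum of two tensors with first-index vectors \<rho> and
    \<sigma>.\<close>
  define z where "z i = y i \<ominus> \<rho> i \<otimes> y m" for i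
  have z_closed [simp]: "z i \<in> carrier R" for i
    by (simp add: z_def closed)
  have "z m = \<zero>" by (simp add: z_def \<rho>_def closed r_neg minus_eq)
  obtain c where c: "c < d" "\<forall>i<d. \<exists>r\<in>carrier R. z i = z c \<otimes> r"
    using pivot[of z] by auto
  then obtain \<sigma>0 where \<sigma>0: "\<And>i. i < d \<Longrightarrow> \<sigma>0 i \<in> carrier R \<and> z i = z c \<otimes> \<sigma>0 i"
    by metis
  define \<sigma> where "\<sigma> i = (if i = c then \<one> else if i < d then \<sigma>0 i else \<zero>)" for i
  have \<sigma>_closed [simp]: "\<sigma> i \<in> carrier R" for i
    using \<sigma>0 by (simp add: \<sigma>_def)
  have z: "z i = z c \<otimes> \<sigma> i" if "i < d" for i
  proof (cases "i = c")
    case True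
    then show ?thesis by (simp add: \<sigma>_def)
  next
    case False
    then show ?thesis using \<sigma>0[OF that] that by (simp add: \<sigma>_def)
  qed
  have \<sigma>c: "\<sigma> c = \<one>" by (simp add: \<sigma>_def)
  define b where "b j k = \<ominus> (z c \<otimes> v j k)" for j k
  have b_closed [simp]: "b j k \<in> carrier R" for j k by (simp add: b_def closed)
  have t: "t i j k = \<rho> i \<otimes> t m j k \<oplus> \<sigma> i \<otimes> b j k" if "i < d" for i j k
  proof -
    have "y i = \<rho> i \<otimes> y m \<oplus> z i"
      by (simp add: z_def closed minus_eq a_ac r_neg r_neg1)
    then have "t i j k = \<rho> i \<otimes> (x m \<otimes> w j k) \<oplus> \<ominus> (\<rho> i \<otimes> (y m \<otimes> v j k)) \<oplus> \<ominus> (\<sigma> i \<otimes> (z c \<otimes> v j k))"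
      unfolding t_def x[OF that] by (simp add: closed z[OF that] l_distr r_distr minus_eq minus_add m_ac a_ac)
    also have "\<dots> = \<rho> i \<otimes> t m j k \<oplus> \<sigma> i \<otimes> b j k"
      by (simp add: t_def b_def closed r_distr minus_eq r_minus)
    finally show ?thesis .
  qed
  \<comment> \<open>After a rotation that puts m last, the \<rho> part carries the factor
    \<open>t m k m\<close>, which vanishes.\<close>
  have a: "t m j k = \<sigma> j \<otimes> b k m" if "j < d" "k < d" for j k
  proof -
    have "t m j k = t j k m" using cyc[OF m(1) that] .
    also have "\<dots> = \<rho> j \<otimes> t m k m \<oplus> \<sigma> j \<otimes> b k m" by (rule t) fact
    also have "t m k m = \<zero>" using tiji[OF m(1) that(2)] .
    finally show ?thesis by simp
  qed
  have "t m c k = \<zero>" if "k < d" for k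
  proof -
    have "t m c c = \<zero>" using cyc[OF m(1) c(1) c(1)] alt(3)[OF c(1) m(1)] by simp
    then have "b c m = \<zero>" using a[OF c(1) c(1)] by (simp add: \<sigma>c)
    then have "t m k c = \<zero>" using a[OF that c(1)] by simp
    then show ?thesis using alt(2)[OF m(1) that c(1)] by simp
  qed
  then have "b k m = \<zero>" if "k < d" for k
    using a[OF c(1) that] that by (simp add: \<sigma>c)
  then have a0: "t m j k = \<zero>" if "j < d" "k < d" for j k
    using a[OF that] that by simp
  \<comment> \<open>Only the \<sigma> part is left, and the same rotation with c in place of m kills
    it.\<close>
  have t': "t i j k = \<sigma> i \<otimes> b j k" if "i < d" "j < d" "k < d" for i j k
    using t[OF that(1)] a0[OF that(2,3)] by simp
  have b: "b j k = t c j k" if "j < d" "k < d" for j k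
    using t'[OF c(1) that] by (simp add: \<sigma>c)
  have "b j k = \<zero>" if "j < d" "k < d" for j k
  proof -
    have "b j k = t j k c" using b[OF that] cyc[OF c(1) that] by simp
    also have "\<dots> = \<sigma> j \<otimes> b k c" using t'[OF that c(1)] .
    also have "b k c = \<zero>" using b[OF that(2) c(1)] tiji[OF c(1) that(2)] by simp
    finally show ?thesis by simp
  qed
  then show ?thesis using t'[OF \<open>i < d\<close> \<open>j < d\<close> \<open>k < d\<close>] \<open>j < d\<close> \<open>k < d\<close> by simp
qed

text \<open>Degree two is proportionality of the degree-one parts. In degree three the coordinates
  are t_ijk + t_jik, or t_jjk if i = j, where t is antisymmetric in the last two indices. If they
  vanish, t is alternating, hence zero by \<open>alternating_rank_two_zero\<close>.\<close>

lemma (in cring) sbracket_zero_iff: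
  assumes closed: "\<And>l. x l \<in> carrier R" "\<And>l. y l \<in> carrier R"
    and alt: "\<And>j k. x [k, j] = \<ominus> x [j, k]" "\<And>j. x [j, j] = \<zero>"
      "\<And>j k. y [k, j] = \<ominus> y [j, k]" "\<And>j. y [j, j] = \<zero>"
    and pivot: "\<And>z :: nat \<Rightarrow> 'a. (\<And>i. z i \<in> carrier R) \<Longrightarrow> d > 0 \<Longrightarrow>
      \<exists>m<d. \<forall>i<d. \<exists>r\<in>carrier R. z i = z m \<otimes> r"
  shows "(\<forall>b\<in>hall d. sbracket x y b = \<zero>) \<longleftrightarrow>
    (\<forall>a\<in>hall1 d. \<forall>a'\<in>hall1 d. x a \<otimes> y a' = x a' \<otimes> y a) \<and>
    (\<forall>a\<in>hall1 d. \<forall>b\<in>hall2 d. x a \<otimes> y b = y a \<otimes> x b)"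
proof -
  define t where "t i j k = x [i] \<otimes> y [j, k] \<ominus> y [i] \<otimes> x [j, k]" for i j k
  have t_closed [simp]: "t i j k \<in> carrier R" for i j k
    by (simp add: t_def closed)
  have t_swap: "t i k j = \<ominus> t i j k" for i j k
    unfolding t_def alt(1)[of k j] alt(3)[of k j] by (simp add: closed minus_eq minus_add r_minus)
  have t_jj: "t i j j = \<zero>" for i j
    by (simp add: t_def closed alt(2,4) minus_eq)
  have br3: "sbracket x y [i, j, k] = (if i = j then t j j k else t i j k \<oplus> t j i k)" for i j k
    by (simp add: t_def)
  have eq_iff: "a \<ominus> b = \<zero> \<longleftrightarrow> a = b" if "a \<in> carrier R" "b \<in> carrier R" for a b
    using that by (simp add: r_right_minus_eq)
  have hall2_ball: "(\<forall>b\<in>hall2 d. P b) \<longleftrightarrow> (\<forall>j k. j < k \<longrightarrow> k < d \<longrightarrow> P [j, k])" for P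
    by (auto simp: hall2_def)
  have two: "(\<forall>b\<in>hall2 d. sbracket x y b = \<zero>) \<longleftrightarrow>
      (\<forall>a\<in>hall1 d. \<forall>a'\<in>hall1 d. x a \<otimes> y a' = x a' \<otimes> y a)"
  proof -
    have "(\<forall>b\<in>hall2 d. sbracket x y b = \<zero>) \<longleftrightarrow> (\<forall>j k. j < k \<longrightarrow> k < d \<longrightarrow> x [j] \<otimes> y [k] = y [j] \<otimes> x [k])"
      by (simp add: hall2_ball eq_iff closed)
    also have "\<dots> \<longleftrightarrow> (\<forall>j k. j < d \<longrightarrow> k < d \<longrightarrow> x [j] \<otimes> y [k] = x [k] \<otimes> y [j])"
    proof (intro iffI allI impI)
      fix j k assume *: "\<forall>j k. j < k \<longrightarrow> k < d \<longrightarrow> x [j] \<otimes> y [k] = y [j] \<otimes> x [k]" "j < d" "k < d"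
      then show "x [j] \<otimes> y [k] = x [k] \<otimes> y [j]"
        by (cases j k rule: linorder_cases) (auto simp: closed m_comm)
    qed (auto simp: closed m_comm)
    finally show ?thesis by (auto simp: hall1_def)
  qed
  have three: "(\<forall>b\<in>hall3 d. sbracket x y b = \<zero>) \<longleftrightarrow> (\<forall>a\<in>hall1 d. \<forall>b\<in>hall2 d. x a \<otimes> y b = y a \<otimes> x b)"
  proof -
    have "(\<forall>i j k. i < d \<longrightarrow> j < d \<longrightarrow> k < d \<longrightarrow> t i j k = \<zero>)" if B: "\<forall>b\<in>hall3 d. sbracket x y b = \<zero>"
    proof (intro allI impI)
      fix i j k assume ijk: "i < d" "j < d" "k < d"
      have B': "sbracket x y [i, j, k] = \<zero>" if "j < k" "j \<le> i" "i < d" "k < d" for i j k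
        using B that by (auto simp: hall3_def simp del: sbracket.simps)
      have jjk: "t j j k = \<zero>" if "j < k" "k < d" for j k
        using B'[of j k j] that unfolding br3 by simp
      have sw: "t j i k = \<ominus> t i j k" if "j < k" "j < i" "i < d" "k < d" for i j k
      proof -
        have "t i j k \<oplus> t j i k = \<zero>"
          using B'[of j k i] that unfolding br3 by simp
        then show ?thesis by (metis a_comm minus_equality t_closed)
      qed
      have d3: "t i i k = \<zero>" if "i < d" "k < d" for i k
      proof (cases i k rule: linorder_cases)
        case less
        then show ?thesis using that jjk by simp
      next
        case equal
        then show ?thesis using t_jj by simp
      next
        case greater
        then have "t k i i = \<ominus> t i k i" using that sw[of k i i] by simp
        then have "t i k i = \<zero>" using t_jj by (metis minus_minus minus_zero t_closed)
        then show ?thesis using t_swap[of i i k] by simp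
      qed
      have mm: "\<ominus> (\<ominus> t i j k) = t i j k" for i j k by simp
      have alt': "t j i k = \<ominus> t i j k" if "i < d" "j < d" "k < d" for i j k
      proof -
        \<comment> \<open>Vanishing at a Hall list swaps the first two indices when the least index
          is one of them (cases 4 and 5). With k least, the swap is composed of exchanges that
          involve k.\<close>
        consider "i = j" | "i = k" "i \<noteq> j" | "j = k" "i \<noteq> j" | "j < i" "j < k" "i \<noteq> k" | "i < j" "i < k" "j \<noteq> k"
          | "k < i" "k < j" "i \<noteq> j"
          by linarith
        then show ?thesis
        proof cases
          case 1
          then show ?thesis using d3 that by simp
        next
          case 2
          have "t i j i = \<zero>" using t_swap[of i j i] d3[of i j] that by simp
          then show ?thesis using 2 t_jj by simp
        next
          case 3
          have "t j i j = \<zero>" using t_swap[of j i j] d3[of j i] that by simp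
          then show ?thesis using 3 t_jj by simp
        next
          case 4
          then show ?thesis using sw that by simp
        next
          case 5
          then have "t i j k = \<ominus> t j i k" using sw that by simp
          then show ?thesis using mm by simp
        next
          case 6
          have "t j i k = \<ominus> t j k i" by (rule t_swap)
          also have "t j k i = \<ominus> t k j i" using sw[of k i j] 6 that by (metis mm)
          also have "t k j i = \<ominus> t k i j" by (rule t_swap)
          also have "t k i j = \<ominus> t i k j" using sw[of k j i] 6 that by simp
          also have "t i k j = \<ominus> t i j k" by (rule t_swap)
          finally show ?thesis by simp
        qed
      qed
      show "t i j k = \<zero>"
      proof (rule alternating_rank_two_zero[of "\<lambda>i. x [i]" "\<lambda>i. y [i]" "\<lambda>j k. x [j, k]" "\<lambda>j k. y [j, k]" d,
            folded t_def])
        show "\<exists>m<d. \<forall>i<d. \<exists>r\<in>carrier R. z i = z m \<otimes> r" if "\<And>i. z i \<in> carrier R" for z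
          using pivot[of z] that ijk by simp
        show "t i k j = \<ominus> t i j k" for i j k
          by (rule t_swap)
        show "t i i k = \<zero>" if "i < d" "k < d" for i k
          using that by (rule d3)
      qed (fact closed alt' ijk)+
    qed
    moreover have "(\<forall>a\<in>hall1 d. \<forall>b\<in>hall2 d. x a \<otimes> y b = y a \<otimes> x b) \<longleftrightarrow>
        (\<forall>i j k. i < d \<longrightarrow> j < k \<longrightarrow> k < d \<longrightarrow> t i j k = \<zero>)"
      by (auto simp: hall1_def hall2_def t_def eq_iff closed)
    moreover have "\<forall>b\<in>hall3 d. sbracket x y b = \<zero>"
      if A: "\<forall>i j k. i < d \<longrightarrow> j < k \<longrightarrow> k < d \<longrightarrow> t i j k = \<zero>"
    proof
      fix b assume "b \<in> hall3 d"
      then obtain i j k where b: "b = [i, j, k]" "j < k" "j \<le> i" "i < d" "k < d"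
        by (auto simp: hall3_def)
      have "t j i k = \<zero>"
      proof (cases i k rule: linorder_cases)
        case greater
        then have "t j k i = \<zero>" using A b by auto
        then show ?thesis using t_swap[of j i k] by simp
      qed (use A b t_jj in auto)
      then show "sbracket x y b = \<zero>"
        using A b br3[of i j k] by auto
    qed
    ultimately show ?thesis by auto
  qed
  have one: "\<forall>b\<in>hall1 d. sbracket x y b = \<zero>"
    by (auto simp: hall1_def)
  show ?thesis
    unfolding hall_Un using one two three by (simp add: ball_Un)
qed

text \<open>Two functions on the whole index set are regrouped into their restrictions to A, a
  family of pairs on B and a family of pairs on C. Once the A-parts are fixed, the conditions at
  different b are independent and the C-part is free.\<close>

lemma card_pairs_PiE:
  fixes K :: "('i \<Rightarrow> 's) \<Rightarrow> ('i \<Rightarrow> 's) \<Rightarrow> ('s \<times> 's) set"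
  assumes fin: "finite A" "finite B" "finite C" "finite S"
    and disj: "A \<inter> B = {}" "A \<inter> C = {}" "B \<inter> C = {}"
    and K: "\<And>x y. K x y \<subseteq> S \<times> S"
  shows "card {(f, g). f \<in> A \<union> B \<union> C \<rightarrow>\<^sub>E S \<and> g \<in> A \<union> B \<union> C \<rightarrow>\<^sub>E S
      \<and> Q (restrict f A) (restrict g A)
      \<and> (\<forall>b\<in>B. (f b, g b) \<in> K (restrict f A) (restrict g A))}
    = (\<Sum>(x, y)\<in>{(x, y). x \<in> A \<rightarrow>\<^sub>E S \<and> y \<in> A \<rightarrow>\<^sub>E S \<and> Q x y}.
        card (K x y) ^ card B * (card S ^ 2) ^ card C)" (is "card ?P = (\<Sum>(x, y)\<in>?X. _)")
proof -
  let ?Y = "\<lambda>(x, y). (B \<rightarrow>\<^sub>E K x y) \<times> (C \<rightarrow>\<^sub>E S \<times> S)"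
  let ?F = "\<lambda>(f, g). ((restrict f A, restrict g A), (\<lambda>b\<in>B. (f b, g b)), (\<lambda>c\<in>C. (f c, g c)))"
  let ?m = "\<lambda>pr x u w. \<lambda>i\<in>A \<union> B \<union> C. if i \<in> A then x i else if i \<in> B then pr (u i) else pr (w i)"
  let ?I = "\<lambda>((x, y), (u, w)). (?m fst x u w, ?m snd y u w)"
  have "bij_betw ?F ?P (Sigma ?X ?Y)"
  proof (rule bij_betw_byWitness[where f' = ?I])
    show "\<forall>p\<in>?P. ?I (?F p) = p"
      using disj by (auto simp: fun_eq_iff PiE_def extensional_def)
    show "\<forall>p\<in>Sigma ?X ?Y. ?F (?I p) = p"
      using disj by (auto simp: fun_eq_iff PiE_def extensional_def)
    show "?F ` ?P \<subseteq> Sigma ?X ?Y"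
      by (auto simp: PiE_def)
    show "?I ` Sigma ?X ?Y \<subseteq> ?P"
    proof (rule image_subsetI)
      fix p assume "p \<in> Sigma ?X ?Y"
      then obtain x y u w where p: "p = ((x, y), (u, w))" and x: "x \<in> A \<rightarrow>\<^sub>E S" and y: "y \<in> A \<rightarrow>\<^sub>E S" and q: "Q x y"
        and u: "u \<in> B \<rightarrow>\<^sub>E K x y" and w: "w \<in> C \<rightarrow>\<^sub>E S \<times> S"
        by auto
      have r: "restrict (?m fst x u w) A = x" "restrict (?m snd y u w) A = y"
        using x y by (auto simp: fun_eq_iff PiE_def extensional_def)
      have uS: "u b \<in> S \<times> S" if "b \<in> B" for b using u K[of x y] that by auto
      have wS: "w b \<in> S \<times> S" if "b \<in> C" for b using w that by auto
      have "?m fst x u w \<in> A \<union> B \<union> C \<rightarrow>\<^sub>E S"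
        using x uS wS by (fastforce simp: mem_Times_iff)
      moreover have "?m snd y u w \<in> A \<union> B \<union> C \<rightarrow>\<^sub>E S"
        using y uS wS by (fastforce simp: mem_Times_iff)
      moreover have "\<forall>b\<in>B. (?m fst x u w b, ?m snd y u w b) \<in> K x y"
        using u disj by auto
      ultimately show "?I p \<in> ?P"
        using q by (simp only: p prod.case mem_Collect_eq r simp_thms)
    qed
  qed
  then have "card ?P = card (Sigma ?X ?Y)"
    by (rule bij_betw_same_card)
  also have "\<dots> = (\<Sum>p\<in>?X. card (?Y p))"
  proof (rule card_SigmaI)
    show "finite ?X"
      by (rule finite_subset[of _ "(A \<rightarrow>\<^sub>E S) \<times> (A \<rightarrow>\<^sub>E S)"]) (auto intro!: finite_PiE fin)
    show "\<forall>p\<in>?X. finite (?Y p)"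
      using fin K by (auto intro!: finite_PiE finite_cartesian_product intro: finite_subset)
  qed
  also have "\<dots> = (\<Sum>(x, y)\<in>?X. card (K x y) ^ card B * (card S ^ 2) ^ card C)"
    using fin by (intro sum.cong) (auto simp: card_PiE card_cartesian_product power2_eq_square)
  finally show ?thesis .
qed

text \<open>Source of the alternation that \<open>sbracket_zero_iff\<close> demands of the
  degree-two coordinates.\<close>

lemma term_coord_antisym: "term_coord t [k, j] = - term_coord t [j, k]"
  by (induction t) auto

lemma term_coord_diag: "term_coord t [j, j] = 0"
  using term_coord_antisym[of t j j] by simp

context f3_base_change
begin

lemma coord_antisym:
  assumes "V \<in> carrier M"
  shows "coord V [k, j] = \<ominus> coord V [j, k]" "coord V [j, j] = \<zero>"
proof -
  obtain v where v: "v \<in> TS" "V = tclass v"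
    using assms by (rule M_cases)
  \<comment> \<open>Negation is written as a difference from zero, which \<open>tval_diff\<close>
    can transport.\<close>
  have anti: "lie_coord X [k, j] = 0 - lie_coord X [j, k]" for X :: "rat lie_term set" and j k
    by (simp add: lie_coord_def term_coord_antisym[of _ k j])
  have 0: "tval (\<lambda>_. 0) v = \<zero>"
    using v(1) tval_diff[OF TS_ok[OF v(1), of "[]"] TS_ok[OF v(1), of "[]"]] by (simp add: r_neg minus_eq)
  have ok: "tval_ok (\<lambda>_. 0) v"
    using v(1) by (auto simp: tval_ok_def in_lists_conv_set)
  show "coord V [k, j] = \<ominus> coord V [j, k]"
    using v tval_diff[OF ok TS_ok[OF v(1), of "[j, k]"]]
    by (simp add: coord_tclass anti[of _ k j] 0 minus_eq)
  show "coord V [j, j] = \<zero>"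
    using v 0 by (simp add: coord_tclass lie_coord_def term_coord_diag)
qed

text \<open>Each degree-two Hall element contributes one syzygy of the degree-one parts.
  Degree-three coordinates do not enter any bracket and are free. The group order on the left avoids
  a division.\<close>

lemma class_number_F3:
  assumes fin: "finite (carrier S)"
    and pivot: "\<And>z :: nat \<Rightarrow> 's. (\<And>i. z i \<in> carrier S) \<Longrightarrow> d > 0 \<Longrightarrow>
      \<exists>m<d. \<forall>i<d. \<exists>r\<in>carrier S. z i = z m \<otimes> r"
  shows "class_number (F3 d S) * card (carrier S) ^ card (hall d)
    = (\<Sum>(x, y)\<in>{(x, y). x \<in> hall1 d \<rightarrow>\<^sub>E carrier S \<and> y \<in> hall1 d \<rightarrow>\<^sub>E carrier S \<and>
          (\<forall>a\<in>hall1 d. \<forall>a'\<in>hall1 d. x a \<otimes> y a' = x a' \<otimes> y a)}.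
        card {(s, t). s \<in> carrier S \<and> t \<in> carrier S \<and> (\<forall>a\<in>hall1 d. x a \<otimes> t = y a \<otimes> s)} ^ card (hall2 d)
        * (card (carrier S) ^ 2) ^ card (hall3 d))" (is "_ = ?sum")
proof -
  let ?r = "\<lambda>V. restrict (coord V) (hall d)"
  let ?Q = "\<lambda>x y. \<forall>a\<in>hall1 d. \<forall>a'\<in>hall1 d. x a \<otimes> y a' = x a' \<otimes> y a"
  let ?K = "\<lambda>x y. {(s, t). s \<in> carrier S \<and> t \<in> carrier S \<and> (\<forall>a\<in>hall1 d. x a \<otimes> t = y a \<otimes> s)}"
  let ?C = "{(V, W). V \<in> carrier G \<and> W \<in> carrier G \<and> V \<otimes>\<^bsub>G\<^esub> W = W \<otimes>\<^bsub>G\<^esub> V}"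
  let ?P = "{(f, g). f \<in> hall1 d \<union> hall2 d \<union> hall3 d \<rightarrow>\<^sub>E carrier S \<and> g \<in> hall1 d \<union> hall2 d \<union> hall3 d \<rightarrow>\<^sub>E carrier S
      \<and> ?Q (restrict f (hall1 d)) (restrict g (hall1 d))
      \<and> (\<forall>b\<in>hall2 d. (f b, g b) \<in> ?K (restrict f (hall1 d)) (restrict g (hall1 d)))}"
  note bij = bij_betw_coord
  have sub: "hall1 d \<subseteq> hall d" "hall2 d \<subseteq> hall d"
    by (auto simp: hall_Un)
  have commute: "V \<otimes>\<^bsub>G\<^esub> W = W \<otimes>\<^bsub>G\<^esub> V \<longleftrightarrow> (?r V, ?r W) \<in> ?P"
    if VW: "V \<in> carrier M" "W \<in> carrier M" for V W
  proof -
    have "V \<otimes>\<^bsub>G\<^esub> W = W \<otimes>\<^bsub>G\<^esub> V \<longleftrightarrow> ?Q (coord V) (coord W)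
        \<and> (\<forall>a\<in>hall1 d. \<forall>b\<in>hall2 d. coord V a \<otimes> coord W b = coord W a \<otimes> coord V b)"
      unfolding commute_G_iff[OF VW]
      by (rule sbracket_zero_iff[of "coord V" "coord W", OF coord_closed[OF VW(1)] coord_closed[OF VW(2)]
          coord_antisym[OF VW(1)] coord_antisym[OF VW(2)] pivot])
    also have "\<dots> \<longleftrightarrow> (?r V, ?r W) \<in> ?P"
      using VW sub by (auto simp: hall_Un subset_iff)
    finally show ?thesis .
  qed
  have "bij_betw (\<lambda>(V, W). (?r V, ?r W)) ?C ?P"
    unfolding bij_betw_def
  proof (intro conjI equalityI subsetI)
    show "inj_on (\<lambda>(V, W). (?r V, ?r W)) ?C"
      using bij_betw_imp_inj_on[OF bij] by (auto simp: inj_on_def carrier_G)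
  next
    fix p assume "p \<in> (\<lambda>(V, W). (?r V, ?r W)) ` ?C"
    then obtain V W where VW: "V \<in> carrier M" "W \<in> carrier M" "V \<otimes>\<^bsub>G\<^esub> W = W \<otimes>\<^bsub>G\<^esub> V" "p = (?r V, ?r W)"
      by (auto simp: carrier_G)
    show "p \<in> ?P"
      using commute[OF VW(1,2)] VW(3) unfolding VW(4) by (rule iffD1)
  next
    fix p assume p: "p \<in> ?P"
    then obtain f g where fg: "p = (f, g)" "f \<in> hall d \<rightarrow>\<^sub>E carrier S" "g \<in> hall d \<rightarrow>\<^sub>E carrier S"
      by (auto simp: hall_Un)
    have "f \<in> ?r ` carrier M" "g \<in> ?r ` carrier M"
      using fg(2,3) bij_betw_imp_surj_on[OF bij] by simp_all
    then obtain V W where VW: "V \<in> carrier M" "W \<in> carrier M" "f = ?r V" "g = ?r W"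
      by (elim imageE) (rule that)
    have "V \<otimes>\<^bsub>G\<^esub> W = W \<otimes>\<^bsub>G\<^esub> V"
      by (rule iffD2[OF commute[OF VW(1,2)]]) (use p in \<open>simp only: fg(1) VW(3,4)\<close>)
    then show "p \<in> (\<lambda>(V, W). (?r V, ?r W)) ` ?C"
      using VW fg(1) by (intro image_eqI[of _ _ "(V, W)"]) (simp_all add: carrier_G)
  qed
  then have CP: "card ?C = card ?P"
    by (rule bij_betw_same_card)
  have "card (carrier G) = card (hall d \<rightarrow>\<^sub>E carrier S)"
    unfolding carrier_G using bij by (rule bij_betw_same_card)
  then have order: "card (carrier G) = card (carrier S) ^ card (hall d)"
    by (simp add: card_PiE finite_hall)
  have "finite (carrier G)"
    unfolding carrier_G using bij_betw_finite[OF bij] fin by (simp add: finite_PiE finite_hall)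
  then have "class_number G * card (carrier S) ^ card (hall d) = card ?P"
    using group.class_number_commuting_pairs[OF group_G] CP order by simp
  also have "\<dots> = ?sum"
    by (rule card_pairs_PiE) (use fin finite_hall_parts hall_parts_disjoint in auto)
  finally show ?thesis
    by (simp add: F3_eq)
qed

end

section \<open>Counting over finite chain rings\<close>

text \<open>An abstraction of O/P^n. Zero is the case k = n of the decomposition, and
  \<open>card_multiples\<close> forces the filtration by powers of \<open>\<pi>\<close> to have n
  proper steps. For n = 0 this is the zero ring.\<close>

locale chain_ring = cring R for R (structure) +
  fixes \<pi> and n q :: nat
  assumes pi_closed [simp]: "\<pi> \<in> carrier R"
    and finite_carrier: "finite (carrier R)"
    and pi_unit_decomp: "x \<in> carrier R \<Longrightarrow> \<exists>k\<le>n. \<exists>u\<in>Units R. x = \<pi> [^] k \<otimes> u"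
    and q_gt_1: "q > 1"
    and card_multiples: "j \<le> n \<Longrightarrow> card ((\<lambda>s. \<pi> [^] j \<otimes> s) ` carrier R) = q ^ (n - j)"
begin

definition D :: "nat \<Rightarrow> 'a set" where "D j = (\<lambda>s. \<pi> [^] j \<otimes> s) ` carrier R"

lemma card_D: "j \<le> n \<Longrightarrow> card (D j) = q ^ (n - j)"
  by (simp add: D_def card_multiples)

lemma D_subset: "D j \<subseteq> carrier R"
  by (auto simp: D_def)

lemma D_closed: "x \<in> D j \<Longrightarrow> x \<in> carrier R"
  using D_subset by auto

lemma finite_D: "finite (D j)"
  using finite_carrier by (simp add: D_def)

lemma D_I: "x = \<pi> [^] j \<otimes> s \<Longrightarrow> s \<in> carrier R \<Longrightarrow> x \<in> D j"
  by (auto simp: D_def)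

lemma D_E:
  assumes "x \<in> D j"
  obtains s where "s \<in> carrier R" "x = \<pi> [^] j \<otimes> s"
  using assms by (auto simp: D_def)

lemma D_0: "D 0 = carrier R"
  by (force simp: D_def)

lemma D_antimono:
  assumes "j \<le> k"
  shows "D k \<subseteq> D j"
proof
  fix x assume "x \<in> D k"
  then obtain s where s: "s \<in> carrier R" "x = \<pi> [^] k \<otimes> s" by (rule D_E)
  have "\<pi> [^] k = \<pi> [^] j \<otimes> \<pi> [^] (k - j)"
    using assms by (simp add: nat_pow_mult)
  then show "x \<in> D j"
    using s by (intro D_I[of _ j "\<pi> [^] (k - j) \<otimes> s"]) (auto simp: m_assoc)
qed

lemma D_mult: "x \<in> D j \<Longrightarrow> y \<in> D k \<Longrightarrow> x \<otimes> y \<in> D (j + k)"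
proof (elim D_E)
  fix s t assume "s \<in> carrier R" "x = \<pi> [^] j \<otimes> s" "t \<in> carrier R" "y = \<pi> [^] k \<otimes> t"
  then show "x \<otimes> y \<in> D (j + k)"
    by (intro D_I[of _ _ "s \<otimes> t"]) (auto simp: nat_pow_mult[symmetric] m_ac)
qed

lemma D_mult_left: "x \<in> D j \<Longrightarrow> y \<in> carrier R \<Longrightarrow> y \<otimes> x \<in> D j"
  using D_mult[of y 0 x j] by (simp add: D_0)

lemma D_mult_right: "x \<in> D j \<Longrightarrow> y \<in> carrier R \<Longrightarrow> x \<otimes> y \<in> D j"
  using D_mult[of x j y 0] by (simp add: D_0)

lemma zero_in_D: "\<zero> \<in> D j"
  by (rule D_I[of _ _ \<zero>]) auto

lemma D_n: "D n = {\<zero>}"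
proof -
  have "card (D n) = 1" by (simp add: card_D)
  then show ?thesis using zero_in_D[of n] by (metis card_1_singletonE singletonD)
qed

lemma D_zero: "n \<le> j \<Longrightarrow> x \<in> D j \<Longrightarrow> x = \<zero>"
  using D_antimono[of n j] D_n by auto

text \<open>The valuation is well defined because the filtration is strict, which is read off from
  cardinalities: k < j would force \<open>D k = D j\<close>.\<close>

lemma pi_pow_unit_in_D_iff:
  assumes "k \<le> n" "j \<le> n" "u \<in> Units R"
  shows "\<pi> [^] k \<otimes> u \<in> D j \<longleftrightarrow> j \<le> k"
proof
  assume "j \<le> k"
  have "\<pi> [^] k \<otimes> u \<in> D k" using assms by (auto intro: D_I)
  with D_antimono[OF \<open>j \<le> k\<close>] show "\<pi> [^] k \<otimes> u \<in> D j" by auto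
next
  assume *: "\<pi> [^] k \<otimes> u \<in> D j"
  show "j \<le> k"
  proof (rule ccontr)
    assume "\<not> j \<le> k"
    have "\<pi> [^] k \<otimes> u \<otimes> inv u \<in> D j" using * assms by (auto intro!: D_mult_right[OF *])
    moreover have "\<pi> [^] k \<otimes> u \<otimes> inv u = \<pi> [^] k"
      using assms(3) by (simp add: m_assoc Units_closed)
    ultimately have "\<pi> [^] k \<in> D j" by simp
    then have "D k \<subseteq> D j" unfolding D_def[of k] by (auto intro: D_mult_right)
    moreover have "D j \<subseteq> D k" using \<open>\<not> j \<le> k\<close> by (intro D_antimono) simp
    ultimately have "card (D k) = card (D j)" by simp
    then have "q ^ (n - k) = q ^ (n - j)" using assms by (simp add: card_D)
    then have "n - k = n - j" using q_gt_1 by simp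
    then show False using assms \<open>\<not> j \<le> k\<close> by simp
  qed
qed

lemma pi_pow_mult_in_D_iff:
  assumes "x \<in> carrier R" "i \<le> j" "j \<le> n"
  shows "\<pi> [^] i \<otimes> x \<in> D j \<longleftrightarrow> x \<in> D (j - i)"
proof -
  obtain k u where k: "k \<le> n" "u \<in> Units R" "x = \<pi> [^] k \<otimes> u"
    using pi_unit_decomp[OF assms(1)] by blast
  have e: "\<pi> [^] i \<otimes> x = \<pi> [^] (i + k) \<otimes> u"
    using k by (simp add: nat_pow_mult[symmetric] m_assoc Units_closed)
  have x: "x \<in> D (j - i) \<longleftrightarrow> j - i \<le> k"
    using k assms pi_pow_unit_in_D_iff[of k "j - i" u] by simp
  show ?thesis
  proof (cases "i + k \<le> n")
    case True
    then show ?thesis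
      using pi_pow_unit_in_D_iff[of "i + k" j u] k assms e x by auto
  next
    case False
    then have "\<pi> [^] (i + k) \<otimes> u \<in> D (i + k)" using k by (intro D_I) auto
    moreover have "D (i + k) \<subseteq> D j" using False assms by (intro D_antimono) simp
    ultimately show ?thesis using False assms e x by auto
  qed
qed

lemma pi_pow_mult_zero_iff:
  "x \<in> carrier R \<Longrightarrow> i \<le> n \<Longrightarrow> \<pi> [^] i \<otimes> x = \<zero> \<longleftrightarrow> x \<in> D (n - i)"
  using pi_pow_mult_in_D_iff[of x i n] by (simp add: D_n)

text \<open>An entry of least valuation divides all others. This supplies the pivots of the rank-two
  argument.\<close>

lemma pivot:
  assumes "finite I" "I \<noteq> {}" "\<And>i. i \<in> I \<Longrightarrow> z i \<in> carrier R"
  shows "\<exists>m\<in>I. \<forall>i\<in>I. \<exists>r\<in>carrier R. z i = z m \<otimes> r"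
proof -
  have "\<exists>p. snd p \<in> Units R \<and> z i = \<pi> [^] (fst p :: nat) \<otimes> snd p" if "i \<in> I" for i
    using pi_unit_decomp[OF assms(3)[OF that]] by auto
  then obtain p where p: "\<And>i. i \<in> I \<Longrightarrow> snd (p i) \<in> Units R \<and> z i = \<pi> [^] (fst (p i) :: nat) \<otimes> snd (p i)"
    by metis
  define k where "k i = fst (p i)" for i
  define u where "u i = snd (p i)" for i
  have ku: "u i \<in> Units R \<and> z i = \<pi> [^] k i \<otimes> u i" if "i \<in> I" for i
    using p[OF that] by (simp add: k_def u_def)
  have "Min (k ` I) \<in> k ` I" using assms(1,2) by simp
  then obtain m where "m \<in> I" "k m = Min (k ` I)" by auto
  then have m: "m \<in> I" "\<And>i. i \<in> I \<Longrightarrow> k m \<le> k i" using assms(1) by auto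
  have "z i = z m \<otimes> (inv (u m) \<otimes> (\<pi> [^] (k i - k m) \<otimes> u i))" if "i \<in> I" for i
  proof -
    have u: "u m \<in> Units R" "u i \<in> Units R" using ku m(1) that by auto
    have "z m \<otimes> (inv (u m) \<otimes> (\<pi> [^] (k i - k m) \<otimes> u i))
        = (u m \<otimes> inv (u m)) \<otimes> ((\<pi> [^] k m \<otimes> \<pi> [^] (k i - k m)) \<otimes> u i)"
      using ku[OF m(1)] u Units_closed by (simp add: m_ac del: Units_r_inv)
    also have "\<dots> = \<pi> [^] k i \<otimes> u i"
      using u m(2)[OF that] Units_closed by (simp add: nat_pow_mult)
    finally show ?thesis using ku[OF that] by simp
  qed
  moreover have "inv (u m) \<otimes> (\<pi> [^] (k i - k m) \<otimes> u i) \<in> carrier R" if "i \<in> I" for i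
    using ku m(1) that Units_closed by auto
  ultimately show ?thesis using m(1) by blast
qed

end

text \<open>Elements are sorted by the last set of the decreasing chain that contains them; the size
  of a layer is a difference of cardinalities.\<close>

lemma sum_over_chain:
  fixes f :: "nat \<Rightarrow> real" and E :: "nat \<Rightarrow> 'b set"
  assumes fin: "finite (E 0)" and dec: "\<And>j. E (Suc j) \<subseteq> E j" and empty: "E (Suc N) = {}"
    and f: "\<And>j x. j \<le> N \<Longrightarrow> x \<in> E j - E (Suc j) \<Longrightarrow> g x = f j"
  shows "(\<Sum>x\<in>E 0. g x) = (\<Sum>j\<le>N. (real (card (E j)) - real (card (E (Suc j)))) * f j)"
proof -
  have sub: "E k \<subseteq> E 0" for k
    by (induction k) (use dec in auto)
  then have finE: "finite (E k)" for k
    using fin finite_subset by blast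
  have step: "(\<Sum>x\<in>E k. g x) = (real (card (E k)) - real (card (E (Suc k)))) * f k + (\<Sum>x\<in>E (Suc k). g x)"
    if "k \<le> N" for k
  proof -
    have "(\<Sum>x\<in>E k. g x) = (\<Sum>x\<in>E k - E (Suc k). g x) + (\<Sum>x\<in>E (Suc k). g x)"
      using dec finE by (intro sum.subset_diff) auto
    also have "(\<Sum>x\<in>E k - E (Suc k). g x) = real (card (E k - E (Suc k))) * f k"
      using f[OF that] by simp
    also have "real (card (E k - E (Suc k))) = real (card (E k)) - real (card (E (Suc k)))"
      using dec finE card_mono[OF finE dec] by (simp add: card_Diff_subset of_nat_diff)
    finally show ?thesis .
  qed
  have "(\<Sum>x\<in>E 0. g x) = (\<Sum>j<k. (real (card (E j)) - real (card (E (Suc j)))) * f j) + (\<Sum>x\<in>E k. g x)"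
    if "k \<le> Suc N" for k
    using that by (induction k) (simp_all add: step)
  from this[of "Suc N"] show ?thesis
    by (simp add: empty lessThan_Suc_atMost)
qed

text \<open>This is the number of primitive vectors of length \<open>d\<close> over a chain ring of length \<open>m\<close>.\<close>

definition primitive_count :: "nat \<Rightarrow> nat \<Rightarrow> nat \<Rightarrow> real"
  where "primitive_count q d m = (if m = 0 then 1 else real q ^ (d * m) - real q ^ (d * (m - 1)))"

section \<open>Proportional vectors and their syzygies\<close>

context chain_ring
begin

abbreviation "vecs I \<equiv> I \<rightarrow>\<^sub>E carrier R"

definition proportional :: "'i set \<Rightarrow> ('i \<Rightarrow> 'a) \<Rightarrow> ('i \<Rightarrow> 'a) \<Rightarrow> bool"
  where "proportional I x y \<longleftrightarrow> (\<forall>a\<in>I. \<forall>a'\<in>I. x a \<otimes> y a' = x a' \<otimes> y a)"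

definition syzygies :: "'i set \<Rightarrow> ('i \<Rightarrow> 'a) \<Rightarrow> ('i \<Rightarrow> 'a) \<Rightarrow> ('a \<times> 'a) set"
  where "syzygies I x y = {(s, t). s \<in> carrier R \<and> t \<in> carrier R \<and> (\<forall>a\<in>I. x a \<otimes> t = y a \<otimes> s)}"

text \<open>The shear that subtracts \<rho>_a y_m from y_a for a different from m is invertible and
  maps this set onto a box.\<close>

lemma card_vecs_sheared:
  assumes "finite I" "m \<in> I" "\<And>a. a \<in> I \<Longrightarrow> \<rho> a \<in> carrier R" "P \<subseteq> carrier R" "Q \<subseteq> carrier R"
  shows "card {y \<in> vecs I. y m \<in> P \<and> (\<forall>a\<in>I - {m}. y a \<ominus> \<rho> a \<otimes> y m \<in> Q)} = card P * card Q ^ (card I - 1)"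
proof -
  let ?Y = "{y \<in> vecs I. y m \<in> P \<and> (\<forall>a\<in>I - {m}. y a \<ominus> \<rho> a \<otimes> y m \<in> Q)}"
  let ?W = "Pi\<^sub>E I (\<lambda>a. if a = m then P else Q)"
  let ?f = "\<lambda>y. \<lambda>a\<in>I. if a = m then y m else y a \<ominus> \<rho> a \<otimes> y m"
  let ?g = "\<lambda>w. \<lambda>a\<in>I. if a = m then w m else w a \<oplus> \<rho> a \<otimes> w m"
  have cancel1: "(x \<ominus> y) \<oplus> y = x" and cancel2: "(x \<oplus> y) \<ominus> y = x"
    if "x \<in> carrier R" "y \<in> carrier R" for x y
    using that by (simp_all add: minus_eq a_assoc l_neg r_neg)
  have "bij_betw ?f ?Y ?W"
  proof (rule bij_betw_byWitness[where f' = ?g])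
    show "\<forall>y\<in>?Y. ?g (?f y) = y"
    proof (intro ballI ext)
      fix y a assume y: "y \<in> ?Y"
      then have "y a \<in> carrier R" if "a \<in> I" for a using that by auto
      then show "?g (?f y) a = y a"
        using y assms(2,3) by (auto simp: cancel1 PiE_def extensional_def)
    qed
    show "\<forall>w\<in>?W. ?f (?g w) = w"
    proof (intro ballI ext)
      fix w a assume w: "w \<in> ?W"
      have "w a \<in> carrier R" if "a \<in> I" for a
        using PiE_mem[OF w that] assms(4,5) by (auto split: if_splits)
      then show "?f (?g w) a = w a"
        using w assms(2,3) by (auto simp: cancel2 PiE_def extensional_def)
    qed
    show "?f ` ?Y \<subseteq> ?W"
      using assms(2) by auto
    show "?g ` ?W \<subseteq> ?Y"
    proof (rule image_subsetI)
      fix w assume w: "w \<in> ?W"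
      have wc: "w a \<in> carrier R" if "a \<in> I" for a
        using PiE_mem[OF w that] assms(4,5) by (auto split: if_splits)
      have wm: "w m \<in> P" using PiE_mem[OF w assms(2)] by simp
      have wQ: "w a \<in> Q" if "a \<in> I" "a \<noteq> m" for a using PiE_mem[OF w that(1)] that by simp
      show "?g w \<in> ?Y"
        using wc wm wQ assms(2,3) by (auto simp: cancel2)
    qed
  qed
  then have "card ?Y = card ?W"
    by (rule bij_betw_same_card)
  also have "\<dots> = (\<Prod>a\<in>I. card (if a = m then P else Q))"
    by (rule card_PiE) fact
  also have "\<dots> = card P * (\<Prod>a\<in>I - {m}. card Q)"
    using assms(1,2) by (subst prod.remove[of _ m]) (auto intro!: prod.cong)
  finally show ?thesis
    using assms(1,2) by simp
qed

text \<open>The solutions form a coset of the annihilator \<open>D (n - i)\<close> of pi^i.\<close>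

lemma pi_unit_mult_eq_card:
  assumes "i \<le> n" "u \<in> Units R" "b \<in> D i"
  shows "card {t \<in> carrier R. \<pi> [^] i \<otimes> u \<otimes> t = b} = q ^ i"
proof -
  obtain w where w: "w \<in> carrier R" "b = \<pi> [^] i \<otimes> w" using assms(3) by (rule D_E)
  define t0 where "t0 = inv u \<otimes> w"
  have t0: "t0 \<in> carrier R" using assms w by (simp add: t0_def)
  have b: "b = \<pi> [^] i \<otimes> u \<otimes> t0"
  proof -
    have "\<pi> [^] i \<otimes> u \<otimes> t0 = \<pi> [^] i \<otimes> ((u \<otimes> inv u) \<otimes> w)"
      unfolding t0_def using assms w Units_closed by (simp add: m_assoc del: Units_r_inv)
    then show ?thesis using assms w by simp
  qed
  have uc: "u \<in> carrier R" using assms by auto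
  have iff: "\<pi> [^] i \<otimes> u \<otimes> t = b \<longleftrightarrow> t \<ominus> t0 \<in> D (n - i)" if t: "t \<in> carrier R" for t
  proof -
    have "\<pi> [^] i \<otimes> u \<otimes> t = b \<longleftrightarrow> \<pi> [^] i \<otimes> u \<otimes> t \<ominus> \<pi> [^] i \<otimes> u \<otimes> t0 = \<zero>"
      unfolding b using t t0 uc by (simp add: r_right_minus_eq)
    also have "\<pi> [^] i \<otimes> u \<otimes> t \<ominus> \<pi> [^] i \<otimes> u \<otimes> t0 = \<pi> [^] i \<otimes> (u \<otimes> (t \<ominus> t0))"
      using t t0 uc by (simp add: minus_eq r_distr r_minus m_assoc)
    also have "\<dots> = \<zero> \<longleftrightarrow> u \<otimes> (t \<ominus> t0) \<in> D (n - i)"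
      using t t0 uc assms(1) by (intro pi_pow_mult_zero_iff) auto
    also have "\<dots> \<longleftrightarrow> t \<ominus> t0 \<in> D (n - i)"
    proof
      assume "u \<otimes> (t \<ominus> t0) \<in> D (n - i)"
      then have "inv u \<otimes> (u \<otimes> (t \<ominus> t0)) \<in> D (n - i)"
        using assms by (auto intro!: D_mult_left[of "u \<otimes> (t \<ominus> t0)"])
      moreover have "inv u \<otimes> (u \<otimes> (t \<ominus> t0)) = t \<ominus> t0"
        using assms t t0 uc by (simp add: m_assoc[symmetric])
      ultimately show "t \<ominus> t0 \<in> D (n - i)" by simp
    qed (use uc in \<open>auto intro: D_mult_left\<close>)
    finally show ?thesis .
  qed
  have "bij_betw (\<lambda>t. t \<ominus> t0) {t \<in> carrier R. \<pi> [^] i \<otimes> u \<otimes> t = b} (D (n - i))"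
  proof (rule bij_betw_byWitness[where f' = "\<lambda>t. t \<oplus> t0"])
    have c: "(x \<oplus> t0) \<ominus> t0 = x" if "x \<in> carrier R" for x
      using that t0 by (simp add: minus_eq a_assoc r_neg)
    show "(\<lambda>t. t \<oplus> t0) ` D (n - i) \<subseteq> {t \<in> carrier R. \<pi> [^] i \<otimes> u \<otimes> t = b}"
      using t0 D_closed iff c by auto
  qed (use t0 D_closed iff in \<open>auto simp: minus_eq a_assoc r_neg l_neg\<close>)
  then show ?thesis
    using bij_betw_same_card card_D[of "n - i"] assms(1) by fastforce
qed

text \<open>Write x = x_m \<rho> with a pivot m and put z_a = y_a - \<rho>_a y_m. Proportionality
  says that all z_a lie in \<open>D (n - i)\<close>. The sum is layered by the level of (y_m, z), on
  which alone the number of syzygies depends.\<close>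

lemma sum_syzygies_fixed:
  fixes x :: "'i \<Rightarrow> 'a"
  assumes I: "finite I" "I \<noteq> {}" and i: "i \<le> n" and x: "x \<in> vecs I" "\<And>a. a \<in> I \<Longrightarrow> x a \<in> D i"
    and not_more: "i < n \<Longrightarrow> \<exists>a\<in>I. x a \<notin> D (Suc i)"
  shows "(\<Sum>y\<in>{y \<in> vecs I. proportional I x y}. real (card (syzygies I x y)) ^ C)
    = real q ^ (n - i) * (\<Sum>j\<le>i. primitive_count q (card I) (i - j) * real q ^ (C * (n + j)))"
proof -
  have xc: "x a \<in> carrier R" if "a \<in> I" for a using x(2)[OF that] D_closed by auto
  obtain m u where m: "m \<in> I" "u \<in> Units R" "x m = \<pi> [^] i \<otimes> u"
  proof (cases "i < n")
    case True
    then obtain m where m: "m \<in> I" "x m \<notin> D (Suc i)" using not_more by auto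
    obtain k u where k: "k \<le> n" "u \<in> Units R" "x m = \<pi> [^] k \<otimes> u"
      using pi_unit_decomp[OF xc[OF m(1)]] by blast
    have "i \<le> k" using x(2)[OF m(1)] pi_pow_unit_in_D_iff[OF k(1) i k(2)] k(3) by simp
    moreover have "\<not> Suc i \<le> k" using m(2) pi_pow_unit_in_D_iff[OF k(1) _ k(2), of "Suc i"] k(3) True by simp
    ultimately have "k = i" by simp
    with that m k show ?thesis by blast
  next
    \<comment> \<open>Here x = 0, and zero is still pi^n times the unit 1.\<close>
    case False
    then have "i = n" using i by simp
    obtain m where m: "m \<in> I" using I(2) by auto
    have "x m = \<zero>" using x(2)[OF m] \<open>i = n\<close> D_n by simp
    moreover have "\<pi> [^] n = \<zero>"
      using pi_pow_mult_zero_iff[of \<one> n] by (simp add: D_0)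
    ultimately have "x m = \<pi> [^] i \<otimes> \<one>" using \<open>i = n\<close> by simp
    with that m show ?thesis by blast
  qed
  have uc: "u \<in> carrier R" using m by auto
  define \<rho> where "\<rho> a = (if a = m then \<one> else inv u \<otimes> (SOME s. s \<in> carrier R \<and> x a = \<pi> [^] i \<otimes> s))" for a
  have \<rho>: "\<rho> a \<in> carrier R \<and> x a = x m \<otimes> \<rho> a" if a: "a \<in> I" for a
  proof (cases "a = m")
    case True
    then show ?thesis using xc[OF a] by (simp add: \<rho>_def)
  next
    case False
    let ?s = "SOME s. s \<in> carrier R \<and> x a = \<pi> [^] i \<otimes> s"
    have "\<exists>s. s \<in> carrier R \<and> x a = \<pi> [^] i \<otimes> s"
      using x(2)[OF a] by (auto simp: D_def)
    then have s: "?s \<in> carrier R" "x a = \<pi> [^] i \<otimes> ?s"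
      using someI_ex[of "\<lambda>s. s \<in> carrier R \<and> x a = \<pi> [^] i \<otimes> s"] by auto
    have "x m \<otimes> (inv u \<otimes> ?s) = \<pi> [^] i \<otimes> ((u \<otimes> inv u) \<otimes> ?s)"
      unfolding m(3) using s m(2) uc by (simp add: m_assoc del: Units_r_inv)
    also have "\<dots> = x a"
      using s m(2) by simp
    finally show ?thesis
      using False s m(2) by (simp add: \<rho>_def)
  qed
  have \<rho>m: "\<rho> m = \<one>" by (simp add: \<rho>_def)
  have \<rho>c: "\<rho> a \<in> carrier R" if "a \<in> I" for a using \<rho>[OF that] by simp
  \<comment> \<open>With y_m read modulo P^i and z_a divided by pi^(n - i), \<open>F j\<close> is
    divisibility of the resulting vector by pi^j. The chain ends after j = i, where that vector is
    zero. The part of y_m that is lost modulo P^i accounts for the factor q^(n - i).\<close>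
  define F where "F j = (if j \<le> i then {y \<in> vecs I. y m \<in> D j \<and> (\<forall>a\<in>I - {m}. y a \<ominus> \<rho> a \<otimes> y m \<in> D (n - i + j))} else {})" for j
  have cardF: "real (card (F j)) - real (card (F (Suc j))) = real q ^ (n - i) * primitive_count q (card I) (i - j)"
    if "j \<le> i" for j
  proof -
    have c: "real (card (F j)) = real q ^ (n - i) * real q ^ (card I * (i - j))" if "j \<le> i" for j
    proof -
      have "card (F j) = card (D j) * card (D (n - i + j)) ^ (card I - 1)"
        unfolding F_def using that
        by (simp add: card_vecs_sheared[where I = I and m = m and \<rho> = \<rho>] I m(1) \<rho>c D_subset)
      also have "\<dots> = q ^ (n - j) * (q ^ (i - j)) ^ (card I - 1)"
        using that i by (simp add: card_D)
      also have "\<dots> = q ^ ((n - j) + (i - j) * (card I - 1))"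
        by (simp add: power_add power_mult)
      also have "(n - j) + (i - j) * (card I - 1) = (n - i) + card I * (i - j)"
      proof -
        have "card I = Suc (card I - 1)" using I by (simp add: card_gt_0_iff)
        then have "card I * (i - j) = (i - j) + (card I - 1) * (i - j)" by (metis mult_Suc)
        then show ?thesis using that i by (simp add: mult.commute)
      qed
      finally show ?thesis by (simp add: power_add)
    qed
    show ?thesis
    proof (cases "j = i")
      case True
      then show ?thesis using c[of i] by (simp add: F_def primitive_count_def)
    next
      case False
      then show ?thesis using c[of j] c[of "Suc j"] that
        by (simp add: primitive_count_def right_diff_distrib)
    qed
  qed
  have zin: "\<pi> [^] i \<otimes> (u \<otimes> z) = \<zero> \<longleftrightarrow> z \<in> D (n - i)" if "z \<in> carrier R" for z
  proof -
    have "\<pi> [^] i \<otimes> (u \<otimes> z) = u \<otimes> (\<pi> [^] i \<otimes> z)" using that uc by (simp add: m_ac)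
    also have "\<dots> = \<zero> \<longleftrightarrow> \<pi> [^] i \<otimes> z = \<zero>"
      using that uc m(2) by (metis Units_l_cancel nat_pow_closed m_closed pi_closed r_null zero_closed)
    finally show ?thesis using pi_pow_mult_zero_iff[OF that i] by simp
  qed
  have split_y: "y a = \<rho> a \<otimes> y m \<oplus> (y a \<ominus> \<rho> a \<otimes> y m)" if "y \<in> vecs I" "a \<in> I" for y a
    using PiE_mem[OF that] PiE_mem[OF that(1) m(1)] \<rho>c[OF that(2)] by (simp add: minus_eq a_ac r_neg r_neg1)
  have propF: "{y \<in> vecs I. proportional I x y} = F 0"
  proof (intro equalityI subsetI)
    fix y assume "y \<in> {y \<in> vecs I. proportional I x y}"
    then have y: "y \<in> vecs I" "proportional I x y" by auto
    have yc: "y a \<in> carrier R" if "a \<in> I" for a using y(1) that by auto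
    have "y a \<ominus> \<rho> a \<otimes> y m \<in> D (n - i)" if a: "a \<in> I" for a
    proof -
      have "x m \<otimes> y a = x a \<otimes> y m" using y(2) m(1) a by (simp add: proportional_def)
      also have "\<dots> = x m \<otimes> (\<rho> a \<otimes> y m)"
        using \<rho>[OF a] xc[OF m(1)] yc[OF m(1)] by (metis m_assoc)
      finally have "x m \<otimes> (y a \<ominus> \<rho> a \<otimes> y m) = \<zero>"
        using a m(1) xc yc \<rho>c by (simp add: minus_eq r_distr r_minus r_neg)
      then have "\<pi> [^] i \<otimes> (u \<otimes> (y a \<ominus> \<rho> a \<otimes> y m)) = \<zero>"
        using a m yc \<rho>c uc by (simp add: m_assoc)
      then show ?thesis using zin a m(1) yc \<rho>c by simp
    qed
    then show "y \<in> F 0" using y(1) yc m(1) by (auto simp: F_def D_0)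
  next
    fix y assume "y \<in> F 0"
    then have y: "y \<in> vecs I" "\<And>a. a \<in> I - {m} \<Longrightarrow> y a \<ominus> \<rho> a \<otimes> y m \<in> D (n - i)"
      by (auto simp: F_def)
    have yc: "y a \<in> carrier R" if "a \<in> I" for a using y(1) that by auto
    have y': "y a \<ominus> \<rho> a \<otimes> y m \<in> D (n - i)" if "a \<in> I" for a
    proof (cases "a = m")
      case True
      then show ?thesis using yc[OF that] zero_in_D by (simp add: \<rho>m minus_eq r_neg)
    qed (use y that in auto)
    have prod: "x a \<otimes> y b = x m \<otimes> (\<rho> a \<otimes> \<rho> b \<otimes> y m)" if ab: "a \<in> I" "b \<in> I" for a b
    proof -
      let ?z = "y b \<ominus> \<rho> b \<otimes> y m"
      have zc: "?z \<in> carrier R" using ab m(1) yc \<rho>c by simp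
      have "x a \<otimes> ?z \<in> D (i + (n - i))" using x(2)[OF ab(1)] y'[OF ab(2)] by (rule D_mult)
      then have z0: "x a \<otimes> ?z = \<zero>" using i D_n by simp
      have "x a \<otimes> y b = x a \<otimes> (\<rho> b \<otimes> y m \<oplus> ?z)" using split_y[OF y(1) ab(2)] by simp
      also have "\<dots> = x a \<otimes> (\<rho> b \<otimes> y m)"
        using z0 zc ab m(1) yc \<rho>c xc by (simp add: r_distr)
      also have "\<dots> = (x m \<otimes> \<rho> a) \<otimes> (\<rho> b \<otimes> y m)" using \<rho>[OF ab(1)] by simp
      finally show ?thesis
        using ab m(1) yc \<rho>c xc by (simp add: m_assoc)
    qed
    have "proportional I x y"
      unfolding proportional_def
    proof (intro ballI)
      fix a b assume "a \<in> I" "b \<in> I"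
      then show "x a \<otimes> y b = x b \<otimes> y a"
        using prod[of a b] prod[of b a] \<rho>c by (simp add: m_comm)
    qed
    then show "y \<in> {y \<in> vecs I. proportional I x y}" using y(1) by simp
  qed
  have card_syz: "card (syzygies I x y) = q ^ (n + j)" if j: "j \<le> i" and yF: "y \<in> F j - F (Suc j)" for j y
  proof -
    define z where "z a = y a \<ominus> \<rho> a \<otimes> y m" for a
    have y: "y \<in> vecs I" "y m \<in> D j" "\<And>a. a \<in> I - {m} \<Longrightarrow> z a \<in> D (n - i + j)"
      using yF j by (auto simp: F_def z_def)
    have yc: "y a \<in> carrier R" if "a \<in> I" for a using y(1) that by auto
    have zc: "z a \<in> carrier R" if "a \<in> I" for a using that yc \<rho>c m(1) by (simp add: z_def)
    have sol: "(\<forall>a\<in>I. x a \<otimes> t = y a \<otimes> s) \<longleftrightarrow> x m \<otimes> t = y m \<otimes> s \<and> (\<forall>a\<in>I - {m}. s \<otimes> z a = \<zero>)"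
      if st: "s \<in> carrier R" "t \<in> carrier R" for s t
    proof -
      have "x a \<otimes> t = y a \<otimes> s \<longleftrightarrow> s \<otimes> z a = \<zero>" if eq: "x m \<otimes> t = y m \<otimes> s" and a: "a \<in> I" for a
      proof -
        have c: "\<rho> a \<in> carrier R" "z a \<in> carrier R" "x m \<in> carrier R" "y m \<in> carrier R"
          using a m(1) \<rho>c zc xc yc by auto
        have "x a \<otimes> t = \<rho> a \<otimes> (x m \<otimes> t)"
          using \<rho>[OF a] c st by (metis m_assoc m_comm)
        also have "\<dots> = \<rho> a \<otimes> y m \<otimes> s" using c st by (simp add: eq m_assoc)
        finally have 1: "x a \<otimes> t = \<rho> a \<otimes> y m \<otimes> s" .
        have "y a \<otimes> s = (\<rho> a \<otimes> y m \<oplus> z a) \<otimes> s"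
          using split_y[OF y(1) a] unfolding z_def by (rule arg_cong)
        also have "\<dots> = \<rho> a \<otimes> y m \<otimes> s \<oplus> s \<otimes> z a"
          using c st by (simp add: l_distr m_comm[of s "z a"])
        finally have 2: "y a \<otimes> s = \<rho> a \<otimes> y m \<otimes> s \<oplus> s \<otimes> z a" .
        show ?thesis
          unfolding 1 2 using c st by (intro add.l_cancel_one') auto
      qed
      then show ?thesis using m(1) by auto
    qed
    \<comment> \<open>The equation at the pivot is solvable for t exactly if y_m s lies in
      \<open>D i\<close>; the other equations read s z_a = 0. Then s has |D (i - j)| values and t
      has q^i, together q^(n + j).\<close>
    have S: "y m \<otimes> s \<in> D i \<and> (\<forall>a\<in>I - {m}. s \<otimes> z a = \<zero>) \<longleftrightarrow> s \<in> D (i - j)" if s: "s \<in> carrier R" for s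
    proof
      assume "s \<in> D (i - j)"
      moreover have "s \<otimes> z a = \<zero>" if "a \<in> I - {m}" for a
        using D_mult[OF \<open>s \<in> D (i - j)\<close> y(3)[OF that]] i j by (intro D_zero) auto
      ultimately show "y m \<otimes> s \<in> D i \<and> (\<forall>a\<in>I - {m}. s \<otimes> z a = \<zero>)"
        using D_mult[OF y(2), of s "i - j"] j by simp
    next
      assume *: "y m \<otimes> s \<in> D i \<and> (\<forall>a\<in>I - {m}. s \<otimes> z a = \<zero>)"
      obtain k v where k: "k \<le> n" "v \<in> Units R" "s = \<pi> [^] k \<otimes> v"
        using pi_unit_decomp[OF s] by blast
      have strip: "w \<in> D (l - k)" if w: "w \<in> carrier R" "s \<otimes> w \<in> D l" "k \<le> l" "l \<le> n" for w l
      proof -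
        have "inv v \<otimes> (s \<otimes> w) \<in> D l" by (rule D_mult_left[OF w(2) Units_inv_closed[OF k(2)]])
        moreover have "inv v \<otimes> (s \<otimes> w) = (v \<otimes> inv v) \<otimes> (\<pi> [^] k \<otimes> w)"
          unfolding k(3) using k(2) w Units_closed[OF k(2)] by (simp add: m_ac del: Units_r_inv Units_l_inv)
        ultimately show ?thesis using k w pi_pow_mult_in_D_iff[of w k l] by simp
      qed
      show "s \<in> D (i - j)"
      \<comment> \<open>If s had valuation k < i - j, dividing by s would give y_m in
        \<open>D (i - k)\<close> and z_a in \<open>D (n - k)\<close>, which puts y into the next
        layer.\<close>
      proof (rule ccontr)
        assume "s \<notin> D (i - j)"
        then have kij: "k < i - j"
          using k i pi_pow_unit_in_D_iff[of k "i - j" v] by auto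
        have "s \<otimes> y m \<in> D i" using * s yc[OF m(1)] by (simp add: m_comm)
        then have "y m \<in> D (i - k)" using strip[OF yc[OF m(1)], of i] kij i by simp
        moreover have "D (i - k) \<subseteq> D (Suc j)" using kij by (intro D_antimono) simp
        moreover have "z a \<in> D (n - i + Suc j)" if "a \<in> I - {m}" for a
        proof -
          have "s \<otimes> z a \<in> D n" using * that by (simp add: zero_in_D)
          then have "z a \<in> D (n - k)" using strip[of "z a" n] zc that k by simp
          moreover have "D (n - k) \<subseteq> D (n - i + Suc j)" using kij i by (intro D_antimono) simp
          ultimately show ?thesis by auto
        qed
        ultimately have "y \<in> F (Suc j)"
          using y(1) kij by (auto simp: F_def z_def)
        then show False using yF by simp
      qed
    qed
    have syz: "syzygies I x y = (SIGMA s:D (i - j). {t \<in> carrier R. x m \<otimes> t = y m \<otimes> s})"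
    proof -
      have "y m \<otimes> s \<in> D i" if "t \<in> carrier R" "x m \<otimes> t = y m \<otimes> s" for s t
        using D_mult_right[OF x(2)[OF m(1)] that(1)] that(2) by simp
      then have "(s, t) \<in> syzygies I x y \<longleftrightarrow> s \<in> D (i - j) \<and> t \<in> carrier R \<and> x m \<otimes> t = y m \<otimes> s" for s t
        using sol[of s t] S[of s] D_closed[of s "i - j"] unfolding syzygies_def by auto
      then show ?thesis by auto
    qed
    have "card (syzygies I x y) = (\<Sum>s\<in>D (i - j). card {t \<in> carrier R. x m \<otimes> t = y m \<otimes> s})"
      unfolding syz using finite_D finite_carrier by simp
    also have "\<dots> = (\<Sum>s\<in>D (i - j). q ^ i)"
    proof (rule sum.cong)
      fix s assume s: "s \<in> D (i - j)"
      have "y m \<otimes> s \<in> D i" using iffD2[OF S[OF D_closed[OF s]] s] by simp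
      then show "card {t \<in> carrier R. x m \<otimes> t = y m \<otimes> s} = q ^ i"
        unfolding m(3) by (intro pi_unit_mult_eq_card i m(2))
    qed simp
    also have "\<dots> = q ^ (n - (i - j)) * q ^ i"
      using i by (simp add: card_D)
    also have "\<dots> = q ^ (n + j)"
      using i j by (simp add: power_add[symmetric])
    finally show ?thesis .
  qed
  have "(\<Sum>y\<in>F 0. real (card (syzygies I x y)) ^ C)
      = (\<Sum>j\<le>i. (real (card (F j)) - real (card (F (Suc j)))) * (real q ^ (n + j)) ^ C)"
  proof (rule sum_over_chain)
    have "F 0 \<subseteq> vecs I" by (auto simp: F_def)
    then show "finite (F 0)" by (rule finite_subset) (use I finite_carrier in \<open>auto intro: finite_PiE\<close>)
    show "F (Suc j) \<subseteq> F j" for j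
      using D_antimono[of j "Suc j"] D_antimono[of "n - i + j" "n - i + Suc j"]
      by (auto simp: F_def split: if_splits)
    show "F (Suc i) = {}" by (simp add: F_def)
  qed (use card_syz in simp)
  also have "\<dots> = (\<Sum>j\<le>i. real q ^ (n - i) * primitive_count q (card I) (i - j) * real q ^ (C * (n + j)))"
    by (intro sum.cong) (simp_all add: cardF power_mult[symmetric] mult.commute)
  finally show ?thesis
    unfolding propF by (simp add: sum_distrib_left mult.assoc)
qed

text \<open>The vectors x are layered by valuation i; layer i has as many members as there are
  primitive vectors modulo P^(n - i). The zero vector is layer n.\<close>

theorem sum_syzygies:
  fixes I :: "'i set"
  assumes I: "finite I"
  shows "(\<Sum>(x, y)\<in>{(x, y). x \<in> vecs I \<and> y \<in> vecs I \<and> proportional I x y}. real (card (syzygies I x y)) ^ C)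
    = (\<Sum>i\<le>n. primitive_count q (card I) (n - i) * real q ^ (n - i) *
        (\<Sum>j\<le>i. primitive_count q (card I) (i - j) * real q ^ (C * (n + j))))"
proof -
  have finv: "finite (vecs I)" using I finite_carrier by (auto intro: finite_PiE)
  have "{(x, y). x \<in> vecs I \<and> y \<in> vecs I \<and> proportional I x y} = (SIGMA x:vecs I. {y \<in> vecs I. proportional I x y})"
    by auto
  then have "(\<Sum>(x, y)\<in>{(x, y). x \<in> vecs I \<and> y \<in> vecs I \<and> proportional I x y}. real (card (syzygies I x y)) ^ C)
      = (\<Sum>x\<in>vecs I. \<Sum>y\<in>{y \<in> vecs I. proportional I x y}. real (card (syzygies I x y)) ^ C)"
    using finv by (simp add: sum.Sigma)
  also have "\<dots> = (\<Sum>i\<le>n. primitive_count q (card I) (n - i) * real q ^ (n - i) *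
        (\<Sum>j\<le>i. primitive_count q (card I) (i - j) * real q ^ (C * (n + j))))"
  proof (cases "I = {}")
    \<comment> \<open>Without coordinates there is no pivot. Since
      \<open>primitive_count q 0 k\<close> is 1 for k = 0 and 0 otherwise, only i = j = n
      contributes.\<close>
    case True
    let ?f = "\<lambda>x :: 'i \<Rightarrow> 'a. \<lambda>y :: 'i \<Rightarrow> 'a. real (card (syzygies {} x y)) ^ C"
    have "syzygies {} x y = carrier R \<times> carrier R" for x y :: "'i \<Rightarrow> 'a"
      by (auto simp: syzygies_def)
    then have f: "?f x y = real q ^ (C * (n + n))" for x y
      using card_D[of 0]
      by (simp add: D_0 card_cartesian_product power_add[symmetric] power_mult[symmetric] mult.commute
          flip: of_nat_power of_nat_mult)
    have pc: "primitive_count q 0 k = of_bool (k = 0)" for k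
      by (simp add: primitive_count_def)
    have "(\<Sum>j\<le>i. primitive_count q 0 (i - j) * real q ^ (C * (n + j))) = real q ^ (C * (n + i))" for i
    proof -
      have "(\<Sum>j\<le>i. primitive_count q 0 (i - j) * real q ^ (C * (n + j)))
          = (\<Sum>j\<le>i. if j = i then real q ^ (C * (n + j)) else 0)"
        by (intro sum.cong) (auto simp: pc)
      then show ?thesis by simp
    qed
    moreover have "(\<Sum>i\<le>n. primitive_count q 0 (n - i) * real q ^ (n - i) * real q ^ (C * (n + i)))
        = (\<Sum>i\<le>n. if i = n then real q ^ (C * (n + i)) else 0)"
      by (intro sum.cong) (auto simp: pc)
    ultimately show ?thesis
      by (simp add: True f proportional_def)
  next
    case False
    define E where "E j = (if j \<le> n then I \<rightarrow>\<^sub>E D j else {})" for j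
    have E0: "E 0 = vecs I" by (simp add: E_def D_0)
    have "(\<Sum>x\<in>E 0. \<Sum>y\<in>{y \<in> vecs I. proportional I x y}. real (card (syzygies I x y)) ^ C)
      = (\<Sum>i\<le>n. (real (card (E i)) - real (card (E (Suc i)))) *
          (real q ^ (n - i) * (\<Sum>j\<le>i. primitive_count q (card I) (i - j) * real q ^ (C * (n + j)))))"
    proof (rule sum_over_chain)
      show "finite (E 0)" using finv by (simp add: E0)
      show "E (Suc j) \<subseteq> E j" for j
        using D_antimono[of j "Suc j"] by (auto simp: E_def split: if_splits)
      show "E (Suc n) = {}" by (simp add: E_def)
    next
      fix i x assume i: "i \<le> n" and x: "x \<in> E i - E (Suc i)"
      have xE: "x \<in> I \<rightarrow>\<^sub>E D i" using x i by (simp add: E_def)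
      show "(\<Sum>y\<in>{y \<in> vecs I. proportional I x y}. real (card (syzygies I x y)) ^ C)
        = real q ^ (n - i) * (\<Sum>j\<le>i. primitive_count q (card I) (i - j) * real q ^ (C * (n + j)))"
      proof (rule sum_syzygies_fixed[OF I False i])
        show "x \<in> vecs I" using xE D_subset by (auto simp: PiE_def Pi_def)
        show "x a \<in> D i" if "a \<in> I" for a using xE that by auto
        show "\<exists>a\<in>I. x a \<notin> D (Suc i)" if "i < n"
          using x xE that by (auto simp: E_def PiE_def)
      qed
    qed
    moreover have "real (card (E i)) - real (card (E (Suc i))) = primitive_count q (card I) (n - i)" if "i \<le> n" for i
    proof -
      have c: "real (card (E i)) = real q ^ (card I * (n - i))" if "i \<le> n" for i
        using that I by (simp add: E_def card_PiE card_D power_mult[symmetric] mult.commute)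
      show ?thesis
      proof (cases "i = n")
        case True
        then show ?thesis using c[of n] by (simp add: E_def primitive_count_def)
      next
        case False
        then show ?thesis using c[of i] c[of "Suc i"] that by (simp add: primitive_count_def)
      qed
    qed
    ultimately show ?thesis
      unfolding E0 by (simp add: mult.assoc)
  qed
  finally show ?thesis .
qed

end

section \<open>Quotients of discrete valuation rings\<close>

context discrete_valuation_ring
begin

abbreviation "P \<equiv> max_ideal R"

lemma max_ideal: "maximalideal P R"
  unfolding max_ideal_def using local by (rule theI')

lemma max_ideal_unique: "maximalideal I R \<Longrightarrow> I = P"
  using local max_ideal by blast

definition \<pi> :: 'a where "\<pi> = (SOME a. a \<in> carrier R \<and> P = PIdl a)"

lemma pi_closed [simp]: "\<pi> \<in> carrier R" and P_eq: "P = PIdl \<pi>"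
proof -
  have "\<exists>a. a \<in> carrier R \<and> P = PIdl a"
    using exists_gen[OF maximalideal.axioms(1)[OF max_ideal]] by blast
  then have "\<pi> \<in> carrier R \<and> P = PIdl \<pi>"
    unfolding \<pi>_def by (rule someI_ex)
  then show "\<pi> \<in> carrier R" "P = PIdl \<pi>" by auto
qed

lemma in_PIdl_iff: "a \<in> carrier R \<Longrightarrow> x \<in> PIdl a \<longleftrightarrow> (\<exists>r\<in>carrier R. x = a \<otimes> r)"
  unfolding cgenideal_def by (auto simp: m_comm)

lemma pi_nonzero: "\<pi> \<noteq> \<zero>"
proof
  assume "\<pi> = \<zero>"
  then have "P = PIdl \<zero>" using P_eq by (rule subst)
  also have "PIdl \<zero> = {\<zero>}" using zero_closed by (auto simp: in_PIdl_iff ex_in_conv simp del: zero_closed)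
  finally have "maximalideal {\<zero>} R" using max_ideal by (rule subst)
  then show False using not_field zeromaximalideal_eq_field by blast
qed

lemma one_notin_P: "\<one> \<notin> P"
  using maximalideal.I_notcarr[OF max_ideal] ideal.one_imp_carrier[OF maximalideal.axioms(1)[OF max_ideal]]
  by auto

text \<open>A nonzero nonunit has an irreducible divisor; this generates a maximal ideal, which can
  only be \<open>P\<close>.\<close>

lemma unit_if_notin_P:
  assumes "x \<in> carrier R" "x \<notin> P"
  shows "x \<in> Units R"
proof (rule ccontr)
  assume "x \<notin> Units R"
  moreover have "x \<noteq> \<zero>"
    using assms(2) additive_subgroup.zero_closed[OF ideal.axioms(1)[OF maximalideal.axioms(1)[OF max_ideal]]] by auto
  ultimately obtain b where b: "b \<in> carrier R" "ring_irreducible b" "b divides x"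
    using exists_irreducible_divisor[of x] assms(1) by blast
  have "PIdl b = P"
    using irreducible_imp_maximalideal[OF b(1,2)] by (rule max_ideal_unique)
  moreover have "x \<in> PIdl b"
    using b(1,3) by (auto simp: in_PIdl_iff factor_def)
  ultimately show False using assms(2) by simp
qed

lemma pi_pow_nonzero: "\<pi> [^] (k :: nat) \<noteq> \<zero>"
  by (induction k) (auto simp: pi_nonzero integral_iff)

text \<open>Factors \<open>\<pi>\<close> are split off as long as the cofactor is not a unit.
  Stopping at n is enough modulo P^n and avoids showing that the process terminates.\<close>

lemma pi_pow_decomp:
  assumes "x \<in> carrier R"
  shows "(\<exists>k<n. \<exists>u\<in>Units R. x = \<pi> [^] k \<otimes> u) \<or> (\<exists>r\<in>carrier R. x = \<pi> [^] (n :: nat) \<otimes> r)"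
proof (induction n)
  case 0
  then show ?case using assms by (intro disjI2 bexI[of _ x]) auto
next
  case (Suc n)
  then show ?case
  proof
    assume "\<exists>k<n. \<exists>u\<in>Units R. x = \<pi> [^] k \<otimes> u"
    then show ?thesis using less_SucI by blast
  next
    assume "\<exists>r\<in>carrier R. x = \<pi> [^] n \<otimes> r"
    then obtain r where r: "r \<in> carrier R" "x = \<pi> [^] n \<otimes> r" by blast
    show ?thesis
    proof (cases "r \<in> Units R")
      case True
      then show ?thesis using r by blast
    next
      case False
      then have "r \<in> PIdl \<pi>" using unit_if_notin_P r P_eq by blast
      then obtain z where z: "z \<in> carrier R" "r = \<pi> \<otimes> z" by (auto simp: in_PIdl_iff)
      then have "x = \<pi> [^] Suc n \<otimes> z" using r by (simp add: m_assoc)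
      then show ?thesis using z by blast
    qed
  qed
qed

lemma ideal_prod_PIdl:
  assumes "a \<in> carrier R" "b \<in> carrier R"
  shows "ideal_prod R (PIdl a) (PIdl b) = PIdl (a \<otimes> b)"
proof
  show "ideal_prod R (PIdl a) (PIdl b) \<subseteq> PIdl (a \<otimes> b)"
  proof
    fix x assume "x \<in> ideal_prod R (PIdl a) (PIdl b)"
    then show "x \<in> PIdl (a \<otimes> b)"
    proof (induction rule: ideal_prod.induct)
      case (prod i j)
      then obtain r s where "r \<in> carrier R" "i = a \<otimes> r" "s \<in> carrier R" "j = b \<otimes> s"
        using assms by (auto simp: in_PIdl_iff)
      then show ?case using assms by (auto simp: in_PIdl_iff m_ac intro!: bexI[of _ "r \<otimes> s"])
    next
      case (sum s t)
      then show ?case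
        using additive_subgroup.a_closed[OF ideal.axioms(1)[OF cgenideal_ideal]] assms by simp
    qed
  qed
  show "PIdl (a \<otimes> b) \<subseteq> ideal_prod R (PIdl a) (PIdl b)"
  proof
    fix x assume "x \<in> PIdl (a \<otimes> b)"
    then obtain r where r: "r \<in> carrier R" "x = a \<otimes> b \<otimes> r" using assms by (auto simp: in_PIdl_iff)
    then have "x = (a \<otimes> r) \<otimes> b" using assms by (simp add: m_ac)
    moreover have "a \<otimes> r \<in> PIdl a" "b \<in> PIdl b"
      using assms r cgenideal_self[of b] in_PIdl_iff[of a] by auto
    ultimately show "x \<in> ideal_prod R (PIdl a) (PIdl b)" by (auto intro: ideal_prod.prod)
  qed
qed

lemma ideal_power_eq: "ideal_power R P n = PIdl (\<pi> [^] n)"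
proof (induction n)
  case 0
  have "PIdl \<one> = carrier R" by (auto simp: in_PIdl_iff)
  then show ?case by (simp add: ideal_power_def ideals_set_def nat_pow_def)
next
  case (Suc n)
  have "ideal_power R P (Suc n) = ideal_prod R (ideal_power R P n) P"
    by (simp add: ideal_power_def nat_pow_def ideals_set_def)
  also have "\<dots> = ideal_prod R (PIdl (\<pi> [^] n)) (PIdl \<pi>)"
    by (simp only: Suc P_eq[symmetric])
  finally show ?case
    by (simp add: ideal_prod_PIdl)
qed

end

section \<open>The filtration of the ring modulo the n-th power of its maximal ideal\<close>

locale dvr_quotient = discrete_valuation_ring +
  fixes n :: nat
begin

definition "I = ideal_power R P n"
abbreviation "Q \<equiv> R Quot I"
definition h :: "'a \<Rightarrow> 'a set" where "h x = I +> x"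

lemma I_eq: "I = PIdl (\<pi> [^] n)"
  by (simp add: I_def ideal_power_eq)

lemma ideal_I: "ideal I R"
  by (simp add: I_eq cgenideal_ideal)

lemma h_hom: "ring_hom_cring R Q h"
  using ideal.rcos_ring_hom_cring[OF ideal_I is_cring] unfolding h_def[abs_def] .

sublocale h: ring_hom_cring R Q h
  by (rule h_hom)

lemma Q_cases:
  assumes "X \<in> carrier Q"
  obtains x where "x \<in> carrier R" "X = h x"
  using assms by (auto simp: h_def FactRing_def A_RCOSETS_def')

lemma h_eq_iff: "x \<in> carrier R \<Longrightarrow> y \<in> carrier R \<Longrightarrow> h x = h y \<longleftrightarrow> x \<ominus> y \<in> I"
  using quotient_eq_iff_same_a_r_cos[OF ideal_I] by (simp add: h_def)

lemma h_pow: "x \<in> carrier R \<Longrightarrow> h (x [^] (k :: nat)) = h x [^]\<^bsub>Q\<^esub> k"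
  by (induction k) simp_all

lemma h_unit: "u \<in> Units R \<Longrightarrow> h u \<in> Units Q"
proof -
  assume u: "u \<in> Units R"
  then have "h (inv u) \<otimes>\<^bsub>Q\<^esub> h u = \<one>\<^bsub>Q\<^esub>"
    using h.hom_mult[of "inv u" u] by (simp add: Units_closed)
  moreover have "h u \<otimes>\<^bsub>Q\<^esub> h (inv u) = \<one>\<^bsub>Q\<^esub>"
    using u h.hom_mult[of u "inv u"] by (simp add: Units_closed)
  ultimately show ?thesis
    unfolding Units_def using u by (auto intro!: bexI[of _ "h (inv u)"])
qed

definition D :: "nat \<Rightarrow> 'a set set" where "D j = (\<lambda>s. h \<pi> [^]\<^bsub>Q\<^esub> j \<otimes>\<^bsub>Q\<^esub> s) ` carrier Q"

lemma D_iff: "X \<in> D j \<longleftrightarrow> (\<exists>r\<in>carrier R. X = h (\<pi> [^] j \<otimes> r))"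
proof
  assume "X \<in> D j"
  then obtain s where s: "s \<in> carrier Q" "X = h \<pi> [^]\<^bsub>Q\<^esub> j \<otimes>\<^bsub>Q\<^esub> s" by (auto simp: D_def)
  obtain r where "r \<in> carrier R" "s = h r" using s(1) by (rule Q_cases)
  with s show "\<exists>r\<in>carrier R. X = h (\<pi> [^] j \<otimes> r)" by (auto simp: h_pow)
qed (auto simp: D_def h_pow)

lemma D_n: "D n = {\<zero>\<^bsub>Q\<^esub>}"
proof -
  have "h (\<pi> [^] n \<otimes> r) = \<zero>\<^bsub>Q\<^esub>" if "r \<in> carrier R" for r
  proof -
    have "\<pi> [^] n \<otimes> r \<ominus> \<zero> \<in> I" using that by (auto simp: I_eq in_PIdl_iff minus_eq)
    then show ?thesis using h_eq_iff[of "\<pi> [^] n \<otimes> r" \<zero>] that by simp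
  qed
  then show ?thesis
    using zero_closed by (auto simp: D_iff ex_in_conv simp del: zero_closed h.hom_mult)
qed

lemma D_0: "D 0 = carrier Q"
  by (auto simp: D_iff) (metis Q_cases)

text \<open>Digit expansion: each element of \<open>D j\<close> is uniquely pi^j t + Y with Y in
  \<open>D (Suc j)\<close> and t in a system T of representatives of the residue field.\<close>

lemma card_D_step:
  assumes "j < n" "finite (carrier (R Quot P))"
  shows "finite (D (Suc j)) \<Longrightarrow> finite (D j)" "card (D j) = card (carrier (R Quot P)) * card (D (Suc j))"
proof -
  have idP: "ideal P R" using max_ideal by (rule maximalideal.axioms)
  have K: "carrier (R Quot P) = (\<lambda>x. P +> x) ` carrier R"
    by (auto simp: FactRing_def A_RCOSETS_def')
  obtain T where T: "T \<subseteq> carrier R" "inj_on (\<lambda>x. P +> x) T" "carrier (R Quot P) = (\<lambda>x. P +> x) ` T"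
    unfolding K using subset_image_inj[of "(\<lambda>x. P +> x) ` carrier R" "\<lambda>x. P +> x" "carrier R"] by auto
  have cong: "P +> x = P +> y \<longleftrightarrow> x \<ominus> y \<in> P" if "x \<in> carrier R" "y \<in> carrier R" for x y
    using quotient_eq_iff_same_a_r_cos[OF idP] that by simp
  \<comment> \<open>Because j < n, a factor \<open>\<pi>\<close> remains after pi^j is cancelled in
    the domain R; this puts t - t' into \<open>P\<close>.\<close>
  have split: "\<pi> [^] n = \<pi> [^] j \<otimes> (\<pi> \<otimes> \<pi> [^] (n - Suc j))"
  proof -
    have "\<pi> [^] n = \<pi> [^] (Suc j + (n - Suc j))" using assms(1) by simp
    also have "\<dots> = \<pi> [^] Suc j \<otimes> \<pi> [^] (n - Suc j)" by (simp only: nat_pow_mult pi_closed)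
    finally show ?thesis by (simp add: m_assoc)
  qed
  let ?f = "\<lambda>(t, Y). h (\<pi> [^] j \<otimes> t) \<oplus>\<^bsub>Q\<^esub> Y"
  have DQ: "Y \<in> carrier Q" if "Y \<in> D k" for Y k using that by (auto simp: D_iff)
  have inj: "inj_on ?f (T \<times> D (Suc j))"
  proof (rule inj_onI, clarify)
    fix t Y t' Y'
    assume t: "t \<in> T" "t' \<in> T" and Y: "Y \<in> D (Suc j)" "Y' \<in> D (Suc j)"
      and eq: "h (\<pi> [^] j \<otimes> t) \<oplus>\<^bsub>Q\<^esub> Y = h (\<pi> [^] j \<otimes> t') \<oplus>\<^bsub>Q\<^esub> Y'"
    have tc: "t \<in> carrier R" "t' \<in> carrier R" using t T by auto
    obtain r where r: "r \<in> carrier R" "Y = h (\<pi> [^] Suc j \<otimes> r)" using Y(1) by (auto simp: D_iff)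
    obtain r' where r': "r' \<in> carrier R" "Y' = h (\<pi> [^] Suc j \<otimes> r')" using Y(2) by (auto simp: D_iff)
    let ?x = "\<pi> [^] j \<otimes> t \<oplus> \<pi> [^] Suc j \<otimes> r" and ?y = "\<pi> [^] j \<otimes> t' \<oplus> \<pi> [^] Suc j \<otimes> r'"
    have "h ?x = h ?y" using eq r r' tc by simp
    then have "?x \<ominus> ?y \<in> I" using r r' tc by (simp only: h_eq_iff m_closed a_closed nat_pow_closed pi_closed)
    then obtain s where s: "s \<in> carrier R" "?x \<ominus> ?y = \<pi> [^] n \<otimes> s"
      by (auto simp: I_eq in_PIdl_iff)
    have "\<pi> [^] j \<otimes> (t \<ominus> t') = ?x \<ominus> ?y \<oplus> (\<pi> [^] Suc j \<otimes> r' \<ominus> \<pi> [^] Suc j \<otimes> r)"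
    proof -
      have gen: "a \<ominus> a' = (a \<oplus> b) \<ominus> (a' \<oplus> b') \<oplus> (b' \<ominus> b)"
        if "a \<in> carrier R" "a' \<in> carrier R" "b \<in> carrier R" "b' \<in> carrier R" for a a' b b'
        using that by algebra
      show ?thesis
        using gen[of "\<pi> [^] j \<otimes> t" "\<pi> [^] j \<otimes> t'" "\<pi> [^] Suc j \<otimes> r" "\<pi> [^] Suc j \<otimes> r'"] tc r r'
        by (simp add: minus_eq r_distr r_minus)
    qed
    also have "\<dots> = \<pi> [^] j \<otimes> (\<pi> \<otimes> (\<pi> [^] (n - Suc j) \<otimes> s \<oplus> (r' \<ominus> r)))"
      unfolding s(2) split using s(1) r(1) r'(1) by (simp add: minus_eq r_distr r_minus m_assoc)
    finally have "t \<ominus> t' = \<pi> \<otimes> (\<pi> [^] (n - Suc j) \<otimes> s \<oplus> (r' \<ominus> r))"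
      using m_lcancel[OF pi_pow_nonzero[of j]] tc s(1) r(1) r'(1) by simp
    then have "t \<ominus> t' \<in> P"
      unfolding P_eq using s(1) r(1) r'(1) by (auto simp: in_PIdl_iff)
    then have "P +> t = P +> t'" using cong tc by simp
    then have tt: "t = t'" using T(2) t by (auto dest: inj_onD)
    moreover have "Y = Y'"
      by (rule h.S.add.l_cancel[OF eq[unfolded tt]]) (use DQ[OF Y(1)] DQ[OF Y(2)] tc in simp_all)
    ultimately show "t = t' \<and> Y = Y'" by simp
  qed
  have img: "?f ` (T \<times> D (Suc j)) = D j"
  proof (intro equalityI subsetI)
    fix X assume "X \<in> ?f ` (T \<times> D (Suc j))"
    then obtain t r where "t \<in> T" "r \<in> carrier R" "X = h (\<pi> [^] j \<otimes> t) \<oplus>\<^bsub>Q\<^esub> h (\<pi> [^] Suc j \<otimes> r)"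
      by (auto simp: D_iff)
    moreover have "t \<in> carrier R" using \<open>t \<in> T\<close> T by auto
    ultimately have "X = h (\<pi> [^] j \<otimes> (t \<oplus> \<pi> \<otimes> r))"
      by (simp add: r_distr m_assoc h.hom_add[symmetric] del: h.hom_add h.hom_mult)
    then show "X \<in> D j"
      unfolding D_iff using \<open>t \<in> carrier R\<close> \<open>r \<in> carrier R\<close> by (intro bexI[of _ "t \<oplus> \<pi> \<otimes> r"]) auto
  next
    fix X assume "X \<in> D j"
    then obtain r where r: "r \<in> carrier R" "X = h (\<pi> [^] j \<otimes> r)" by (auto simp: D_iff)
    have "P +> r \<in> (\<lambda>x. P +> x) ` T" using T(3) K r(1) by auto
    then obtain t where t: "t \<in> T" "P +> r = P +> t" by auto
    have tc: "t \<in> carrier R" using t T by auto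
    have "r \<ominus> t \<in> P" using t(2) cong[OF r(1) tc] by simp
    then obtain c where c: "c \<in> carrier R" "r \<ominus> t = \<pi> \<otimes> c" unfolding P_eq by (auto simp: in_PIdl_iff)
    have "r = t \<oplus> (r \<ominus> t)" using r(1) tc by algebra
    then have "\<pi> [^] j \<otimes> r = \<pi> [^] j \<otimes> (t \<oplus> \<pi> \<otimes> c)" using c(2) by simp
    also have "\<dots> = \<pi> [^] j \<otimes> t \<oplus> \<pi> [^] Suc j \<otimes> c"
      using tc c(1) by (simp add: r_distr m_assoc)
    finally have "X = h (\<pi> [^] j \<otimes> t \<oplus> \<pi> [^] Suc j \<otimes> c)"
      using r(2) by simp
    also have "\<dots> = ?f (t, h (\<pi> [^] Suc j \<otimes> c))"
      using tc c(1) by (simp only: prod.case h.hom_add m_closed nat_pow_closed pi_closed)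
    finally show "X \<in> ?f ` (T \<times> D (Suc j))"
      using t(1) c(1) by (intro image_eqI[of _ _ "(t, h (\<pi> [^] Suc j \<otimes> c))"]) (auto simp: D_iff)
  qed
  have cT: "card T = card (carrier (R Quot P))" "finite T"
    using T assms(2) by (auto simp: card_image finite_image_iff)
  show "card (D j) = card (carrier (R Quot P)) * card (D (Suc j))"
    using card_image[OF inj] unfolding img by (simp add: card_cartesian_product cT)
  show "finite (D (Suc j)) \<Longrightarrow> finite (D j)"
    unfolding img[symmetric] using cT by auto
qed

lemma card_residue_gt_1:
  assumes "finite (carrier (R Quot P))"
  shows "card (carrier (R Quot P)) > 1"
proof -
  have idP: "ideal P R" using max_ideal by (rule maximalideal.axioms)
  have "P +> \<zero> \<noteq> P +> \<one>"
    using quotient_eq_iff_same_a_r_cos[OF idP, of \<one> \<zero>] one_notin_P by (auto simp: minus_eq)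
  moreover have "{P +> \<zero>, P +> \<one>} \<subseteq> carrier (R Quot P)"
    by (auto simp: FactRing_def A_RCOSETS_def')
  ultimately show ?thesis
    using card_mono[OF assms, of "{P +> \<zero>, P +> \<one>}"] by simp
qed

lemma finite_and_card_D:
  assumes "finite (carrier (R Quot P))" "j \<le> n"
  shows "finite (D j) \<and> card (D j) = card (carrier (R Quot P)) ^ (n - j)"
  using assms(2)
proof (induction rule: inc_induct)
  case base
  show ?case by (simp add: D_n)
next
  case (step k)
  then show ?case
    using card_D_step[OF step.hyps(2) assms(1)] by (simp add: Suc_diff_Suc[symmetric])
qed

lemma chain_ring_Q:
  assumes "finite (carrier (R Quot P))"
  shows "chain_ring Q (h \<pi>) n (card (carrier (R Quot P)))"
proof unfold_locales
  show "h \<pi> \<in> carrier Q" by simp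
  show "finite (carrier Q)" using finite_and_card_D[OF assms, of 0] by (simp add: D_0)
  show "card (carrier (R Quot P)) > 1" using assms by (rule card_residue_gt_1)
next
  fix X assume "X \<in> carrier Q"
  then obtain x where x: "x \<in> carrier R" "X = h x" by (rule Q_cases)
  from pi_pow_decomp[OF x(1), of n]
  show "\<exists>k\<le>n. \<exists>u\<in>Units Q. X = h \<pi> [^]\<^bsub>Q\<^esub> k \<otimes>\<^bsub>Q\<^esub> u"
  proof
    assume "\<exists>k<n. \<exists>u\<in>Units R. x = \<pi> [^] k \<otimes> u"
    then obtain k u where ku: "k < n" "u \<in> Units R" "x = \<pi> [^] k \<otimes> u" by blast
    then have "X = h \<pi> [^]\<^bsub>Q\<^esub> k \<otimes>\<^bsub>Q\<^esub> h u" using x by (simp add: h_pow Units_closed)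
    then show ?thesis using ku h_unit[OF ku(2)] less_imp_le by blast
  next
    assume "\<exists>r\<in>carrier R. x = \<pi> [^] n \<otimes> r"
    then have "X \<in> D n" unfolding D_iff x(2) by blast
    then have "X = \<zero>\<^bsub>Q\<^esub>" using D_n by simp
    \<comment> \<open>The class is zero, which has to be presented as pi^n times a unit.\<close>
    moreover have "h \<pi> [^]\<^bsub>Q\<^esub> n \<otimes>\<^bsub>Q\<^esub> \<one>\<^bsub>Q\<^esub> \<in> D n"
      unfolding D_def by (rule imageI) simp
    ultimately show ?thesis using D_n by (intro exI[of _ n] conjI bexI[of _ "\<one>\<^bsub>Q\<^esub>"]) auto
  qed
next
  fix j assume "j \<le> n"
  then show "card ((\<lambda>s. h \<pi> [^]\<^bsub>Q\<^esub> j \<otimes>\<^bsub>Q\<^esub> s) ` carrier Q) = card (carrier (R Quot P)) ^ (n - j)"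
    using finite_and_card_D[OF assms, of j] by (simp add: D_def)
qed

end

text \<open>Lagrange's theorem in the additive group.\<close>

lemma (in ring) add_pow_one_card:
  assumes "finite (carrier R)"
  shows "add_pow R (int (card (carrier R))) \<one> = \<zero>"
proof -
  have "\<one> [^]\<^bsub>add_monoid R\<^esub> order (add_monoid R) = \<one>\<^bsub>add_monoid R\<^esub>"
    by (rule group.pow_order_eq_1[OF add.is_group]) simp
  then have "add_pow R (card (carrier R)) \<one> = \<zero>"
    by (simp add: add_pow_def order_def)
  then show ?thesis
    by (simp add: add_pow_int_ge)
qed

lemma (in ring_hom_ring) hom_add_pow_int:
  "x \<in> carrier R \<Longrightarrow> h (add_pow R (k :: int) x) = add_pow S k (h x)"
  unfolding add_pow_def using group_hom.hom_int_pow[OF a_group_hom] by simp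

text \<open>If 6 were in \<open>P\<close>, both 6 and the number of residues would annihilate 1 in
  the residue ring, and Bezout would give 1 = 0 there. So 6 is already a unit of R.\<close>

lemma (in dvr_quotient) six_unit_Q:
  assumes "finite (carrier (R Quot P))" "coprime (6 :: int) (int (card (carrier (R Quot P))))"
  shows "add_pow Q (6 :: int) \<one>\<^bsub>Q\<^esub> \<in> Units Q"
proof -
  have idP: "ideal P R" using max_ideal by (rule maximalideal.axioms)
  interpret k: ring_hom_cring R "R Quot P" "\<lambda>x. P +> x"
    using ideal.rcos_ring_hom_cring[OF idP is_cring] .
  let ?c = "int (card (carrier (R Quot P)))"
  let ?e = "\<lambda>m :: int. add_pow (R Quot P) m \<one>\<^bsub>R Quot P\<^esub>"
  let ?six = "add_pow R (6 :: int) \<one>"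
  have e_add: "?e (a + b) = ?e a \<oplus>\<^bsub>R Quot P\<^esub> ?e b" for a b
    by (simp add: k.S.add.int_pow_mult)
  have e_mult: "?e (a * b) = ?e a \<otimes>\<^bsub>R Quot P\<^esub> ?e b" for a b
    by (simp add: k.S.add_pow_ldistr_int k.S.add.int_pow_pow mult.commute)
  have "?six \<notin> P"
  proof
    assume "?six \<in> P"
    then have "P +> ?six = P +> \<zero>"
      using quotient_eq_iff_same_a_r_cos[OF idP, of ?six \<zero>] by (simp add: minus_eq)
    then have e6: "?e 6 = \<zero>\<^bsub>R Quot P\<^esub>"
      using ring_hom_ring.hom_add_pow_int[OF ideal.rcos_ring_hom_ring[OF idP], of \<one> 6] by simp
    have ec: "?e ?c = \<zero>\<^bsub>R Quot P\<^esub>"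
      by (rule k.S.add_pow_one_card) fact
    obtain a b where "a * 6 + b * ?c = 1"
      using assms(2) bezout_int[of 6 ?c] by (auto simp: coprime_iff_gcd_eq_1)
    then have "?e 1 = \<zero>\<^bsub>R Quot P\<^esub>"
      using e_add[of "a * 6" "b * ?c"] e_mult[of a 6] e_mult[of b ?c] e6 ec by simp
    then have "P +> \<one> = P +> \<zero>" by simp
    then have "\<one> \<ominus> \<zero> \<in> P"
      using quotient_eq_iff_same_a_r_cos[OF idP, of \<one> \<zero>] by simp
    then show False using one_notin_P by (simp add: minus_eq)
  qed
  then have "?six \<in> Units R" by (intro unit_if_notin_P) auto
  then have "h ?six \<in> Units Q" by (rule h_unit)
  then show ?thesis using ring_hom_ring.hom_add_pow_int[OF ideal.rcos_ring_hom_ring[OF ideal_I], of \<one> 6] by (simp add: h_def[symmetric])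
qed

section \<open>The class counting zeta function\<close>

text \<open>The factor q^(C n) of q^(C (n + j)) cancels against the degree-two part of the group
  order, and of the q^(2 n r) choices in degree three a factor q^(n r) remains. The degree-one part
  q^(n d) stays on the left.\<close>

lemma (in dvr_quotient) class_number_F3_quotient:
  fixes d :: nat
  defines "q \<equiv> card (carrier (R Quot P))" and "A \<equiv> primitive_count (card (carrier (R Quot P))) d"
    and "C \<equiv> card (hall2 d)" and "r \<equiv> card (hall3 d)"
  assumes fin: "finite (carrier (R Quot P))" and coprime: "coprime (6 :: int) (int q)"
  shows "real (class_number (F3 d Q)) * real q ^ (n * d) = real q ^ (n * r) *
    (\<Sum>i\<le>n. A (n - i) * real q ^ (n - i) * (\<Sum>j\<le>i. A (i - j) * real q ^ (C * j)))"
proof -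
  interpret Q: chain_ring Q "h \<pi>" n q
    unfolding q_def by (rule chain_ring_Q) fact
  interpret B: f3_base_change Q d
  proof unfold_locales
    show "add_pow Q (6 :: int) \<one>\<^bsub>Q\<^esub> \<in> Units Q"
      using six_unit_Q fin coprime by (simp add: q_def)
  qed
  have q: "real q > 0" using Q.q_gt_1 by simp
  have cQ: "card (carrier Q) = q ^ n"
    using Q.card_D[of 0] by (simp add: Q.D_0)
  have pivot: "\<exists>m<d. \<forall>i<d. \<exists>r\<in>carrier Q. z i = z m \<otimes>\<^bsub>Q\<^esub> r"
    if "\<And>i :: nat. z i \<in> carrier Q" "d > 0" for z
    using Q.pivot[of "{..<d}" z] that by fastforce
  let ?X = "{(x, y). x \<in> Q.vecs (hall1 d) \<and> y \<in> Q.vecs (hall1 d) \<and> Q.proportional (hall1 d) x y}"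
  let ?S = "\<Sum>i\<le>n. A (n - i) * real q ^ (n - i) * (\<Sum>j\<le>i. A (i - j) * real q ^ (C * j))"
  have "class_number (F3 d Q) * card (carrier Q) ^ card (hall d)
      = (\<Sum>(x, y)\<in>?X. card (Q.syzygies (hall1 d) x y) ^ C * (card (carrier Q) ^ 2) ^ r)"
    unfolding C_def r_def Q.proportional_def Q.syzygies_def
    by (rule B.class_number_F3[OF Q.finite_carrier pivot])
  from arg_cong[OF this, of real]
  have "real (class_number (F3 d Q)) * real (card (carrier Q)) ^ card (hall d)
      = (\<Sum>(x, y)\<in>?X. real (card (Q.syzygies (hall1 d) x y)) ^ C * (real (card (carrier Q)) ^ 2) ^ r)"
    by (simp add: case_prod_unfold)
  also have "\<dots> = (\<Sum>(x, y)\<in>?X. real (card (Q.syzygies (hall1 d) x y)) ^ C) * (real (card (carrier Q)) ^ 2) ^ r"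
    by (simp add: sum_distrib_right case_prod_unfold)
  also have "(\<Sum>(x, y)\<in>?X. real (card (Q.syzygies (hall1 d) x y)) ^ C)
      = (\<Sum>i\<le>n. A (n - i) * real q ^ (n - i) * (\<Sum>j\<le>i. A (i - j) * real q ^ (C * (n + j))))"
    using Q.sum_syzygies[OF finite_hall_parts(1), of d C] by (simp add: A_def q_def card_hall1)
  also have "\<dots> = real q ^ (C * n) * ?S"
    by (simp add: sum_distrib_left power_add add_mult_distrib2 mult_ac)
  finally have "real (class_number (F3 d Q)) * (real q ^ n) ^ (d + C + r)
      = real q ^ (C * n) * ?S * ((real q ^ n) ^ 2) ^ r"
    unfolding card_hall cQ C_def[symmetric] r_def[symmetric] by simp
  moreover have "(real q ^ n) ^ (d + C + r) = real q ^ (n * d) * (real q ^ (C * n) * real q ^ (n * r))"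
    by (simp add: power_add power_mult[symmetric] mult.commute)
  moreover have "((real q ^ n) ^ 2) ^ r = real q ^ (n * r) * real q ^ (n * r)"
    by (simp only: monoid_mult_class.power2_eq_square power_mult_distrib power_mult)
  ultimately have "(real (class_number (F3 d Q)) * real q ^ (n * d)) * (real q ^ (C * n) * real q ^ (n * r))
      = (real q ^ (n * r) * ?S) * (real q ^ (C * n) * real q ^ (n * r))"
    by (simp only: mult_ac)
  then show ?thesis
    using q by simp
qed

section \<open>Generating functions\<close>

lemma fps_linear_factor_nth:
  fixes F :: "real fps"
  shows "fps_nth (F * (1 - fps_const k * fps_X)) n = fps_nth F n - (if n = 0 then 0 else k * fps_nth F (n - 1))"
proof -
  have "F * (1 - fps_const k * fps_X) = F - fps_const k * (F * fps_X)"
    by (simp add: algebra_simps)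
  then show ?thesis by simp
qed

text \<open>From index 1 on the counts are geometric with ratio q^d, so after multiplication only
  the coefficients 0 and 1 survive.\<close>

lemma fps_primitive_count:
  "Abs_fps (\<lambda>m. primitive_count q d m * c ^ m) * (1 - fps_const (real q ^ d * c) * fps_X)
    = 1 - fps_const c * fps_X"
proof (rule fps_ext)
  fix n
  have 2: "primitive_count q d (Suc (Suc m)) = real q ^ d * primitive_count q d (Suc m)" for m
    by (simp add: primitive_count_def power_add algebra_simps)
  have 1: "primitive_count q d (Suc 0) = real q ^ d - 1" and 0: "primitive_count q d 0 = 1"
    by (simp_all add: primitive_count_def)
  consider "n = 0" | "n = 1" | m where "n = Suc (Suc m)"
    by (metis One_nat_def not0_implies_Suc)
  then show "fps_nth (Abs_fps (\<lambda>m. primitive_count q d m * c ^ m) * (1 - fps_const (real q ^ d * c) * fps_X)) n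
      = fps_nth (1 - fps_const c * fps_X) n"
    unfolding fps_linear_factor_nth
    by cases (simp_all add: 0 1 2 algebra_simps fps_one_nth)
qed

lemma fps_geometric: "Abs_fps (\<lambda>m. c ^ m) * (1 - fps_const c * fps_X) = (1 :: real fps)"
  by (rule fps_ext) (auto simp: fps_linear_factor_nth power_eq_if)

theorem theoremE:
  fixes R :: "('a, 'b) ring_scheme" and p q f d :: nat
  assumes "Factorial_Ring.prime p" and "p \<ge> 5" and "q = p ^ f"
    and "compact_discrete_valuation_ring R"
    and "card (carrier (R Quot max_ideal R)) = q"
  shows "class_counting_zeta R (F3 d) =
    ((1 - fps_const (real q powr ((real d - 1) * (real d ^ 2 + real d - 3) / 3)) * fps_X)
      * (1 - fps_const (real q powr ((real d - 2) * real d * (real d + 2) / 3)) * fps_X))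
    / ((1 - fps_const (real q powr ((real d - 1) * real d * (real d + 1) / 3)) * fps_X)
      * (1 - fps_const (real q powr ((real d ^ 3 - real d + 3) / 3)) * fps_X)
      * (1 - fps_const (real q powr ((2 * real d ^ 2 + 3 * real d - 11) * real d / 6)) * fps_X))"
proof -
  interpret discrete_valuation_ring R
    using assms(4) by (rule compact_discrete_valuation_ring.axioms)
  have "q > 0"
    using assms(1,3) by (simp add: prime_gt_0_nat)
  \<comment> \<open>An infinite set has \<open>card\<close> zero, but q > 0.\<close>
  then have fin: "finite (carrier (R Quot max_ideal R))"
    using assms(5) by (metis card.infinite less_numeral_extra(3))
  have "\<not> p dvd 6"
  proof
    assume "p dvd 6"
    then have "p \<le> 6" by (rule dvd_imp_le) simp
    with assms(2) have "p = 5 \<or> p = 6" by linarith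
    moreover have "\<not> (5 :: nat) dvd 6" "\<not> Factorial_Ring.prime (6 :: nat)"
      using not_prime_eq_prod_nat[of 6] prime_nat_iff[of 6] by (auto dest: spec[of _ 2])
    ultimately show False using assms(1) \<open>p dvd 6\<close> by auto
  qed
  then have "coprime p 6"
    using assms(1) by (intro prime_imp_coprime)
  then have "coprime (int 6) (int p)"
    unfolding coprime_int_iff by (simp add: coprime_commute)
  then have coprime: "coprime (6 :: int) (int q)"
    unfolding assms(3) by simp
  define C where "C = card (hall2 d)"
  define r where "r = card (hall3 d)"
  \<comment> \<open>The factor q^(n (r - d)) becomes \<tau>^n. For d = 1 the exponent r - d is -1,
    hence a quotient of powers.\<close>
  define \<tau> where "\<tau> = real q ^ r / real q ^ d"
  let ?A = "primitive_count q d"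
  let ?K = "\<lambda>n. class_number (F3 d (R Quot ideal_power R (max_ideal R) n))"
  \<comment> \<open>Splitting \<tau>^n as \<tau>^j \<tau>^(i - j) \<tau>^(n - i) turns the double
    sum into a threefold convolution.\<close>
  have K: "real (?K n) = (\<Sum>i\<le>n. (\<Sum>j\<le>i. (real q ^ C * \<tau>) ^ j * (?A (i - j) * \<tau> ^ (i - j)))
      * (?A (n - i) * (real q * \<tau>) ^ (n - i)))" for n
  proof -
    interpret dvr_quotient R n by unfold_locales
    have "real (?K n) * real q ^ (n * d) = real q ^ (n * r) *
        (\<Sum>i\<le>n. ?A (n - i) * real q ^ (n - i) * (\<Sum>j\<le>i. ?A (i - j) * real q ^ (C * j)))"
      using class_number_F3_quotient[of d] fin coprime
      unfolding assms(5) I_def C_def r_def by simp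
    moreover have "real q ^ (n * r) / real q ^ (n * d) = \<tau> ^ n"
      by (simp add: \<tau>_def power_divide power_mult[symmetric] mult.commute)
    ultimately have "real (?K n) = \<tau> ^ n *
        (\<Sum>i\<le>n. ?A (n - i) * real q ^ (n - i) * (\<Sum>j\<le>i. ?A (i - j) * real q ^ (C * j)))"
      using \<open>q > 0\<close> by (simp add: field_simps)
    also have "\<dots> = (\<Sum>i\<le>n. \<tau> ^ n *
        (?A (n - i) * real q ^ (n - i) * (\<Sum>j\<le>i. ?A (i - j) * real q ^ (C * j))))"
      by (rule sum_distrib_left)
    also have "\<dots> = (\<Sum>i\<le>n. (\<Sum>j\<le>i. (real q ^ C * \<tau>) ^ j * (?A (i - j) * \<tau> ^ (i - j)))
        * (?A (n - i) * (real q * \<tau>) ^ (n - i)))"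
    proof (intro sum.cong HOL.refl)
      fix i assume "i \<in> {..n}"
      then have n: "\<tau> ^ n = \<tau> ^ i * \<tau> ^ (n - i)"
        by (simp add: power_add[symmetric])
      have "\<tau> ^ i * (\<Sum>j\<le>i. ?A (i - j) * real q ^ (C * j))
          = (\<Sum>j\<le>i. (real q ^ C * \<tau>) ^ j * (?A (i - j) * \<tau> ^ (i - j)))"
        unfolding sum_distrib_left
      proof (intro sum.cong HOL.refl)
        fix j assume "j \<in> {..i}"
        then have "\<tau> ^ i = \<tau> ^ j * \<tau> ^ (i - j)"
          by (simp add: power_add[symmetric])
        then show "\<tau> ^ i * (?A (i - j) * real q ^ (C * j)) = (real q ^ C * \<tau>) ^ j * (?A (i - j) * \<tau> ^ (i - j))"
          by (simp add: power_mult_distrib power_mult)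
      qed
      then show "\<tau> ^ n * (?A (n - i) * real q ^ (n - i) * (\<Sum>j\<le>i. ?A (i - j) * real q ^ (C * j)))
        = (\<Sum>j\<le>i. (real q ^ C * \<tau>) ^ j * (?A (i - j) * \<tau> ^ (i - j))) * (?A (n - i) * (real q * \<tau>) ^ (n - i))"
        unfolding n by (simp add: power_mult_distrib mult_ac)
    qed
    finally show ?thesis .
  qed
  let ?FC = "Abs_fps (\<lambda>m. (real q ^ C * \<tau>) ^ m)"
  let ?F = "\<lambda>c. Abs_fps (\<lambda>m. ?A m * c ^ m)"
  let ?l = "\<lambda>c :: real. 1 - fps_const c * fps_X"
  have Z: "class_counting_zeta R (F3 d) = ?FC * ?F \<tau> * ?F (real q * \<tau>)"
    by (rule fps_ext) (simp add: class_counting_zeta_def K fps_mult_nth atLeast0AtMost)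
  let ?den = "?l (real q ^ d * \<tau>) * ?l (real q ^ d * (real q * \<tau>)) * ?l (real q ^ C * \<tau>)"
  have "class_counting_zeta R (F3 d) * ?den
      = (?F (real q * \<tau>) * ?l (real q ^ d * (real q * \<tau>))) * (?F \<tau> * ?l (real q ^ d * \<tau>)) * (?FC * ?l (real q ^ C * \<tau>))"
    unfolding Z by (simp only: mult_ac)
  also have "\<dots> = ?l (real q * \<tau>) * ?l \<tau>"
    by (simp only: fps_primitive_count fps_geometric mult_1_right)
  finally have ZD: "class_counting_zeta R (F3 d) * ?den = ?l (real q * \<tau>) * ?l \<tau>" .
  \<comment> \<open>A nonzero denominator makes the division of power series an exact
    cancellation.\<close>
  have "fps_nth ?den 0 = 1"
    by (simp add: fps_mult_nth)
  then have nz: "?den \<noteq> 0"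
    by (metis fps_zero_nth zero_neq_one)
  have main: "class_counting_zeta R (F3 d) = (?l (real q * \<tau>) * ?l \<tau>) / ?den"
    using nonzero_mult_div_cancel_right[OF nz, of "class_counting_zeta R (F3 d)"] unfolding ZD by (rule HOL.sym)
  have q: "real q > 0" using \<open>q > 0\<close> by simp
  have "2 * C + d = d ^ 2" "3 * r + d = d ^ 3"
    unfolding C_def r_def by (rule card_hall2 card_hall3)+
  from this[THEN arg_cong[of _ _ real]]
  have "2 * real C + real d = real d ^ 2" "3 * real r + real d = real d ^ 3"
    by simp_all
  then have Cr: "real C = (real d ^ 2 - real d) / 2" "real r = (real d ^ 3 - real d) / 3"
    by simp_all
  have powr: "real q powr real k = real q ^ k" for k
    using q by (rule powr_realpow)
  have \<tau>: "\<tau> = real q powr (real r - real d)"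
    using q by (simp add: \<tau>_def powr_diff powr)
  have one: "real q = real q powr 1"
    using q by simp
  have e1: "real q * \<tau> = real q powr ((real d - 1) * (real d ^ 2 + real d - 3) / 3)"
    unfolding \<tau> by (subst one, subst powr_add[symmetric])
      (simp add: Cr field_simps monoid_mult_class.power2_eq_square power3_eq_cube)
  have e2: "\<tau> = real q powr ((real d - 2) * real d * (real d + 2) / 3)"
    unfolding \<tau> by (simp add: Cr field_simps monoid_mult_class.power2_eq_square power3_eq_cube)
  have e3: "real q ^ d * \<tau> = real q powr ((real d - 1) * real d * (real d + 1) / 3)"
    unfolding \<tau> powr[symmetric] powr_add[symmetric]
    by (simp add: Cr field_simps monoid_mult_class.power2_eq_square power3_eq_cube)
  have e4: "real q ^ d * (real q * \<tau>) = real q powr ((real d ^ 3 - real d + 3) / 3)"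
    unfolding e1 powr[symmetric] powr_add[symmetric]
    by (simp add: field_simps monoid_mult_class.power2_eq_square power3_eq_cube)
  have e5: "real q ^ C * \<tau> = real q powr ((2 * real d ^ 2 + 3 * real d - 11) * real d / 6)"
    unfolding \<tau> powr[symmetric] powr_add[symmetric]
    by (simp add: Cr field_simps monoid_mult_class.power2_eq_square power3_eq_cube)
  show ?thesis
    \<comment> \<open>The equation for \<tau> alone comes last, since it would destroy the products
      that the other equations match; \<open>e4\<close> is adapted to \<open>e1\<close>, whose left
      side occurs in it.\<close>
    using main unfolding e3 e5 e1 e4[unfolded e1] unfolding e2 .
qed

end
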